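(* Let $n\geq 2$ be an integer and let $G$ be a nonempty finite simple graph without isolated vertices. Then the symbolic power $I(G)^{(n)}$ is Scarf if and only if one of the following holds: (1) $G$ is a path of length $1$ or $2$. (2) $G$ is a triangle and $n$ is even. (3) $G$ is a disjoint union of two edges.
   Context: Let $\Bbbk$ be a field and $S=\Bbbk[V(G)]$ the polynomial ring whose variables are the vertices of $G$. The edge ideal is $I(G)=(xy : \{x,y\}\in E(G))\subseteq S$. Let $\mathcal C(G)$ be the set of minimal vertex covers of $G$, and for $A\subseteq V(G)$ let $\mathfrak p_A$ be the prime ideal generated by the variables in $A$. The $n$-th symbolic power is $I(G)^{(n)}=\bigcap_{A\in\mathcal C(G)}\mathfrak p_A^n$. The length of a path is its number of edges. Scarf ideals: for a monomial ideal $I$ let $\operatorname{Mingens}(I)$ be its set of minimal monomial generators. The Taylor resolution of $S/I$ has free basis $e_\sigma$, $\sigma\subseteq\operatorname{Mingens}(I)$, with $e_\sigma$ in homological degree $|\sigma|$ and $\partial(e_\sigma)=\sum_{j=1}^t(-1)^{j+1}\frac{\operatorname{lcm}(\sigma)}{\operatorname{lcm}(\sigma\setminus\{m_{i_j}\})}e_{\sigma\setminus\{m_{i_j}\}}$ for $\sigma=\{m_{i_1},\dots,m_{i_t}\}$. The Scarf complex of $I$ is the simplicial complex of all $\sigma\subseteq\operatorname{Mingens}(I)$ such that $\operatorname{lcm}(\sigma)\neq\operatorname{lcm}(\tau)$ for every $\tau\subseteq\operatorname{Mingens}(I)$ with $\tau\neq\sigma$. It induces a subcomplex of the Taylor resolution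 (spanned by the $e_\sigma$ with $\sigma$ in the Scarf complex). $I$ is called Scarf if this subcomplex is a minimal free resolution of $S/I$ (equivalently, a free resolution of $S/I$). *)

theory Defs
  imports "HOL-Library.Poly_Mapping" "HOL-Algebra.QuotRing" "HOL-Algebra.Ideal_Product"
begin

section \<open>Polynomial rings and monomials\<close>

text \<open>A monomial is represented by its exponent vector, and a polynomial by its finitely
  supported coefficient function on exponent vectors.\<close>

type_synonym 'v monomial = "'v \<Rightarrow>\<^sub>0 nat"
type_synonym ('v, 'k) mpoly = "'v monomial \<Rightarrow>\<^sub>0 'k"

definition poly_ring :: "'v set \<Rightarrow> ('v, 'k::field) mpoly ring" where
  "poly_ring V =
    \<lparr> carrier = {p. \<forall>m\<in>Poly_Mapping.keys p. Poly_Mapping.keys m \<subseteq> V},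
      mult = (*), one = 1, zero = 0, add = (+) \<rparr>"

definition mpoly_monom :: "'v monomial \<Rightarrow> ('v, 'k::field) mpoly" where
  "mpoly_monom m = Poly_Mapping.single m 1"

definition mpoly_var :: "'v \<Rightarrow> ('v, 'k::field) mpoly" where
  "mpoly_var v = mpoly_monom (Poly_Mapping.single v 1)"

definition mono_dvd :: "'v monomial \<Rightarrow> 'v monomial \<Rightarrow> bool" where
  "mono_dvd m m' \<longleftrightarrow> (\<forall>v. Poly_Mapping.lookup m v \<le> Poly_Mapping.lookup m' v)"

text \<open>The least common multiple of a finite set of monomials; the inserted 0 makes the lcm of
  the empty set the monomial 1.\<close>

definition mono_lcm :: "'v monomial set \<Rightarrow> 'v monomial" where
  "mono_lcm M = Abs_poly_mapping (\<lambda>v. Max (insert 0 ((\<lambda>m. Poly_Mapping.lookup m v) ` M)))"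

lemma lookup_mono_lcm:
  assumes "finite M"
  shows "Poly_Mapping.lookup (mono_lcm M) v = Max (insert 0 ((\<lambda>m. Poly_Mapping.lookup m v) ` M))"
proof -
  have "{v. Max (insert 0 ((\<lambda>m. Poly_Mapping.lookup m v) ` M)) \<noteq> 0}
      \<subseteq> (\<Union>m\<in>M. Poly_Mapping.keys m)"
  proof
    fix v assume v: "v \<in> {v. Max (insert 0 ((\<lambda>m. Poly_Mapping.lookup m v) ` M)) \<noteq> 0}"
    have "Max (insert 0 ((\<lambda>m. Poly_Mapping.lookup m v) ` M))
        \<in> insert 0 ((\<lambda>m. Poly_Mapping.lookup m v) ` M)"
      by (rule Max_in) (use assms in auto)
    with v show "v \<in> (\<Union>m\<in>M. Poly_Mapping.keys m)"
      by (auto simp: in_keys_iff simp del: Max_insert)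
  qed
  then have "finite {v. Max (insert 0 ((\<lambda>m. Poly_Mapping.lookup m v) ` M)) \<noteq> 0}"
    by (rule finite_subset) (use assms in auto)
  then show ?thesis
    unfolding mono_lcm_def by (subst Abs_poly_mapping_inverse) auto
qed

lemma poly_ring_cring: "cring (poly_ring V :: ('v, 'k::field) mpoly ring)"
proof -
  have inv: "\<exists>y\<in>carrier (poly_ring V). y + x = 0"
    if "x \<in> carrier (poly_ring V)" for x :: "('v, 'k) mpoly"
    using that by (intro bexI[of _ "- x"]) (auto simp: poly_ring_def in_keys_iff)
  have mult: "x * y \<in> carrier (poly_ring V)"
    if x: "x \<in> carrier (poly_ring V)" and y: "y \<in> carrier (poly_ring V)"
    for x y :: "('v, 'k) mpoly"
  proof -
    have "Poly_Mapping.keys m \<subseteq> V" if m: "m \<in> Poly_Mapping.keys (x * y)" for m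
    proof -
      obtain a b where ab: "a \<in> Poly_Mapping.keys x" "b \<in> Poly_Mapping.keys y" "m = a + b"
        using m keys_mult[of x y] by blast
      then have "Poly_Mapping.keys m \<subseteq> Poly_Mapping.keys a \<union> Poly_Mapping.keys b"
        using Poly_Mapping.keys_add[of a b] by simp
      then show ?thesis
        using ab x y by (auto simp: poly_ring_def)
    qed
    then show ?thesis by (auto simp: poly_ring_def)
  qed
  have add: "x + y \<in> carrier (poly_ring V)"
    if "x \<in> carrier (poly_ring V)" "y \<in> carrier (poly_ring V)" for x y :: "('v, 'k) mpoly"
    using that Poly_Mapping.keys_add[of x y] by (auto simp: poly_ring_def)
  let ?R = "poly_ring V :: ('v, 'k) mpoly ring"
  have R: "x \<oplus>\<^bsub>?R\<^esub> y = x + y" "x \<otimes>\<^bsub>?R\<^esub> y = x * y" "\<zero>\<^bsub>?R\<^esub> = 0" "\<one>\<^bsub>?R\<^esub> = 1" for x y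
    by (simp_all add: poly_ring_def)
  have "0 \<in> carrier ?R" "1 \<in> carrier ?R"
    by (simp_all add: poly_ring_def)
  then show ?thesis
    by (intro cringI abelian_groupI comm_monoidI)
      (simp_all only: R add mult inv add.assoc mult.assoc add_0_left mult_1_left distrib_right,
        simp_all only: add.commute mult.commute)
qed


section \<open>Graphs and symbolic powers of edge ideals\<close>

definition simple_graph :: "'v set \<Rightarrow> 'v set set \<Rightarrow> bool" where
  "simple_graph V E \<longleftrightarrow> finite V \<and> (\<forall>e\<in>E. e \<subseteq> V \<and> card e = 2)"

definition isolated_vertex :: "'v set set \<Rightarrow> 'v \<Rightarrow> bool" where
  "isolated_vertex E v \<longleftrightarrow> (\<forall>e\<in>E. v \<notin> e)"

definition is_path :: "'v set \<Rightarrow> 'v set set \<Rightarrow> nat \<Rightarrow> bool" where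
  "is_path V E l \<longleftrightarrow> (\<exists>vs. distinct vs \<and> length vs = Suc l \<and> set vs = V \<and>
     E = {{vs ! i, vs ! Suc i} | i. i < l})"

definition is_triangle :: "'v set \<Rightarrow> 'v set set \<Rightarrow> bool" where
  "is_triangle V E \<longleftrightarrow> (\<exists>a b c. distinct [a, b, c] \<and> V = {a, b, c} \<and>
     E = {{a, b}, {b, c}, {a, c}})"

definition is_two_disjoint_edges :: "'v set \<Rightarrow> 'v set set \<Rightarrow> bool" where
  "is_two_disjoint_edges V E \<longleftrightarrow> (\<exists>a b c d. distinct [a, b, c, d] \<and> V = {a, b, c, d} \<and>
     E = {{a, b}, {c, d}})"

definition vertex_cover :: "'v set \<Rightarrow> 'v set set \<Rightarrow> 'v set \<Rightarrow> bool" where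
  "vertex_cover V E A \<longleftrightarrow> A \<subseteq> V \<and> (\<forall>e\<in>E. e \<inter> A \<noteq> {})"

definition minimal_vertex_covers :: "'v set \<Rightarrow> 'v set set \<Rightarrow> 'v set set" where
  "minimal_vertex_covers V E =
    {A. vertex_cover V E A \<and> (\<forall>B. B \<subset> A \<longrightarrow> \<not> vertex_cover V E B)}"

definition variable_ideal :: "'v set \<Rightarrow> 'v set \<Rightarrow> ('v, 'k::field) mpoly set" where
  "variable_ideal V A = Idl\<^bsub>poly_ring V\<^esub> (mpoly_var ` A)"

text \<open>The power is taken in the commutative monoid of ideals, i.e. it is an iterated
  ideal product.\<close>

definition edge_ideal_symbolic_power ::
  "'v set \<Rightarrow> 'v set set \<Rightarrow> nat \<Rightarrow> ('v, 'k::field) mpoly set" where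
  "edge_ideal_symbolic_power V E n =
    (\<Inter>A \<in> minimal_vertex_covers V E. variable_ideal V A [^]\<^bsub>ideals_set (poly_ring V)\<^esub> n)"


section \<open>The Taylor complex and Scarf ideals\<close>

text \<open>The monomials in \<open>I\<close> that are minimal with respect to divisibility. For a monomial ideal
  this is its unique minimal generating set of monomials.\<close>

definition mingens :: "('v, 'k::field) mpoly set \<Rightarrow> 'v monomial set" where
  "mingens I = {m. mpoly_monom m \<in> I \<and> (\<forall>m'. mpoly_monom m' \<in> I \<and> mono_dvd m' m \<longrightarrow> m' = m)}"

definition scarf_complex :: "('v, 'k::field) mpoly set \<Rightarrow> 'v monomial set set" where
  "scarf_complex I = {\<sigma>. \<sigma> \<subseteq> mingens I \<and>
     (\<forall>\<tau>. \<tau> \<subseteq> mingens I \<and> \<tau> \<noteq> \<sigma> \<longrightarrow> mono_lcm \<sigma> \<noteq> mono_lcm \<tau>)}"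

text \<open>Elements of the free module with basis \<open>e\<^sub>\<sigma>\<close> are given by their coordinate functions
  \<open>\<sigma> \<mapsto> c \<sigma>\<close>. The submodule of homological degree \<open>i\<close> spanned by the \<open>e\<^sub>\<sigma>\<close> with \<open>\<sigma> \<in> \<Delta>\<close>:\<close>

definition taylor_chains ::
  "'v set \<Rightarrow> 'v monomial set set \<Rightarrow> nat \<Rightarrow> ('v monomial set \<Rightarrow> ('v, 'k::field) mpoly) set" where
  "taylor_chains V \<Delta> i = {c. (\<forall>\<sigma>. c \<sigma> \<in> carrier (poly_ring V)) \<and>
     (\<forall>\<sigma>. c \<sigma> \<noteq> 0 \<longrightarrow> \<sigma> \<in> \<Delta> \<and> card \<sigma> = i)}"

definition taylor_basis :: "'v monomial set \<Rightarrow> 'v monomial set \<Rightarrow> ('v, 'k::field) mpoly" where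
  "taylor_basis \<sigma> = (\<lambda>\<tau>. if \<tau> = \<sigma> then 1 else 0)"

text \<open>The list \<open>ms\<close> enumerates the minimal generators and fixes the order used for the signs.
  Since list positions start at 0, the sign at position \<open>j\<close> is \<open>(-1) ^ j\<close>.\<close>

definition taylor_boundary ::
  "'v monomial list \<Rightarrow> 'v monomial set \<Rightarrow> 'v monomial set \<Rightarrow> ('v, 'k::field) mpoly" where
  "taylor_boundary ms \<sigma> = (\<lambda>\<tau>. let s = filter (\<lambda>m. m \<in> \<sigma>) ms in
     \<Sum>j<length s. (-1) ^ j * mpoly_monom (mono_lcm \<sigma> - mono_lcm (\<sigma> - {s ! j}))
       * taylor_basis (\<sigma> - {s ! j}) \<tau>)"

definition taylor_diff ::
  "'v monomial list \<Rightarrow> ('v monomial set \<Rightarrow> ('v, 'k::field) mpoly)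
    \<Rightarrow> 'v monomial set \<Rightarrow> ('v, 'k) mpoly" where
  "taylor_diff ms c = (\<lambda>\<tau>. \<Sum>\<sigma> \<in> Pow (set ms). c \<sigma> * taylor_boundary ms \<sigma> \<tau>)"

text \<open>The augmentation onto the quotient by \<open>I\<close>, mapping the basis element of the empty set to
  the class of 1.\<close>

definition augmentation ::
  "'v set \<Rightarrow> ('v, 'k::field) mpoly set \<Rightarrow> ('v monomial set \<Rightarrow> ('v, 'k) mpoly)
    \<Rightarrow> ('v, 'k) mpoly set" where
  "augmentation V I c = I +>\<^bsub>poly_ring V\<^esub> c {}"

text \<open>Exactness of \<open>\<dots> \<rightarrow> F\<^sub>2 \<rightarrow> F\<^sub>1 \<rightarrow> F\<^sub>0 \<rightarrow> S/I \<rightarrow> 0\<close> at every spot.\<close>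

definition is_free_resolution ::
  "'v set \<Rightarrow> ('v, 'k::field) mpoly set \<Rightarrow> 'v monomial list \<Rightarrow> 'v monomial set set \<Rightarrow> bool" where
  "is_free_resolution V I ms \<Delta> \<longleftrightarrow>
     augmentation V I ` taylor_chains V \<Delta> 0 = carrier (poly_ring V Quot I) \<and>
     {c \<in> taylor_chains V \<Delta> 0. augmentation V I c = \<zero>\<^bsub>poly_ring V Quot I\<^esub>}
       = taylor_diff ms ` taylor_chains V \<Delta> 1 \<and>
     (\<forall>i\<ge>1. {c \<in> taylor_chains V \<Delta> i. taylor_diff ms c = (\<lambda>\<tau>. 0 :: ('v, 'k) mpoly)}
       = taylor_diff ms ` taylor_chains V \<Delta> (Suc i))"

text \<open>Minimality: the image of the differential lies in \<open>\<mm> F\<close>, where \<open>\<mm>\<close> is generated by all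
  variables.\<close>

definition is_minimal_free_resolution ::
  "'v set \<Rightarrow> ('v, 'k::field) mpoly set \<Rightarrow> 'v monomial list \<Rightarrow> 'v monomial set set \<Rightarrow> bool" where
  "is_minimal_free_resolution V I ms \<Delta> \<longleftrightarrow> is_free_resolution V I ms \<Delta> \<and>
     (\<forall>i. \<forall>c \<in> taylor_chains V \<Delta> (Suc i).
       \<forall>\<tau>. taylor_diff ms c \<tau> \<in> (variable_ideal V V :: ('v, 'k) mpoly set))"

text \<open>Any two enumerations of the minimal generators give isomorphic complexes, so the choice of
  \<open>ms\<close> is immaterial.\<close>

definition is_scarf :: "'v set \<Rightarrow> ('v, 'k::field) mpoly set \<Rightarrow> bool" where
  "is_scarf V I \<longleftrightarrow> (\<exists>ms. distinct ms \<and> set ms = mingens I \<and>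
     is_minimal_free_resolution V I ms (scarf_complex I))"

end

theory Submission
  imports Defs
begin

text \<open>By counting degrees, the symbolic power is the span of the monomials whose degree on every
  vertex cover is at least \<open>n\<close>; monomials supported on a vertex set \<open>W\<close> only see the covers of the
  induced subgraph on \<open>W\<close>. Exactness of the Scarf complex can be tested one multidegree at a
  time. So if \<open>G\<close> contains a claw, paw, diamond, \<open>K\<^sub>4\<close>, \<open>3K\<^sub>2\<close>, \<open>K\<^sub>3 + K\<^sub>2\<close>
  or a path of length two plus a disjoint edge (or \<open>K\<^sub>3\<close> with \<open>n\<close> odd) as induced subgraph, then in
  a suitable multidegree the Scarf complex is disconnected, and if \<open>G\<close> contains the path or the
  cycle on four vertices, then in a suitable multidegree it is an unfilled square. Every graph outside the list contains one of these. For the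
  graphs in the list the Scarf complex is a tree, and the colon ideals arising when the generators
  are added one by one, away from the root, are principal; this gives exactness.\<close>

text \<open>Every obstruction uses one property of a Scarf face: it contains each generator dividing
  its lcm. A cycle of multidegree \<open>m\<close> can only be filled by faces whose lcm divides
  \<open>m\<close>, and this absorption forces more generators into such a face than it has room
  for.

  The witnesses are built from xy for an edge, which lies in I(G), and xyz for a triangle, which
  lies in the second symbolic power. A configuration found for n = 2 is multiplied by the k-th power
  of one fixed edge, which gives every n = k + 2; this is where n \<ge> 2 enters. The odd triangle
  differs: there the three edges are multiplied by (xyz)^k, and n = 2k + 1.

  That every other graph contains a forbidden one is seen by growing a path a - b - c: a further
  vertex adjacent to it creates a forbidden graph on four vertices, and a further vertex not
  adjacent to it brings an edge apart from the path. If no two edges meet, the graph is a matching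
  and only the number of edges matters.\<close>

abbreviation (input) lookup where "lookup \<equiv> Poly_Mapping.lookup"
abbreviation (input) keys where "keys \<equiv> Poly_Mapping.keys"
abbreviation (input) single where "single \<equiv> Poly_Mapping.single"

section \<open>Monomial ideals\<close>

lemma mono_dvd_refl [simp]: "mono_dvd u u"
  by (simp add: mono_dvd_def)

lemma mono_dvd_trans: "mono_dvd u v \<Longrightarrow> mono_dvd v w \<Longrightarrow> mono_dvd u w"
  unfolding mono_dvd_def by (meson order_trans)

lemma mono_dvd_antisym: "mono_dvd u v \<Longrightarrow> mono_dvd v u \<Longrightarrow> u = v"
  by (rule poly_mapping_eqI) (simp add: mono_dvd_def le_antisym)

lemma mono_dvd_keys: "mono_dvd u v \<Longrightarrow> keys u \<subseteq> keys v"
  by (auto simp: mono_dvd_def in_keys_iff) (metis order.strict_trans2)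

lemma mono_dvd_add [simp]: "mono_dvd u (u + v)" "mono_dvd u (v + u)"
  by (simp_all add: mono_dvd_def lookup_add)

lemma mono_dvd_diff_add: "mono_dvd u v \<Longrightarrow> v - u + u = v"
  by (intro poly_mapping_eqI) (simp add: mono_dvd_def lookup_add lookup_minus)

text \<open>Subtraction of exponents is truncated, so \<open>w - u\<close> is lcm(u, w) / u, the
  generator of the colon ideal (w) : u. In this form colon ideals enter the exactness proof.\<close>

lemma mono_dvd_minus_iff: "mono_dvd (w - u) v \<longleftrightarrow> mono_dvd w (u + v)"
  by (simp add: mono_dvd_def lookup_add lookup_minus le_diff_conv add.commute)

lemma keys_plus_nat: "keys (u + v :: 'v monomial) = keys u \<union> keys v"
  by (auto simp: in_keys_iff lookup_add)

lemma keys_minus_subset: "keys (u - v :: 'v monomial) \<subseteq> keys u"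
  by (auto simp: in_keys_iff lookup_minus)

lemma poly_as_sum: "(p :: 'a \<Rightarrow>\<^sub>0 'b::comm_monoid_add) = (\<Sum>u\<in>keys p. single u (lookup p u))"
  by (intro poly_mapping_eqI)
    (auto simp: lookup_sum lookup_single when_def sum.delta in_keys_iff)

text \<open>Reduces membership to single terms. Asking only for 0 and sums makes it fit sets of
  linear combinations that are never shown to be ideals.\<close>

lemma additive_closure:
  fixes p :: "'a \<Rightarrow>\<^sub>0 'b::comm_monoid_add"
  assumes "0 \<in> J" "\<And>p q. p \<in> J \<Longrightarrow> q \<in> J \<Longrightarrow> p + q \<in> J"
    and "\<And>u. u \<in> keys p \<Longrightarrow> single u (lookup p u) \<in> J"
  shows "p \<in> J"
proof -
  have "(\<Sum>u\<in>A. single u (lookup p u)) \<in> J" if "finite A" "A \<subseteq> keys p" for A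
    using that by (induction A rule: finite_induct) (auto intro: assms)
  then show ?thesis using poly_as_sum[of p] by (metis finite_keys order_refl)
qed

lemma single_eq_times_monom:
  assumes "mono_dvd v u"
  shows "single u c = single (u - v) c * mpoly_monom v"
  by (simp add: mpoly_monom_def mult_single mono_dvd_diff_add[OF assms])

lemma mpoly_monom_mult: "mpoly_monom u * mpoly_monom v = mpoly_monom (u + v)"
  by (simp add: mpoly_monom_def mult_single)

lemma keys_mpoly_monom [simp]: "keys (mpoly_monom u :: ('v, 'k::field) mpoly) = {u}"
  by (simp add: mpoly_monom_def)

text \<open>Multiplying by a monomial only shifts exponents; cancellation of monomials and the
  bookkeeping of multidegrees both come from this.\<close>

lemma lookup_times_monom:
  "lookup (p * mpoly_monom u) (v + u) = lookup p v" for p :: "('v, 'k::field) mpoly"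
proof -
  have "lookup (p * mpoly_monom u) (v + u) =
      (\<Sum>w\<in>keys p. lookup (single w (lookup p w) * mpoly_monom u) (v + u))"
    using arg_cong[OF poly_as_sum[of p], of "\<lambda>q. lookup (q * mpoly_monom u) (v + u)"]
    by (simp only: sum_distrib_right lookup_sum)
  also have "\<dots> = (\<Sum>w\<in>keys p. if w = v then lookup p w else 0)"
    by (intro sum.cong) (auto simp: mpoly_monom_def mult_single lookup_single when_def)
  finally show ?thesis by (simp add: sum.delta in_keys_iff)
qed

lemma keys_times_monom:
  assumes "w \<in> keys (p * mpoly_monom u :: ('v, 'k::field) mpoly)"
  obtains v where "v \<in> keys p" "w = v + u"
  using assms keys_mult[of p "mpoly_monom u"] by auto

lemma times_monom_cancel:
  "p * mpoly_monom u = q * mpoly_monom u \<longleftrightarrow> p = q" for p :: "('v, 'k::field) mpoly"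
  by (auto intro!: poly_mapping_eqI dest: arg_cong[of _ _ "\<lambda>r. lookup r (_ + u)"]
      simp: lookup_times_monom)

lemma times_monom_eq_0_iff [simp]:
  "p * mpoly_monom u = 0 \<longleftrightarrow> p = 0" for p :: "('v, 'k::field) mpoly"
  using times_monom_cancel[of p u 0] by simp

lemma poly_ring_simps [simp]:
  "mult (poly_ring V) = (*)" "one (poly_ring V) = 1" "zero (poly_ring V) = 0"
  "add (poly_ring V) = (+)"
  by (simp_all add: poly_ring_def)

text \<open>A span of monomials, which is an ideal once \<open>Q\<close> is
  \<open>up_closed\<close>. The constantly true \<open>Q\<close> gives the polynomial ring itself,
  so the closure lemmas serve for both.\<close>

definition monomial_ideal :: "'v set \<Rightarrow> ('v monomial \<Rightarrow> bool) \<Rightarrow> ('v, 'k::field) mpoly set" where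
  "monomial_ideal V Q = {p. \<forall>u\<in>keys p. keys u \<subseteq> V \<and> Q u}"

definition up_closed :: "('v monomial \<Rightarrow> bool) \<Rightarrow> bool" where
  "up_closed Q \<longleftrightarrow> (\<forall>u v. Q u \<and> mono_dvd u v \<longrightarrow> Q v)"

lemma carrier_poly_ring: "carrier (poly_ring V) = monomial_ideal V (\<lambda>_. True)"
  by (simp add: poly_ring_def monomial_ideal_def)

lemma monomial_ideal_subset: "monomial_ideal V Q \<subseteq> carrier (poly_ring V)"
  by (auto simp: carrier_poly_ring monomial_ideal_def)

lemma monomial_ideal_zero [simp]: "0 \<in> monomial_ideal V Q"
  by (simp add: monomial_ideal_def)

lemma monomial_ideal_add:
  "p \<in> monomial_ideal V Q \<Longrightarrow> q \<in> monomial_ideal V Q \<Longrightarrow> p + q \<in> monomial_ideal V Q"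
  using Poly_Mapping.keys_add[of p q] by (auto simp: monomial_ideal_def)

lemma monomial_ideal_uminus: "p \<in> monomial_ideal V Q \<Longrightarrow> - p \<in> monomial_ideal V Q"
  by (auto simp: monomial_ideal_def in_keys_iff)

lemma monomial_ideal_mult:
  assumes "p \<in> monomial_ideal V P" "q \<in> monomial_ideal V Q"
    and "\<And>u v. P u \<Longrightarrow> Q v \<Longrightarrow> R (u + v)"
  shows "p * q \<in> monomial_ideal V R"
  using assms keys_mult[of p q] by (fastforce simp: monomial_ideal_def keys_plus_nat)

lemma mpoly_monom_in_monomial_ideal [simp]:
  "mpoly_monom u \<in> monomial_ideal V Q \<longleftrightarrow> keys u \<subseteq> V \<and> Q u"
  by (simp add: monomial_ideal_def)

lemma single_in_monomial_ideal:
  "keys u \<subseteq> V \<Longrightarrow> Q u \<Longrightarrow> single u c \<in> monomial_ideal V Q"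
  by (auto simp: monomial_ideal_def)

lemma carrier_poly_ring_add:
  "p \<in> carrier (poly_ring V) \<Longrightarrow> q \<in> carrier (poly_ring V) \<Longrightarrow> p + q \<in> carrier (poly_ring V)"
  by (simp add: carrier_poly_ring monomial_ideal_add)

lemma carrier_poly_ring_mult:
  "p \<in> carrier (poly_ring V) \<Longrightarrow> q \<in> carrier (poly_ring V) \<Longrightarrow> p * q \<in> carrier (poly_ring V)"
  by (simp add: carrier_poly_ring monomial_ideal_mult)

lemma carrier_poly_ring_uminus:
  "p \<in> carrier (poly_ring V) \<Longrightarrow> - p \<in> carrier (poly_ring V)"
  by (simp add: carrier_poly_ring monomial_ideal_uminus)

lemma carrier_poly_ring_zero [simp]: "0 \<in> carrier (poly_ring V)"
  by (simp add: carrier_poly_ring)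

lemma carrier_poly_ring_one [simp]: "1 \<in> carrier (poly_ring V)"
  by (simp add: poly_ring_def)

lemma carrier_poly_ring_diff:
  "p \<in> carrier (poly_ring V) \<Longrightarrow> q \<in> carrier (poly_ring V) \<Longrightarrow> p - q \<in> carrier (poly_ring V)"
  using carrier_poly_ring_add[of p V "- q"] carrier_poly_ring_uminus[of q V] by simp

lemma mpoly_monom_carrier [simp]: "mpoly_monom u \<in> carrier (poly_ring V) \<longleftrightarrow> keys u \<subseteq> V"
  by (simp add: carrier_poly_ring)

lemma monomial_ideal_ideal:
  assumes "up_closed Q"
  shows "ideal (monomial_ideal V Q :: ('v, 'k::field) mpoly set) (poly_ring V)"
proof -
  interpret cring "poly_ring V :: ('v, 'k) mpoly ring" by (rule poly_ring_cring)
  have mult: "p * q \<in> monomial_ideal V Q" "q * p \<in> monomial_ideal V Q"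
    if "p \<in> carrier (poly_ring V)" "q \<in> monomial_ideal V Q" for p q :: "('v, 'k) mpoly"
    using that assms
    by (auto simp: carrier_poly_ring up_closed_def intro!: monomial_ideal_mult
        intro: mono_dvd_add)
  have inv: "\<ominus>\<^bsub>poly_ring V\<^esub> p = - p" if "p \<in> carrier (poly_ring V)" for p :: "('v, 'k) mpoly"
    using that by (intro minus_equality) (auto simp: carrier_poly_ring_uminus)
  show ?thesis
  proof (intro idealI ring_axioms add.subgroupI)
    fix p :: "('v, 'k) mpoly" assume "p \<in> monomial_ideal V Q"
    then show "\<ominus>\<^bsub>poly_ring V\<^esub> p \<in> monomial_ideal V Q"
      using monomial_ideal_subset[of V Q] by (subst inv) (auto intro: monomial_ideal_uminus)
  next
    show "monomial_ideal V Q \<noteq> ({} :: ('v, 'k) mpoly set)"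
      using monomial_ideal_zero by blast
  qed (use mult monomial_ideal_subset[of V Q] in \<open>auto intro: monomial_ideal_add\<close>)
qed

section \<open>Symbolic powers of edge ideals\<close>

definition deg_on :: "'v set \<Rightarrow> 'v monomial \<Rightarrow> nat" where
  "deg_on A u = (\<Sum>v\<in>A. lookup u v)"

lemma deg_on_add [simp]: "deg_on A (u + v) = deg_on A u + deg_on A v"
  by (simp add: deg_on_def lookup_add sum.distrib)

lemma deg_on_mono: "mono_dvd u v \<Longrightarrow> deg_on A u \<le> deg_on A v"
  by (auto simp: deg_on_def mono_dvd_def intro: sum_mono)

lemma up_closed_deg_on: "up_closed (\<lambda>u. k \<le> deg_on A u)"
  unfolding up_closed_def by (meson deg_on_mono order_trans)

lemma deg_on_single: "finite A \<Longrightarrow> v \<in> A \<Longrightarrow> deg_on A (single v 1) = 1"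
  by (simp add: deg_on_def lookup_single when_def)

lemma deg_on_posE:
  assumes "Suc k \<le> deg_on A u"
  obtains v where "v \<in> A" "mono_dvd (single v 1) u"
proof -
  have "\<exists>v\<in>A. lookup u v \<noteq> 0"
  proof (rule ccontr)
    assume "\<not> ?thesis"
    then have "deg_on A u = 0" by (simp add: deg_on_def)
    with assms show False by simp
  qed
  then show ?thesis
    by (auto intro!: that simp: mono_dvd_def lookup_single when_def)
qed

lemma variable_ideal_eq:
  assumes "finite A" "A \<subseteq> V"
  shows "variable_ideal V A = (monomial_ideal V (\<lambda>u. 1 \<le> deg_on A u) :: ('v, 'k::field) mpoly set)"
proof
  interpret cring "poly_ring V :: ('v, 'k) mpoly ring" by (rule poly_ring_cring)
  let ?M = "monomial_ideal V (\<lambda>u. 1 \<le> deg_on A u) :: ('v, 'k) mpoly set"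
  have sub: "mpoly_var ` A \<subseteq> ?M"
    using assms by (auto simp: mpoly_var_def deg_on_single[simplified])
  show "variable_ideal V A \<subseteq> ?M"
    unfolding variable_ideal_def
    by (rule genideal_minimal[OF monomial_ideal_ideal[OF up_closed_deg_on] sub])
  have carr: "mpoly_var ` A \<subseteq> carrier (poly_ring V :: ('v, 'k) mpoly ring)"
    using sub monomial_ideal_subset by blast
  interpret I: ideal "variable_ideal V A :: ('v, 'k) mpoly set" "poly_ring V"
    unfolding variable_ideal_def by (rule genideal_ideal[OF carr])
  have var: "mpoly_var v \<in> (variable_ideal V A :: ('v, 'k) mpoly set)" if "v \<in> A" for v
    unfolding variable_ideal_def using genideal_self[OF carr] that by blast
  show "?M \<subseteq> variable_ideal V A"
  proof
    fix p :: "('v, 'k) mpoly" assume p: "p \<in> ?M"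
    show "p \<in> variable_ideal V A"
    proof (rule additive_closure)
      fix u assume u: "u \<in> keys p"
      then have "Suc 0 \<le> deg_on A u" using p by (auto simp: monomial_ideal_def)
      then obtain v where v: "v \<in> A" "mono_dvd (single v 1) u" by (rule deg_on_posE)
      have "single (u - single v 1) (lookup p u) \<in> carrier (poly_ring V :: ('v, 'k) mpoly ring)"
        using u p keys_minus_subset[of u "single v 1"] unfolding carrier_poly_ring
        by (intro single_in_monomial_ideal) (auto simp: monomial_ideal_def)
      then show "single u (lookup p u) \<in> variable_ideal V A"
        unfolding single_eq_times_monom[OF v(2), of "lookup p u"]
        using I.I_l_closed[OF var[OF v(1)]] by (simp add: mpoly_var_def)
    qed (use I.zero_closed I.a_closed in auto)
  qed
qed

text \<open>Degrees on \<open>A\<close> add up under products; conversely a monomial of degree at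
  least \<open>Suc k\<close> on \<open>A\<close> splits off one variable from \<open>A\<close> and
  keeps degree at least \<open>k\<close>.\<close>

lemma ideal_prod_monomial_ideal:
  "monomial_ideal V (\<lambda>u. k \<le> deg_on A u) \<cdot>\<^bsub>poly_ring V\<^esub> monomial_ideal V (\<lambda>u. 1 \<le> deg_on A u)
    = (monomial_ideal V (\<lambda>u. Suc k \<le> deg_on A u) :: ('v, 'k::field) mpoly set)"
  (is "ideal_prod ?R ?I ?J = ?K")
proof
  interpret cring ?R by (rule poly_ring_cring)
  show "ideal_prod ?R ?I ?J \<subseteq> ?K"
  proof
    fix p assume "p \<in> ideal_prod ?R ?I ?J"
    then show "p \<in> ?K"
      by induction (auto intro: monomial_ideal_add intro!: monomial_ideal_mult)
  qed
  interpret I: ideal "ideal_prod ?R ?I ?J" ?R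
    by (intro ideal_prod_is_ideal monomial_ideal_ideal up_closed_deg_on)
  show "?K \<subseteq> ideal_prod ?R ?I ?J"
  proof
    fix p assume p: "p \<in> ?K"
    show "p \<in> ideal_prod ?R ?I ?J"
    proof (rule additive_closure)
      fix u assume u: "u \<in> keys p"
      then have *: "Suc k \<le> deg_on A u" "keys u \<subseteq> V" using p by (auto simp: monomial_ideal_def)
      obtain v where v: "v \<in> A" "mono_dvd (single v 1) u" by (rule deg_on_posE[OF *(1)])
      \<comment> \<open>Over an infinite \<open>A\<close> the sum \<open>deg_on A u\<close> is 0 by
        convention, which contradicts the positive degree.\<close>
      have fin: "finite A"
        using *(1) by (cases "finite A") (auto simp: deg_on_def)
      have "deg_on A (u - single v 1 + single v 1) = deg_on A u"
        by (simp only: mono_dvd_diff_add[OF v(2)])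
      then have "deg_on A (u - single v 1) + 1 = deg_on A u"
        by (simp only: deg_on_add deg_on_single[OF fin v(1)])
      then have "single (u - single v 1) (lookup p u) \<in> ?I"
        using * keys_minus_subset[of u "single v 1"]
        by (intro single_in_monomial_ideal) auto
      moreover have "v \<in> V"
        using mono_dvd_keys[OF v(2)] *(2) by auto
      then have "mpoly_monom (single v 1) \<in> ?J"
        by (auto simp: deg_on_single[OF fin v(1), simplified])
      ultimately show "single u (lookup p u) \<in> ideal_prod ?R ?I ?J"
        unfolding single_eq_times_monom[OF v(2), of "lookup p u"]
        by (rule ideal_prod.prod[of _ ?I _ ?J ?R, unfolded poly_ring_simps(1)])
    qed (use I.zero_closed I.a_closed in auto)
  qed
qed

lemma variable_ideal_pow:
  assumes "finite A" "A \<subseteq> V"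
  shows "variable_ideal V A [^]\<^bsub>ideals_set (poly_ring V)\<^esub> n
    = (monomial_ideal V (\<lambda>u. n \<le> deg_on A u) :: ('v, 'k::field) mpoly set)"
proof (induction n)
  case 0
  show ?case by (simp add: nat_pow_def ideals_set_def carrier_poly_ring)
next
  case (Suc n)
  have "variable_ideal V A [^]\<^bsub>ideals_set (poly_ring V)\<^esub> Suc n
    = (variable_ideal V A [^]\<^bsub>ideals_set (poly_ring V)\<^esub> n) \<cdot>\<^bsub>poly_ring V\<^esub>
      (variable_ideal V A :: ('v, 'k::field) mpoly set)"
    by (simp add: nat_pow_def ideals_set_def)
  then show ?case
    unfolding Suc by (simp only: variable_ideal_eq[OF assms] ideal_prod_monomial_ideal)
qed

text \<open>All covers occur here, not only the minimal ones. The condition is the same because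
  degrees grow with the cover, and all covers are convenient when a cover has to be enlarged outside
  an induced subgraph.\<close>

definition in_symb :: "'v set \<Rightarrow> 'v set set \<Rightarrow> nat \<Rightarrow> 'v monomial \<Rightarrow> bool" where
  "in_symb V E n u \<longleftrightarrow> (\<forall>A. vertex_cover V E A \<longrightarrow> n \<le> deg_on A u)"

lemma up_closed_in_symb: "up_closed (in_symb V E n)"
  unfolding up_closed_def in_symb_def by (meson deg_on_mono order_trans)

lemma minimal_vertex_cover_below:
  assumes "finite V" "vertex_cover V E A"
  obtains B where "B \<subseteq> A" "B \<in> minimal_vertex_covers V E"
proof -
  have "finite A" using assms by (auto simp: vertex_cover_def intro: finite_subset[of A V])
  then have "\<exists>B\<subseteq>A. B \<in> minimal_vertex_covers V E" using assms(2)
  proof (induction A rule: finite_psubset_induct)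
    case (psubset A)
    show ?case
    proof (cases "A \<in> minimal_vertex_covers V E")
      case False
      then obtain B where "B \<subset> A" "vertex_cover V E B"
        using psubset.prems by (auto simp: minimal_vertex_covers_def)
      then obtain C where "C \<subseteq> B" "C \<in> minimal_vertex_covers V E"
        using psubset.IH by meson
      with \<open>B \<subset> A\<close> show ?thesis by (intro exI[of _ C]) auto
    qed (intro exI[of _ A], simp)
  qed
  then show ?thesis using that by meson
qed

lemma vertex_cover_all_vertices:
  assumes "simple_graph V E"
  shows "vertex_cover V E V"
  unfolding vertex_cover_def
proof (intro conjI ballI)
  fix e assume "e \<in> E"
  then have "e \<subseteq> V" "card e = 2" using assms by (auto simp: simple_graph_def)
  then show "e \<inter> V \<noteq> {}" by (metis Int_absorb2 card.empty zero_neq_numeral)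
qed auto

lemma symbolic_power_eq:
  assumes "simple_graph V E"
  shows "edge_ideal_symbolic_power V E n
    = (monomial_ideal V (in_symb V E n) :: ('v, 'k::field) mpoly set)"
proof -
  have fin: "finite V" using assms by (simp add: simple_graph_def)
  have "edge_ideal_symbolic_power V E n =
      (\<Inter>A\<in>minimal_vertex_covers V E. monomial_ideal V (\<lambda>u. n \<le> deg_on A u) :: ('v, 'k) mpoly set)"
    unfolding edge_ideal_symbolic_power_def
    by (intro INF_cong refl variable_ideal_pow)
      (auto simp: minimal_vertex_covers_def vertex_cover_def intro: finite_subset[OF _ fin])
  also have "\<dots> = monomial_ideal V (in_symb V E n)"
  proof (rule equalityI; rule subsetI)
    fix p :: "('v, 'k) mpoly"
    assume p: "p \<in> (\<Inter>A\<in>minimal_vertex_covers V E. monomial_ideal V (\<lambda>u. n \<le> deg_on A u))"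
    show "p \<in> monomial_ideal V (in_symb V E n)"
      unfolding monomial_ideal_def in_symb_def
    proof (intro CollectI ballI conjI allI impI)
      fix u assume u: "u \<in> keys p"
      \<comment> \<open>Some minimal cover must exist: the intersection over an empty family would
        be the whole type, and the support could leave \<open>V\<close>.\<close>
      obtain B where "B \<in> minimal_vertex_covers V E"
        using minimal_vertex_cover_below[OF fin vertex_cover_all_vertices[OF assms]] by blast
      then show "keys u \<subseteq> V" using p u by (auto simp: monomial_ideal_def)
      fix A assume A: "vertex_cover V E A"
      obtain B where B: "B \<subseteq> A" "B \<in> minimal_vertex_covers V E"
        using minimal_vertex_cover_below[OF fin A] .
      have "n \<le> deg_on B u" using p u B by (auto simp: monomial_ideal_def)
      also have "\<dots> \<le> deg_on A u"
        unfolding deg_on_def using B A fin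
        by (intro sum_mono2) (auto simp: vertex_cover_def intro: finite_subset[OF _ fin])
      finally show "n \<le> deg_on A u" .
    qed
  qed (auto simp: monomial_ideal_def in_symb_def minimal_vertex_covers_def)
  finally show ?thesis .
qed

section \<open>Least common multiples and the Scarf complex\<close>

lemma mono_lcm_dvd_iff:
  assumes "finite \<sigma>"
  shows "mono_dvd (mono_lcm \<sigma>) m \<longleftrightarrow> (\<forall>g\<in>\<sigma>. mono_dvd g m)"
  using assms by (auto simp: mono_dvd_def lookup_mono_lcm)

lemma dvd_mono_lcm: "finite \<sigma> \<Longrightarrow> g \<in> \<sigma> \<Longrightarrow> mono_dvd g (mono_lcm \<sigma>)"
  using mono_lcm_dvd_iff mono_dvd_refl by blast

lemma mono_lcm_mono: "finite \<tau> \<Longrightarrow> \<sigma> \<subseteq> \<tau> \<Longrightarrow> mono_dvd (mono_lcm \<sigma>) (mono_lcm \<tau>)"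
  by (auto simp: mono_lcm_dvd_iff[OF finite_subset] intro: dvd_mono_lcm)

lemma mono_lcm_empty [simp]: "mono_lcm {} = 0"
  by (rule poly_mapping_eqI) (simp add: lookup_mono_lcm)

lemma mono_lcm_single [simp]: "mono_lcm {g} = g"
  by (rule poly_mapping_eqI) (simp add: lookup_mono_lcm)

lemma lookup_mono_lcm_pair [simp]: "lookup (mono_lcm {g, h}) v = max (lookup g v) (lookup h v)"
  by (simp add: lookup_mono_lcm)

lemma keys_mono_lcm: "finite \<sigma> \<Longrightarrow> (\<And>g. g \<in> \<sigma> \<Longrightarrow> keys g \<subseteq> V) \<Longrightarrow> keys (mono_lcm \<sigma>) \<subseteq> V"
proof
  fix v assume *: "finite \<sigma>" "\<And>g. g \<in> \<sigma> \<Longrightarrow> keys g \<subseteq> V" "v \<in> keys (mono_lcm \<sigma>)"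
  have "Max (insert 0 ((\<lambda>m. lookup m v) ` \<sigma>)) \<in> insert 0 ((\<lambda>m. lookup m v) ` \<sigma>)"
    by (rule Max_in) (use * in auto)
  then show "v \<in> V"
    using *(2,3) by (force simp: in_keys_iff lookup_mono_lcm[OF *(1)] simp del: Max_insert)
qed

lemma mingens_antichain:
  "g \<in> mingens I \<Longrightarrow> h \<in> mingens I \<Longrightarrow> mono_dvd g h \<Longrightarrow> g = h"
  by (simp add: mingens_def)

lemma scarf_complex_finite: "finite (mingens I) \<Longrightarrow> \<sigma> \<in> scarf_complex I \<Longrightarrow> finite \<sigma>"
  by (auto simp: scarf_complex_def intro: rev_finite_subset[of "mingens I"])

text \<open>Adjoining such a \<open>g\<close> would produce a second set with the same lcm. All the
  obstruction arguments end with this absorption.\<close>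

lemma scarf_complex_absorb:
  assumes "finite (mingens I)" "\<sigma> \<in> scarf_complex I" "g \<in> mingens I" "mono_dvd g (mono_lcm \<sigma>)"
  shows "g \<in> \<sigma>"
proof (rule ccontr)
  assume "g \<notin> \<sigma>"
  have fin: "finite \<sigma>" by (rule scarf_complex_finite) fact+
  have "mono_lcm (insert g \<sigma>) = mono_lcm \<sigma>"
    using assms(4) fin
    by (intro mono_dvd_antisym) (auto simp: mono_lcm_dvd_iff dvd_mono_lcm intro: mono_lcm_mono)
  then show False
    using assms \<open>g \<notin> \<sigma>\<close> unfolding scarf_complex_def
    by (metis (mono_tags, lifting) insertI1 insert_subset mem_Collect_eq)
qed

text \<open>Otherwise dropping \<open>g\<close> would keep the lcm. This is also why the
  differential on Scarf faces has no unit entries.\<close>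

lemma scarf_complex_irredundant:
  assumes "finite (mingens I)" "\<sigma> \<in> scarf_complex I" "g \<in> \<sigma>"
  shows "\<not> mono_dvd g (mono_lcm (\<sigma> - {g}))"
proof
  assume dvd: "mono_dvd g (mono_lcm (\<sigma> - {g}))"
  have fin: "finite \<sigma>" by (rule scarf_complex_finite) fact+
  have "mono_lcm \<sigma> = mono_lcm (\<sigma> - {g})"
  proof (rule mono_dvd_antisym)
    show "mono_dvd (mono_lcm \<sigma>) (mono_lcm (\<sigma> - {g}))"
      using dvd fin dvd_mono_lcm[of "\<sigma> - {g}"] by (auto simp: mono_lcm_dvd_iff)
  qed (use fin in \<open>auto intro: mono_lcm_mono\<close>)
  moreover have "\<sigma> - {g} \<subseteq> mingens I" "\<sigma> - {g} \<noteq> \<sigma>"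
    using assms by (auto simp: scarf_complex_def)
  ultimately show False using assms(2) by (auto simp: scarf_complex_def)
qed

text \<open>A competitor \<rho> with the lcm of \<tau> is absorbed into \<sigma>, and then an
  element in which \<rho> and \<tau> differ would be redundant in \<sigma>.\<close>

lemma scarf_complex_subset:
  assumes "finite (mingens I)" "\<sigma> \<in> scarf_complex I" "\<tau> \<subseteq> \<sigma>"
  shows "\<tau> \<in> scarf_complex I"
proof -
  have fin: "finite \<sigma>" by (rule scarf_complex_finite) fact+
  have sub: "\<sigma> \<subseteq> mingens I" using assms(2) by (simp add: scarf_complex_def)
  have "mono_lcm \<tau> \<noteq> mono_lcm \<rho>" if \<rho>: "\<rho> \<subseteq> mingens I" "\<rho> \<noteq> \<tau>" for \<rho>
  proof
    assume eq: "mono_lcm \<tau> = mono_lcm \<rho>"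
    have finr: "finite \<rho>" using \<rho>(1) assms(1) by (rule finite_subset)
    have "g \<in> \<sigma>" if "g \<in> \<rho>" for g
    proof (rule scarf_complex_absorb[OF assms(1,2)])
      show "mono_dvd g (mono_lcm \<sigma>)"
        using dvd_mono_lcm[OF finr that] mono_lcm_mono[OF fin assms(3)] eq
        by (auto intro: mono_dvd_trans)
    qed (use that \<rho>(1) in auto)
    then have "\<rho> \<subseteq> \<sigma>" by blast
    have dvd: "mono_dvd g (mono_lcm \<tau>)" "mono_dvd g (mono_lcm \<rho>)" if "g \<in> \<tau> \<union> \<rho>" for g
      using that eq dvd_mono_lcm[OF finr] dvd_mono_lcm[OF finite_subset[OF assms(3) fin]] by auto
    \<comment> \<open>\<open>g\<close> lies in the symmetric difference and \<tau>' is the one of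
      the two sets that omits it. Both have the same lcm, so \<open>g\<close> divides the lcm of
      \<tau>' all the same.\<close>
    obtain g \<tau>' where *: "g \<in> \<tau> \<union> \<rho>" "\<tau>' \<subseteq> \<sigma> - {g}" "\<tau>' = \<tau> \<or> \<tau>' = \<rho>"
      using \<rho>(2) assms(3) \<open>\<rho> \<subseteq> \<sigma>\<close> by blast
    have "mono_dvd g (mono_lcm \<tau>')" using *(3) dvd[OF *(1)] by blast
    then have "mono_dvd g (mono_lcm (\<sigma> - {g}))"
      by (rule mono_dvd_trans[OF _ mono_lcm_mono[OF _ *(2)]]) (use fin in simp)
    moreover have "g \<in> \<sigma>" using *(1) assms(3) \<open>\<rho> \<subseteq> \<sigma>\<close> by blast
    ultimately show False using scarf_complex_irredundant[OF assms(1,2)] by blast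
  qed
  then show ?thesis using sub assms(3) by (auto simp: scarf_complex_def)
qed

lemma empty_in_scarf_complex:
  assumes "finite (mingens I)" "0 \<notin> mingens I"
  shows "{} \<in> scarf_complex I"
proof -
  have "0 \<noteq> mono_lcm \<tau>" if \<tau>: "\<tau> \<subseteq> mingens I" "\<tau> \<noteq> {}" for \<tau>
  proof
    assume "0 = mono_lcm \<tau>"
    then obtain g where "g \<in> \<tau>" "mono_dvd g 0"
      using \<tau> dvd_mono_lcm[OF finite_subset[OF \<tau>(1) assms(1)]] by (metis ex_in_conv)
    then show False
      using mono_dvd_antisym[of g 0] \<tau>(1) assms(2) by (auto simp: mono_dvd_def)
  qed
  then show ?thesis by (auto simp: scarf_complex_def)
qed

lemma singleton_in_scarf_complex:
  assumes "finite (mingens I)" "0 \<notin> mingens I" "g \<in> mingens I"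
  shows "{g} \<in> scarf_complex I"
proof -
  have "g \<noteq> mono_lcm \<tau>" if \<tau>: "\<tau> \<subseteq> mingens I" "\<tau> \<noteq> {g}" for \<tau>
  proof
    assume eq: "g = mono_lcm \<tau>"
    have "\<tau> \<noteq> {}" using eq assms by auto
    moreover have "\<tau> \<subseteq> {g}"
      using eq dvd_mono_lcm[OF finite_subset[OF \<tau>(1) assms(1)]] mingens_antichain[of _ I g]
        assms(3) \<tau>(1) by blast
    ultimately show False using \<tau>(2) by blast
  qed
  then show ?thesis using assms by (auto simp: scarf_complex_def)
qed

text \<open>By \<open>third\<close>, a set with the same lcm lies inside {g, h}. If it is smaller,
  its lcm divides \<open>g\<close> or \<open>h\<close>, so one of the two generators divides the
  other.\<close>

lemma edge_in_scarf_complex: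
  assumes "finite (mingens I)" "g \<in> mingens I" "h \<in> mingens I" "g \<noteq> h"
    and third: "\<And>k. k \<in> mingens I \<Longrightarrow> mono_dvd k (mono_lcm {g, h}) \<Longrightarrow> k = g \<or> k = h"
  shows "{g, h} \<in> scarf_complex I"
proof -
  have "mono_lcm {g, h} \<noteq> mono_lcm \<tau>" if \<tau>: "\<tau> \<subseteq> mingens I" "\<tau> \<noteq> {g, h}" for \<tau>
  proof
    assume eq: "mono_lcm {g, h} = mono_lcm \<tau>"
    have "\<tau> \<subseteq> {g, h}"
      using third dvd_mono_lcm[OF finite_subset[OF \<tau>(1) assms(1)]] \<tau>(1)
      unfolding eq by blast
    then have "\<tau> \<subseteq> {g} \<or> \<tau> \<subseteq> {h}" using \<tau>(2) by blast
    then have "mono_dvd (mono_lcm \<tau>) g \<or> mono_dvd (mono_lcm \<tau>) h"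
      using mono_lcm_mono[of "{g}" \<tau>] mono_lcm_mono[of "{h}" \<tau>] by auto
    moreover have "mono_dvd g (mono_lcm \<tau>)" "mono_dvd h (mono_lcm \<tau>)"
      unfolding eq[symmetric] by (simp_all add: dvd_mono_lcm)
    ultimately have "mono_dvd h g \<or> mono_dvd g h"
      using mono_dvd_trans[of _ "mono_lcm \<tau>"] by blast
    then show False using mingens_antichain assms(2-4) by blast
  qed
  then show ?thesis using assms by (auto simp: scarf_complex_def)
qed


section \<open>The Taylor differential\<close>

definition chain_single :: "('v, 'k::field) mpoly \<Rightarrow> 'v monomial set \<Rightarrow> 'v monomial set \<Rightarrow> ('v, 'k) mpoly"
  where "chain_single q \<sigma> = (\<lambda>\<tau>. if \<tau> = \<sigma> then q else 0)"

lemma taylor_diff_single: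
  assumes "\<sigma> \<subseteq> set ms"
  shows "taylor_diff ms (chain_single q \<sigma>) = (\<lambda>\<tau>. q * taylor_boundary ms \<sigma> \<tau>)"
  using assms
  by (auto simp: taylor_diff_def chain_single_def if_distrib[of "\<lambda>x. x * _"] sum.delta cong: if_cong)

lemma taylor_diff_add:
  "taylor_diff ms (\<lambda>\<sigma>. c \<sigma> + d \<sigma>) = (\<lambda>\<tau>. taylor_diff ms c \<tau> + taylor_diff ms d \<tau>)"
  by (simp add: taylor_diff_def distrib_right sum.distrib)

lemma taylor_diff_zero: "taylor_diff ms (\<lambda>_. 0) = (\<lambda>_. 0)"
  by (simp add: taylor_diff_def)

lemma taylor_chains_single:
  "q \<in> carrier (poly_ring V) \<Longrightarrow> \<sigma> \<in> \<Delta> \<Longrightarrow> chain_single q \<sigma> \<in> taylor_chains V \<Delta> (card \<sigma>)"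
  by (auto simp: taylor_chains_def chain_single_def)

lemma taylor_chains_add:
  "c \<in> taylor_chains V \<Delta> i \<Longrightarrow> d \<in> taylor_chains V \<Delta> i \<Longrightarrow> (\<lambda>\<sigma>. c \<sigma> + d \<sigma>) \<in> taylor_chains V \<Delta> i"
  unfolding taylor_chains_def by (auto intro: carrier_poly_ring_add) (metis add.right_neutral)+

lemma taylor_chains_diff:
  "c \<in> taylor_chains V \<Delta> i \<Longrightarrow> d \<in> taylor_chains V \<Delta> i \<Longrightarrow> (\<lambda>\<sigma>. c \<sigma> - d \<sigma>) \<in> taylor_chains V \<Delta> i"
  unfolding taylor_chains_def by (auto intro: carrier_poly_ring_diff) (metis eq_iff_diff_eq_0)+

lemma carrier_sum:
  "(\<And>x. x \<in> A \<Longrightarrow> f x \<in> carrier (poly_ring V)) \<Longrightarrow> sum f A \<in> carrier (poly_ring V)"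
  by (induction A rule: infinite_finite_induct) (auto intro: carrier_poly_ring_add)

lemma neg_one_power_carrier: "(- 1) ^ j \<in> carrier (poly_ring V)"
  by (induction j) (auto intro: carrier_poly_ring_uminus)

text \<open>Separates the monomial of a boundary coefficient from its signs: \<open>k\<close> only
  collects signs, which is enough for arguments about multidegrees and supports.\<close>

lemma taylor_boundary_factor:
  obtains k :: "('v, 'k::field) mpoly" where "k \<in> carrier (poly_ring V)"
    "taylor_boundary ms \<sigma> \<tau> = k * mpoly_monom (mono_lcm \<sigma> - mono_lcm \<tau>)"
    "k \<noteq> 0 \<longrightarrow> (\<exists>g\<in>\<sigma>. \<tau> = \<sigma> - {g})"
proof -
  define s where "s = filter (\<lambda>m. m \<in> \<sigma>) ms"
  define k :: "('v, 'k) mpoly" where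
    "k = (\<Sum>j<length s. (- 1) ^ j * (if \<tau> = \<sigma> - {s ! j} then 1 else 0))"
  have "k \<in> carrier (poly_ring V)"
    unfolding k_def by (intro carrier_sum carrier_poly_ring_mult neg_one_power_carrier) auto
  moreover have "taylor_boundary ms \<sigma> \<tau> = k * mpoly_monom (mono_lcm \<sigma> - mono_lcm \<tau>)"
    unfolding taylor_boundary_def Let_def s_def[symmetric] k_def taylor_basis_def sum_distrib_right
    by (intro sum.cong) auto
  moreover have "\<exists>g\<in>\<sigma>. \<tau> = \<sigma> - {g}" if "k \<noteq> 0"
  proof -
    have "\<exists>j<length s. \<tau> = \<sigma> - {s ! j}"
    proof (rule ccontr)
      assume "\<not> ?thesis"
      then have "k = 0" unfolding k_def by (intro sum.neutral) auto
      with that show False by simp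
    qed
    then obtain j where j: "j < length s" "\<tau> = \<sigma> - {s ! j}" by blast
    have "s ! j \<in> \<sigma>" using nth_mem[OF j(1)] by (simp add: s_def)
    then show ?thesis using j(2) by blast
  qed
  ultimately show ?thesis by (intro that[of k]) auto
qed

lemma filter_singleton:
  assumes "distinct ms" "g \<in> set ms"
  shows "filter (\<lambda>m. m \<in> {g}) ms = [g]"
proof -
  have "set (filter (\<lambda>m. m \<in> {g}) ms) = {g}" using assms(2) by auto
  then have "length (filter (\<lambda>m. m \<in> {g}) ms) = card {g}"
    using distinct_card[of "filter (\<lambda>m. m \<in> {g}) ms"] assms(1) by simp
  then obtain x where "filter (\<lambda>m. m \<in> {g}) ms = [x]"
    by (auto simp: length_Suc_conv)
  with \<open>set (filter (\<lambda>m. m \<in> {g}) ms) = {g}\<close> show ?thesis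
    by (metis list.set_intros(1) singletonD)
qed

lemma filter_pair:
  assumes "distinct ms" "g \<in> set ms" "h \<in> set ms" "g \<noteq> h"
  shows "filter (\<lambda>m. m \<in> {g, h}) ms = [g, h] \<or> filter (\<lambda>m. m \<in> {g, h}) ms = [h, g]"
proof -
  let ?s = "filter (\<lambda>m. m \<in> {g, h}) ms"
  have set: "set ?s = {g, h}" using assms by auto
  have dist: "distinct ?s" using assms by simp
  have "length ?s = 2"
    using distinct_card[OF dist] set assms(4) by simp
  then obtain x y where xy: "?s = [x, y]"
    by (auto simp: length_Suc_conv numeral_2_eq_2)
  then have "{x, y} = {g, h}" using set by simp
  then show ?thesis unfolding xy by (auto simp: doubleton_eq_iff)
qed

lemma taylor_boundary_singleton:
  assumes "distinct ms" "g \<in> set ms"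
  shows "taylor_boundary ms {g} \<tau> = (if \<tau> = {} then mpoly_monom g else 0)"
  unfolding taylor_boundary_def filter_singleton[OF assms]
  by (simp add: taylor_basis_def)

text \<open>\<epsilon> records which of \<open>g\<close> and \<open>h\<close> comes first in
  \<open>ms\<close>. Later it is used only as an invertible sign, so the enumeration has no
  influence.\<close>

lemma taylor_boundary_pair:
  assumes "distinct ms" "g \<in> set ms" "h \<in> set ms" "g \<noteq> h"
  obtains \<epsilon> :: "('v, 'k::field) mpoly" where "\<epsilon> = 1 \<or> \<epsilon> = - 1"
    "\<And>\<tau>. taylor_boundary ms {g, h} \<tau> = \<epsilon> *
       ((if \<tau> = {h} then mpoly_monom (mono_lcm {g, h} - h) else 0)
        - (if \<tau> = {g} then mpoly_monom (mono_lcm {g, h} - g) else 0))"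
proof (cases "filter (\<lambda>m. m \<in> {g, h}) ms = [g, h]")
  case True
  have [simp]: "{g, h} - {g} = {h}" "{g, h} - {h} = {g}" using assms(4) by auto
  have "taylor_boundary ms {g, h} \<tau> = 1 *
       ((if \<tau> = {h} then mpoly_monom (mono_lcm {g, h} - h) else 0)
        - (if \<tau> = {g} then mpoly_monom (mono_lcm {g, h} - g) else 0 :: ('v, 'k) mpoly))" for \<tau>
    unfolding taylor_boundary_def True Let_def
    by (simp add: taylor_basis_def lessThan_Suc numeral_2_eq_2)
  then show ?thesis using that[of 1] by blast
next
  case False
  then have F: "filter (\<lambda>m. m \<in> {g, h}) ms = [h, g]" using filter_pair[OF assms] by blast
  have [simp]: "{g, h} - {g} = {h}" "{g, h} - {h} = {g}" using assms(4) by auto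
  have "taylor_boundary ms {g, h} \<tau> = - 1 *
       ((if \<tau> = {h} then mpoly_monom (mono_lcm {g, h} - h) else 0)
        - (if \<tau> = {g} then mpoly_monom (mono_lcm {g, h} - g) else 0 :: ('v, 'k) mpoly))" for \<tau>
    unfolding taylor_boundary_def F Let_def
    by (simp add: taylor_basis_def lessThan_Suc numeral_2_eq_2)
  then show ?thesis using that[of "- 1"] by blast
qed

lemma taylor_diff_carrier:
  fixes c :: "'v monomial set \<Rightarrow> ('v, 'k::field) mpoly"
  assumes "c \<in> taylor_chains V \<Delta> i" "\<And>\<sigma>. \<sigma> \<subseteq> set ms \<Longrightarrow> keys (mono_lcm \<sigma>) \<subseteq> V"
  shows "taylor_diff ms c \<tau> \<in> carrier (poly_ring V)"
  unfolding taylor_diff_def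
proof (rule carrier_sum, rule carrier_poly_ring_mult)
  fix \<sigma> assume "\<sigma> \<in> Pow (set ms)"
  then have "keys (mono_lcm \<sigma> - mono_lcm \<tau>) \<subseteq> V"
    using order_trans[OF keys_minus_subset assms(2)] by blast
  moreover obtain k :: "('v, 'k) mpoly" where "k \<in> carrier (poly_ring V)"
    "taylor_boundary ms \<sigma> \<tau> = k * mpoly_monom (mono_lcm \<sigma> - mono_lcm \<tau>)"
    by (rule taylor_boundary_factor[of V ms \<sigma> \<tau>])
  ultimately show "(taylor_boundary ms \<sigma> \<tau> :: ('v, 'k) mpoly) \<in> carrier (poly_ring V)"
    by (simp add: carrier_poly_ring_mult)
qed (use assms(1) in \<open>auto simp: taylor_chains_def\<close>)

text \<open>The term x^\<mu> at \<tau> has multidegree \<open>mono_lcm \<tau> + \<mu>\<close>, and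
  the differential preserves multidegrees. This replaces a decomposition of the complex into its
  graded strands.\<close>

lemma taylor_diff_support:
  fixes c :: "'v monomial set \<Rightarrow> ('v, 'k::field) mpoly"
  assumes "lookup (taylor_diff ms c \<tau>) \<mu> \<noteq> 0"
  obtains \<sigma> g where "\<sigma> \<subseteq> set ms" "c \<sigma> \<noteq> 0" "g \<in> \<sigma>" "\<tau> = \<sigma> - {g}"
    "mono_dvd (mono_lcm \<sigma>) (mono_lcm \<tau> + \<mu>)"
proof -
  obtain \<sigma> where \<sigma>: "\<sigma> \<subseteq> set ms" "lookup (c \<sigma> * taylor_boundary ms \<sigma> \<tau>) \<mu> \<noteq> 0"
    using assms unfolding taylor_diff_def lookup_sum
    by (metis (mono_tags, lifting) PowD sum.neutral)
  obtain k :: "('v, 'k) mpoly" where k: "k \<in> carrier (poly_ring UNIV)"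
    "taylor_boundary ms \<sigma> \<tau> = k * mpoly_monom (mono_lcm \<sigma> - mono_lcm \<tau>)"
    "k \<noteq> 0 \<longrightarrow> (\<exists>g\<in>\<sigma>. \<tau> = \<sigma> - {g})"
    by (rule taylor_boundary_factor[of UNIV ms \<sigma> \<tau>])
  have "c \<sigma> \<noteq> 0" "k \<noteq> 0" using \<sigma>(2) k(2) by auto
  have "\<mu> \<in> keys (c \<sigma> * k * mpoly_monom (mono_lcm \<sigma> - mono_lcm \<tau>))"
    using \<sigma>(2) k(2) by (simp add: in_keys_iff mult.assoc)
  then obtain v where "\<mu> = v + (mono_lcm \<sigma> - mono_lcm \<tau>)" by (rule keys_times_monom)
  then have "mono_dvd (mono_lcm \<sigma>) (mono_lcm \<tau> + \<mu>)"
    using mono_dvd_minus_iff by (metis mono_dvd_add(2))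
  then show ?thesis using that \<sigma>(1) \<open>c \<sigma> \<noteq> 0\<close> k(3) \<open>k \<noteq> 0\<close> by blast
qed

text \<open>A nonzero constant term in a boundary would need \<sigma> and \<sigma> - {g} with equal
  lcm, which irredundancy excludes. Minimality is thus automatic, and only exactness has to be
  proved for each graph.\<close>

lemma scarf_chains_minimal:
  assumes "finite V" "finite (mingens I)" "\<And>g. g \<in> mingens I \<Longrightarrow> keys g \<subseteq> V"
    and "set ms = mingens I" "c \<in> taylor_chains V (scarf_complex I) i"
  shows "taylor_diff ms c \<tau> \<in> variable_ideal V V"
proof -
  have keys: "keys (taylor_diff ms c \<tau>) \<subseteq> {u. keys u \<subseteq> V}"
  proof -
    have "keys (mono_lcm \<sigma>) \<subseteq> V" if "\<sigma> \<subseteq> set ms" for \<sigma>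
      using that assms(2-4) finite_subset[OF that] by (intro keys_mono_lcm) auto
    then show ?thesis
      using taylor_diff_carrier[OF assms(5), of ms \<tau>] by (auto simp: poly_ring_def)
  qed
  have "1 \<le> deg_on V \<mu>" if \<mu>: "\<mu> \<in> keys (taylor_diff ms c \<tau>)" for \<mu>
  proof (rule ccontr)
    assume "\<not> 1 \<le> deg_on V \<mu>"
    then have "deg_on V \<mu> = 0" by simp
    then have "\<forall>v\<in>V. lookup \<mu> v = 0" using assms(1) by (simp add: deg_on_def)
    moreover have "keys \<mu> \<subseteq> V" using keys \<mu> by blast
    ultimately have "lookup \<mu> v = 0" for v by (metis in_keys_iff subsetD)
    then have "\<mu> = 0" by (intro poly_mapping_eqI) simp
    with \<mu> obtain \<sigma> g where \<sigma>: "\<sigma> \<subseteq> set ms" "c \<sigma> \<noteq> 0" "g \<in> \<sigma>" "\<tau> = \<sigma> - {g}"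
      "mono_dvd (mono_lcm \<sigma>) (mono_lcm \<tau>)"
      using taylor_diff_support[of ms c \<tau> \<mu>] by (auto simp: in_keys_iff)
    then have S: "\<sigma> \<in> scarf_complex I" using assms(5) by (auto simp: taylor_chains_def)
    have "finite \<sigma>" using \<sigma>(1) finite_subset by blast
    then have "mono_dvd g (mono_lcm (\<sigma> - {g}))"
      using mono_dvd_trans[OF dvd_mono_lcm] \<sigma> by blast
    then show False using scarf_complex_irredundant[OF assms(2) S \<sigma>(3)] by simp
  qed
  then show ?thesis
    using keys by (auto simp: variable_ideal_eq[OF assms(1) order_refl] monomial_ideal_def)
qed

section \<open>A criterion for being Scarf\<close>

lemma divisible_by_monom:
  assumes "p \<in> carrier (poly_ring V)" "\<And>\<mu>. \<mu> \<in> keys p \<Longrightarrow> mono_dvd \<nu> \<mu>"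
  obtains q :: "('v, 'k::field) mpoly" where "q \<in> carrier (poly_ring V)" "p = q * mpoly_monom \<nu>"
proof -
  have "p \<in> {q * mpoly_monom \<nu> | q. q \<in> carrier (poly_ring V)}"
  proof (rule additive_closure)
    show "0 \<in> {q * mpoly_monom \<nu> | q :: ('v, 'k) mpoly. q \<in> carrier (poly_ring V)}"
      by (intro CollectI exI[of _ 0]) simp
  next
    fix a b :: "('v, 'k) mpoly"
    assume "a \<in> {q * mpoly_monom \<nu> | q. q \<in> carrier (poly_ring V)}"
      "b \<in> {q * mpoly_monom \<nu> | q. q \<in> carrier (poly_ring V)}"
    then obtain x y where "a = x * mpoly_monom \<nu>" "b = y * mpoly_monom \<nu>"
      "x \<in> carrier (poly_ring V)" "y \<in> carrier (poly_ring V)" by blast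
    then show "a + b \<in> {q * mpoly_monom \<nu> | q. q \<in> carrier (poly_ring V)}"
      by (intro CollectI exI[of _ "x + y"]) (simp add: distrib_right carrier_poly_ring_add)
  next
    fix u assume u: "u \<in> keys p"
    have "keys (u - \<nu>) \<subseteq> V"
      using order_trans[OF keys_minus_subset, of u V \<nu>] u assms(1) by (auto simp: poly_ring_def)
    then have "single (u - \<nu>) (lookup p u) \<in> carrier (poly_ring V)"
      unfolding carrier_poly_ring by (intro single_in_monomial_ideal) auto
    then show "single u (lookup p u) \<in> {q * mpoly_monom \<nu> | q. q \<in> carrier (poly_ring V)}"
      using single_eq_times_monom[OF assms(2)[OF u]] by blast
  qed
  then show ?thesis using that by blast
qed

lemma monomial_ideal_combination:
  assumes "p \<in> monomial_ideal V Q" "finite M"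
    and "\<And>u. keys u \<subseteq> V \<Longrightarrow> Q u \<Longrightarrow> \<exists>g\<in>M. mono_dvd g u"
  obtains f :: "'v monomial \<Rightarrow> ('v, 'k::field) mpoly"
    where "\<And>g. f g \<in> carrier (poly_ring V)" "p = (\<Sum>g\<in>M. f g * mpoly_monom g)"
proof -
  let ?J = "{\<Sum>g\<in>M. f g * mpoly_monom g | f :: 'v monomial \<Rightarrow> ('v, 'k) mpoly.
    \<forall>g. f g \<in> carrier (poly_ring V)}"
  have "p \<in> ?J"
  proof (rule additive_closure)
    show "0 \<in> ?J" by (intro CollectI exI[of _ "\<lambda>_. 0"]) simp
  next
    fix a b assume "a \<in> ?J" "b \<in> ?J"
    then obtain x y where "a = (\<Sum>g\<in>M. x g * mpoly_monom g)" "b = (\<Sum>g\<in>M. y g * mpoly_monom g)"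
      "\<forall>g. x g \<in> carrier (poly_ring V)" "\<forall>g. y g \<in> carrier (poly_ring V)" by blast
    then show "a + b \<in> ?J"
      by (intro CollectI exI[of _ "\<lambda>g. x g + y g"])
        (simp add: distrib_right sum.distrib carrier_poly_ring_add)
  next
    fix u assume u: "u \<in> keys p"
    then have "keys u \<subseteq> V" "Q u" using assms(1) by (auto simp: monomial_ideal_def)
    then obtain g where g: "g \<in> M" "mono_dvd g u" using assms(3) by blast
    have "keys (u - g) \<subseteq> V" by (rule order_trans[OF keys_minus_subset \<open>keys u \<subseteq> V\<close>])
    then have "single (u - g) (lookup p u) \<in> carrier (poly_ring V)"
      unfolding carrier_poly_ring by (intro single_in_monomial_ideal) auto
    moreover have "(\<Sum>h\<in>M. (if h = g then single (u - g) (lookup p u) else 0) * mpoly_monom h)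
        = single u (lookup p u)"
      using g(1) assms(2) single_eq_times_monom[OF g(2), of "lookup p u"]
      by (simp add: if_distrib[of "\<lambda>x. x * _"] sum.delta cong: if_cong)
    ultimately show "single u (lookup p u) \<in> ?J"
      by (intro CollectI exI[of _ "\<lambda>h. if h = g then single (u - g) (lookup p u) else 0"]) simp
  qed
  then show ?thesis using that by blast
qed

text \<open>The generators form a rooted tree, ordered by \<open>depth\<close>. The condition \<open>colon\<close> says that the
  colon ideal of the generators not deeper than \<open>g\<close> by \<open>g\<close> is generated by
  \<open>lcm(g, parent g) / g\<close>, so that a relation can be shortened at its deepest generator by
  a multiple of the boundary of the edge to the parent.\<close>

locale scarf_tree =
  fixes V :: "'v set" and Q :: "'v monomial \<Rightarrow> bool" and I :: "('v, 'k::field) mpoly set"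
    and ms :: "'v monomial list" and root :: "'v monomial"
    and par :: "'v monomial \<Rightarrow> 'v monomial" and depth :: "'v monomial \<Rightarrow> nat"
  assumes finV: "finite V" and I_eq: "I = monomial_ideal V Q" and up: "up_closed Q"
    and dist: "distinct ms" and ms: "set ms = mingens I" and nz: "0 \<notin> set ms"
    and gen: "\<And>u. keys u \<subseteq> V \<Longrightarrow> Q u \<Longrightarrow> \<exists>g\<in>set ms. mono_dvd g u"
    and depth_root: "depth root = 0"
    and par: "\<And>g. g \<in> set ms \<Longrightarrow> g \<noteq> root \<Longrightarrow> par g \<in> set ms \<and> depth (par g) < depth g"
    and colon: "\<And>g h. g \<in> set ms \<Longrightarrow> h \<in> set ms \<Longrightarrow> g \<noteq> root \<Longrightarrow> g \<noteq> h \<Longrightarrow>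
      depth h \<le> depth g \<Longrightarrow> mono_dvd (par g) (mono_lcm {g, h})"
    and third: "\<And>g h. g \<in> set ms \<Longrightarrow> h \<in> set ms \<Longrightarrow> g \<noteq> root \<Longrightarrow>
      mono_dvd h (mono_lcm {g, par g}) \<Longrightarrow> h = g \<or> h = par g"
begin

abbreviation scarf where "scarf \<equiv> scarf_complex I"

abbreviation chains :: "nat \<Rightarrow> ('v monomial set \<Rightarrow> ('v, 'k) mpoly) set" where
  "chains \<equiv> taylor_chains V scarf"

section \<open>The Scarf complex is the given tree\<close>

lemma fin_mingens: "finite (mingens I)"
  using ms by (metis List.finite_set)

lemma keys_gen: "g \<in> set ms \<Longrightarrow> keys g \<subseteq> V"
  by (simp add: ms mingens_def I_eq)

lemma keys_lcm: "\<sigma> \<subseteq> set ms \<Longrightarrow> keys (mono_lcm \<sigma>) \<subseteq> V"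
  by (rule keys_mono_lcm) (use keys_gen finite_subset in blast)+

lemma scarf_sub: "\<sigma> \<in> scarf \<Longrightarrow> \<sigma> \<subseteq> set ms"
  by (simp add: ms scarf_complex_def)

lemma scarf_fin: "\<sigma> \<in> scarf \<Longrightarrow> finite \<sigma>"
  using scarf_complex_finite fin_mingens by blast

lemma scarf_empty: "{} \<in> scarf"
  using empty_in_scarf_complex[OF fin_mingens] nz ms by simp

lemma scarf_singleton: "g \<in> set ms \<Longrightarrow> {g} \<in> scarf"
  using singleton_in_scarf_complex[OF fin_mingens] nz ms by simp

lemma par_neq: "g \<in> set ms \<Longrightarrow> g \<noteq> root \<Longrightarrow> par g \<noteq> g"
  using par by (metis less_irrefl)

text \<open>The locale assumption \<open>third\<close> exists for this: no other generator divides
  the lcm along a tree edge, so \<open>edge_in_scarf_complex\<close> applies.\<close>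

lemma scarf_edge: "g \<in> set ms \<Longrightarrow> g \<noteq> root \<Longrightarrow> {g, par g} \<in> scarf"
  using edge_in_scarf_complex[OF fin_mingens, of g "par g"] par third par_neq ms by metis

text \<open>By \<open>colon\<close>, the parent of the deeper generator divides the lcm of the pair;
  absorption puts that parent into the pair, so it must be \<open>h\<close>.\<close>

lemma scarf_pair:
  assumes "\<sigma> \<in> scarf" "g \<in> \<sigma>" "h \<in> \<sigma>" "g \<noteq> h" "depth h \<le> depth g"
  shows "g \<noteq> root \<and> h = par g"
proof -
  have gh: "g \<in> set ms" "h \<in> set ms" using assms scarf_sub by blast+
  have "g \<noteq> root"
    using par[OF gh(2)] assms(4,5) depth_root by (cases "h = root") auto
  have "{g, h} \<in> scarf"
    using scarf_complex_subset[OF fin_mingens assms(1)] assms(2,3) by simp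
  moreover have "mono_dvd (par g) (mono_lcm {g, h})"
    using colon gh \<open>g \<noteq> root\<close> assms(4,5) by blast
  ultimately have "par g \<in> {g, h}"
    using scarf_complex_absorb[OF fin_mingens] par[OF gh(1) \<open>g \<noteq> root\<close>] ms by blast
  then show ?thesis using par_neq[OF gh(1) \<open>g \<noteq> root\<close>] \<open>g \<noteq> root\<close> by auto
qed

text \<open>Compare each element of a face with a deepest one: by \<open>scarf_pair\<close> it can
  only be the parent. Hence no face has three elements.\<close>

lemma scarf_cases:
  assumes "\<sigma> \<in> scarf"
  obtains "\<sigma> = {}" | g where "g \<in> set ms" "\<sigma> = {g}"
    | g where "g \<in> set ms" "g \<noteq> root" "\<sigma> = {g, par g}"
proof (cases "\<sigma> = {}")
  case False
  obtain g where g: "g \<in> \<sigma>" "\<And>h. h \<in> \<sigma> \<Longrightarrow> depth h \<le> depth g"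
  proof -
    have "Max (depth ` \<sigma>) \<in> depth ` \<sigma>"
      using False scarf_fin[OF assms] by (intro Max_in) auto
    then obtain g where g: "g \<in> \<sigma>" "depth g = Max (depth ` \<sigma>)" by auto
    moreover have "depth h \<le> depth g" if "h \<in> \<sigma>" for h
      unfolding g(2) using that scarf_fin[OF assms] by (intro Max_ge) auto
    ultimately show ?thesis using that by blast
  qed
  have gms: "g \<in> set ms" using scarf_sub[OF assms] g(1) by blast
  have *: "g \<noteq> root \<and> h = par g" if "h \<in> \<sigma>" "h \<noteq> g" for h
    using scarf_pair[OF assms g(1) that(1)] that g(2) by blast
  show ?thesis
  proof (cases "\<sigma> = {g}")
    case True
    then show ?thesis using that(2) gms by blast
  next
    case False
    then obtain h where "h \<in> \<sigma>" "h \<noteq> g" using g(1) by blast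
    then have "g \<noteq> root" "\<sigma> = {g, par g}" using * g(1) by blast+
    then show ?thesis using that(3) gms by blast
  qed
qed (use that in blast)

lemma card_edge: "g \<in> set ms \<Longrightarrow> g \<noteq> root \<Longrightarrow> card {g, par g} = 2"
  using par_neq[of g] by auto

section \<open>Chains of the tree and their differentials\<close>

lemma chains_0: "c \<in> chains 0 \<Longrightarrow> c \<sigma> \<noteq> 0 \<Longrightarrow> \<sigma> = {}"
  using scarf_fin by (auto simp: taylor_chains_def)

lemma chains_1: "c \<in> chains 1 \<Longrightarrow> c \<sigma> \<noteq> 0 \<Longrightarrow> \<exists>g\<in>set ms. \<sigma> = {g}"
  using scarf_sub by (fastforce simp: taylor_chains_def card_1_singleton_iff)

lemma chains_2:
  assumes "c \<in> chains 2" "c \<sigma> \<noteq> 0"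
  obtains g where "g \<in> set ms" "g \<noteq> root" "\<sigma> = {g, par g}"
proof -
  have "\<sigma> \<in> scarf" "card \<sigma> = 2" using assms by (auto simp: taylor_chains_def)
  then show ?thesis using that by (elim scarf_cases) auto
qed

lemma chains_ge_3:
  assumes "3 \<le> i" "c \<in> chains i"
  shows "c = (\<lambda>_. 0)"
proof (rule ext, rule ccontr)
  fix \<sigma> assume "c \<sigma> \<noteq> 0"
  then have "\<sigma> \<in> scarf" "3 \<le> card \<sigma>" using assms by (auto simp: taylor_chains_def)
  then show False
    by (elim scarf_cases) (auto simp: card_edge)
qed

lemma zero_chain: "(\<lambda>_. 0) \<in> chains i"
  by (simp add: taylor_chains_def)

lemma edge_boundary:
  assumes "g \<in> set ms" "g \<noteq> root"
  obtains \<epsilon> :: "('v, 'k) mpoly" where "\<epsilon> = 1 \<or> \<epsilon> = - 1"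
    "taylor_boundary ms {g, par g} = (\<lambda>\<tau>. \<epsilon> *
       ((if \<tau> = {g} then mpoly_monom (mono_lcm {g, par g} - g) else 0)
        - (if \<tau> = {par g} then mpoly_monom (mono_lcm {g, par g} - par g) else 0)))"
proof -
  have "par g \<in> set ms" using par assms by blast
  have "{g, par g} = {par g, g}" by blast
  show ?thesis
    by (rule taylor_boundary_pair[OF dist \<open>par g \<in> set ms\<close> assms(1) par_neq[OF assms]])
      (rule that, unfold \<open>{g, par g} = {par g, g}\<close>, assumption, rule ext)
qed

lemma diff_chain_1:
  assumes "c \<in> chains 1"
  shows "taylor_diff ms c = (\<lambda>\<tau>. if \<tau> = {} then \<Sum>g\<in>set ms. c {g} * mpoly_monom g else 0)"
proof
  fix \<tau>
  have "taylor_diff ms c \<tau> = (\<Sum>\<sigma>\<in>(\<lambda>g. {g}) ` set ms. c \<sigma> * taylor_boundary ms \<sigma> \<tau>)"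
    unfolding taylor_diff_def
  proof (rule sum.mono_neutral_right)
    show "\<forall>\<sigma>\<in>Pow (set ms) - (\<lambda>g. {g}) ` set ms. c \<sigma> * taylor_boundary ms \<sigma> \<tau> = 0"
      using chains_1[OF assms] by (metis Diff_iff image_eqI mult_zero_left)
  qed auto
  also have "\<dots> = (\<Sum>g\<in>set ms. c {g} * taylor_boundary ms {g} \<tau>)"
    by (subst sum.reindex) (auto simp: inj_on_def)
  also have "\<dots> = (\<Sum>g\<in>set ms. c {g} * (if \<tau> = {} then mpoly_monom g else 0))"
    by (intro sum.cong refl) (simp add: taylor_boundary_singleton[OF dist])
  finally show "taylor_diff ms c \<tau> = (if \<tau> = {} then \<Sum>g\<in>set ms. c {g} * mpoly_monom g else 0)"
    by simp
qed

text \<open>Both endpoints contribute the monomial of the lcm, with opposite signs. This is the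
  identity that two consecutive differentials compose to zero; tree edges suffice, as they carry all
  2-chains.\<close>

lemma gen_sum_edge_boundary:
  assumes "g \<in> set ms" "g \<noteq> root"
  shows "(\<Sum>h\<in>set ms. taylor_boundary ms {g, par g} {h} * mpoly_monom h) = (0 :: ('v, 'k) mpoly)"
proof -
  let ?L = "mono_lcm {g, par g}"
  obtain \<epsilon> :: "('v, 'k) mpoly" where "\<epsilon> = 1 \<or> \<epsilon> = - 1" and \<epsilon>:
    "taylor_boundary ms {g, par g} = (\<lambda>\<tau>. \<epsilon> *
       ((if \<tau> = {g} then mpoly_monom (?L - g) else 0)
        - (if \<tau> = {par g} then mpoly_monom (?L - par g) else 0)))"
    by (rule edge_boundary[OF assms])
  have cancel: "mpoly_monom (?L - h) * mpoly_monom h = (mpoly_monom ?L :: ('v, 'k) mpoly)"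
    if "h \<in> {g, par g}" for h
    using dvd_mono_lcm[OF _ that] by (simp add: mpoly_monom_mult mono_dvd_diff_add)
  have "(\<Sum>h\<in>set ms. taylor_boundary ms {g, par g} {h} * mpoly_monom h) =
      (\<Sum>h\<in>set ms. (if h = g then \<epsilon> * mpoly_monom ?L else 0)
        - (if h = par g then \<epsilon> * mpoly_monom ?L else 0))"
    unfolding \<epsilon> using cancel by (intro sum.cong refl) (auto simp: mult.assoc algebra_simps)
  also have "\<dots> = 0"
    using assms par by (simp add: sum_subtractf sum.delta)
  finally show ?thesis .
qed

lemma diff_chain_2:
  assumes "c \<in> chains 2"
  shows "taylor_diff ms c \<in> chains 1" "taylor_diff ms (taylor_diff ms c) = (\<lambda>_. 0)"
proof -
  have supp: "\<exists>g\<in>set ms. \<tau> = {g}" if nz: "taylor_diff ms c \<tau> \<noteq> 0" for \<tau>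
  proof -
    obtain \<mu> where "lookup (taylor_diff ms c \<tau>) \<mu> \<noteq> 0"
      using nz by (metis lookup_zero poly_mapping_eqI)
    then obtain \<sigma> h where \<sigma>: "c \<sigma> \<noteq> 0" "h \<in> \<sigma>" "\<tau> = \<sigma> - {h}"
      by (rule taylor_diff_support)
    obtain g where g: "g \<in> set ms" "g \<noteq> root" "\<sigma> = {g, par g}" by (rule chains_2[OF assms \<sigma>(1)])
    have "par g \<in> set ms" "par g \<noteq> g" using par par_neq g by blast+
    then show ?thesis using \<sigma>(2,3) g by auto
  qed
  show ch: "taylor_diff ms c \<in> chains 1"
    unfolding taylor_chains_def
  proof (intro CollectI conjI allI impI)
    fix \<sigma>
    show "taylor_diff ms c \<sigma> \<in> carrier (poly_ring V)"
      by (rule taylor_diff_carrier[OF assms keys_lcm])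
    assume "taylor_diff ms c \<sigma> \<noteq> 0"
    then obtain g where "g \<in> set ms" "\<sigma> = {g}" using supp by blast
    then show "\<sigma> \<in> scarf" "card \<sigma> = 1" using scarf_singleton by auto
  qed
  have zero: "c \<sigma> * (\<Sum>g\<in>set ms. taylor_boundary ms \<sigma> {g} * mpoly_monom g) = 0" for \<sigma>
  proof (cases "c \<sigma> = 0")
    case False
    obtain g where "g \<in> set ms" "g \<noteq> root" "\<sigma> = {g, par g}" by (rule chains_2[OF assms False])
    then show ?thesis by (simp add: gen_sum_edge_boundary)
  qed simp
  have "(\<Sum>g\<in>set ms. taylor_diff ms c {g} * mpoly_monom g)
      = (\<Sum>\<sigma>\<in>Pow (set ms). c \<sigma> * (\<Sum>g\<in>set ms. taylor_boundary ms \<sigma> {g} * mpoly_monom g))"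
    unfolding taylor_diff_def sum_distrib_right sum_distrib_left
    by (subst sum.swap) (simp add: mult.assoc)
  also have "\<dots> = 0" by (simp add: zero)
  finally show "taylor_diff ms (taylor_diff ms c) = (\<lambda>_. 0)"
    unfolding diff_chain_1[OF ch] by auto
qed

lemma deepest:
  assumes "T \<subseteq> set ms" "T \<noteq> {}"
  obtains g where "g \<in> T" "\<And>h. h \<in> T \<Longrightarrow> depth h \<le> depth g"
proof -
  have fin: "finite T" using assms(1) by (rule finite_subset) simp
  have "Max (depth ` T) \<in> depth ` T" using assms(2) fin by (intro Max_in) auto
  then obtain g where g: "g \<in> T" "depth g = Max (depth ` T)" by auto
  show ?thesis
  proof (rule that[OF g(1)])
    fix h assume "h \<in> T"
    then show "depth h \<le> depth g" unfolding g(2) using fin by (intro Max_ge) auto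
  qed
qed

text \<open>A tree has no cycles: at a deepest generator whose edge to its parent has a nonzero
  coefficient, nothing can cancel the contribution of that edge.\<close>

lemma diff_chain_2_injective:
  assumes c: "c \<in> chains 2" and zero: "taylor_diff ms c = (\<lambda>_. 0)"
  shows "c = (\<lambda>_. 0)"
proof (rule ccontr)
  assume "c \<noteq> (\<lambda>_. 0)"
  then obtain \<sigma> where "c \<sigma> \<noteq> 0" by blast
  define T where "T = {g \<in> set ms. g \<noteq> root \<and> c {g, par g} \<noteq> 0}"
  have "T \<noteq> {}"
    using chains_2[OF c \<open>c \<sigma> \<noteq> 0\<close>] \<open>c \<sigma> \<noteq> 0\<close> unfolding T_def by blast
  then obtain g where g: "g \<in> T" "\<And>h. h \<in> T \<Longrightarrow> depth h \<le> depth g"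
    using deepest[of T] unfolding T_def by blast
  then have gr: "g \<in> set ms" "g \<noteq> root" and cg: "c {g, par g} \<noteq> 0" by (auto simp: T_def)
  let ?L = "mono_lcm {g, par g}"
  obtain \<epsilon> :: "('v, 'k) mpoly" where \<epsilon>: "\<epsilon> = 1 \<or> \<epsilon> = - 1"
    "taylor_boundary ms {g, par g} = (\<lambda>\<tau>. \<epsilon> *
       ((if \<tau> = {g} then mpoly_monom (?L - g) else 0)
        - (if \<tau> = {par g} then mpoly_monom (?L - par g) else 0)))"
    by (rule edge_boundary[OF gr])
  have other: "c \<sigma> * taylor_boundary ms \<sigma> {g} = 0" if "\<sigma> \<noteq> {g, par g}" for \<sigma>
  proof (rule ccontr)
    assume nz: "c \<sigma> * taylor_boundary ms \<sigma> {g} \<noteq> 0"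
    then have "c \<sigma> \<noteq> 0" by auto
    then obtain h where h: "h \<in> set ms" "h \<noteq> root" "\<sigma> = {h, par h}" by (rule chains_2[OF c])
    then have "h \<in> T" using \<open>c \<sigma> \<noteq> 0\<close> by (simp add: T_def)
    \<comment> \<open>An edge of the chain could meet \<open>g\<close> from below only if
      \<open>g\<close> were the parent of \<open>h\<close>, but \<open>h\<close> is no deeper than
      \<open>g\<close>.\<close>
    then have "depth (par h) < depth g" using g(2) par h by (meson less_le_trans)
    then have "g \<noteq> par h" by auto
    moreover have "g \<noteq> h" using that h(3) by blast
    moreover obtain \<delta> :: "('v, 'k) mpoly" where "\<delta> = 1 \<or> \<delta> = - 1"
      "taylor_boundary ms {h, par h} = (\<lambda>\<tau>. \<delta> *
       ((if \<tau> = {h} then mpoly_monom (mono_lcm {h, par h} - h) else 0)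
        - (if \<tau> = {par h} then mpoly_monom (mono_lcm {h, par h} - par h) else 0)))"
      by (rule edge_boundary[OF h(1,2)])
    ultimately have "taylor_boundary ms \<sigma> {g} = (0 :: ('v, 'k) mpoly)" by (simp add: h(3))
    then show False using nz by simp
  qed
  have "taylor_diff ms c {g} = (\<Sum>\<sigma>\<in>{{g, par g}}. c \<sigma> * taylor_boundary ms \<sigma> {g})"
    unfolding taylor_diff_def
    by (rule sum.mono_neutral_right) (use gr par other in auto)
  also have "\<dots> = c {g, par g} * \<epsilon> * mpoly_monom (?L - g)"
    using par_neq[OF gr] by (simp add: \<epsilon>(2) mult.assoc)
  finally have "c {g, par g} * \<epsilon> = 0" using zero by simp
  then show False using \<epsilon>(1) cg by auto
qed

text \<open>Generalised from all generators to sets \<open>T\<close> closed under strictly smaller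
  depth. Then removing one deepest generator leaves such a set even if others of equal depth remain,
  and the parent that receives the correction stays in it.\<close>

lemma relation_is_boundary:
  assumes "T \<subseteq> set ms" "\<And>g h. g \<in> T \<Longrightarrow> h \<in> set ms \<Longrightarrow> depth h < depth g \<Longrightarrow> h \<in> T"
    and "c \<in> chains 1" "\<And>g. g \<notin> T \<Longrightarrow> c {g} = 0"
    and "(\<Sum>g\<in>T. c {g} * mpoly_monom g) = 0"
  shows "\<exists>b\<in>chains 2. taylor_diff ms b = c"
proof -
  have "finite T" using assms(1) by (rule finite_subset) simp
  then show ?thesis using assms
  proof (induction T arbitrary: c rule: finite_psubset_induct)
    case (psubset T)
    note c = psubset.prems(3)
    show ?case
    proof (cases "\<exists>g\<in>T. c {g} \<noteq> 0")
      case False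
      have "c = (\<lambda>_. 0)"
      proof (rule ext, rule ccontr)
        fix \<sigma> assume "c \<sigma> \<noteq> 0"
        then obtain g where "g \<in> set ms" "\<sigma> = {g}" using chains_1[OF c] by blast
        then show False using False psubset.prems(4) \<open>c \<sigma> \<noteq> 0\<close> by blast
      qed
      then show ?thesis using zero_chain taylor_diff_zero by (intro bexI[of _ "\<lambda>_. 0"]) auto
    next
      case True
      then obtain g where g: "g \<in> T" "\<And>h. h \<in> T \<Longrightarrow> depth h \<le> depth g"
        using deepest[OF psubset.prems(1)] by blast
      have gms: "g \<in> set ms" using g psubset.prems(1) by blast
      have gsum: "c {g} * mpoly_monom g = - (\<Sum>h\<in>T - {g}. c {h} * mpoly_monom h)"
        using psubset.prems(5) sum.remove[OF psubset.hyps g(1), of "\<lambda>h. c {h} * mpoly_monom h"]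
        by (simp add: eq_neg_iff_add_eq_0)
      show ?thesis
      proof (cases "g = root")
        case True
        \<comment> \<open>If the root is deepest in \<open>T\<close>, then \<open>T\<close> has no
          other element, and a relation on one monomial is zero.\<close>
        have "T - {g} = {}"
        proof -
          have "h = root" if "h \<in> T" for h
            using par[of h] g(2)[OF that] that True depth_root psubset.prems(1) by force
          then show ?thesis using True by blast
        qed
        then have "c {g} * mpoly_monom g = 0" unfolding gsum by (simp only: sum.empty minus_zero)
        then have "c {g} = 0" by simp
        with \<open>T - {g} = {}\<close> \<open>\<exists>g\<in>T. c {g} \<noteq> 0\<close> show ?thesis by blast
      next
        case False
        have pg: "par g \<in> set ms" "depth (par g) < depth g" "par g \<noteq> g"
          using par[OF gms False] par_neq[OF gms False] by auto
        have "par g \<in> T" using psubset.prems(2)[OF g(1)] pg by blast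
        let ?L = "mono_lcm {g, par g}"
        have L: "mono_dvd g ?L" "mono_dvd (par g) ?L" by (simp_all add: dvd_mono_lcm)
        \<comment> \<open>The term of exponent \<mu> + g must cancel against another generator
          \<open>h\<close> of \<open>T\<close>, so it is divisible by lcm(g, h), hence by the parent
          through \<open>colon\<close>, hence by \<open>?L\<close>.\<close>
        have "mono_dvd (?L - g) \<mu>" if \<mu>: "\<mu> \<in> keys (c {g})" for \<mu>
        proof -
          have "lookup (c {g} * mpoly_monom g) (\<mu> + g) \<noteq> 0"
            using \<mu> by (simp add: lookup_times_monom in_keys_iff)
          then have "(\<Sum>h\<in>T - {g}. lookup (c {h} * mpoly_monom h) (\<mu> + g)) \<noteq> 0"
            unfolding gsum by (simp add: lookup_sum)
          then obtain h where h: "h \<in> T - {g}" "lookup (c {h} * mpoly_monom h) (\<mu> + g) \<noteq> 0"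
            by (meson sum.not_neutral_contains_not_neutral)
          obtain \<nu> where "\<mu> + g = \<nu> + h"
            using keys_times_monom[of "\<mu> + g" "c {h}" h] h(2) by (auto simp: in_keys_iff)
          then have "mono_dvd h (\<mu> + g)" by simp
          then have "mono_dvd (mono_lcm {g, h}) (\<mu> + g)" by (simp add: mono_lcm_dvd_iff)
          moreover have "mono_dvd (par g) (mono_lcm {g, h})"
            using h(1) g psubset.prems(1) gms False by (intro colon) auto
          ultimately have "mono_dvd (par g) (\<mu> + g)" by (rule mono_dvd_trans[rotated])
          then have "mono_dvd ?L (\<mu> + g)" by (simp add: mono_lcm_dvd_iff)
          then show ?thesis by (simp add: mono_dvd_minus_iff add.commute)
        qed
        moreover have "c {g} \<in> carrier (poly_ring V)" using c by (simp add: taylor_chains_def)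
        ultimately obtain q where q: "q \<in> carrier (poly_ring V)" "c {g} = q * mpoly_monom (?L - g)"
          using divisible_by_monom by metis
        obtain \<epsilon> :: "('v, 'k) mpoly" where \<epsilon>: "\<epsilon> = 1 \<or> \<epsilon> = - 1"
          "taylor_boundary ms {g, par g} = (\<lambda>\<tau>. \<epsilon> *
            ((if \<tau> = {g} then mpoly_monom (?L - g) else 0)
              - (if \<tau> = {par g} then mpoly_monom (?L - par g) else 0)))"
          by (rule edge_boundary[OF gms False])
        \<comment> \<open>The extra \<epsilon> cancels the sign in the boundary of the edge, so that
          the boundary of \<open>b\<close> agrees with \<open>c\<close> at \<open>g\<close>.\<close>
        define b where "b = chain_single (q * \<epsilon>) {g, par g}"
        have "q * \<epsilon> \<in> carrier (poly_ring V)"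
          using q(1) \<epsilon>(1) by (auto intro: carrier_poly_ring_uminus)
        then have b: "b \<in> chains 2"
          unfolding b_def using taylor_chains_single[OF _ scarf_edge[OF gms False]]
          by (metis card_edge[OF gms False])
        have "\<epsilon> * \<epsilon> = 1" using \<epsilon>(1) by auto
        then have qe: "q * \<epsilon> * (\<epsilon> * p) = q * p" for p by (metis mult.assoc mult_1)
        have "taylor_diff ms b = (\<lambda>\<tau>. q * \<epsilon> * taylor_boundary ms {g, par g} \<tau>)"
          unfolding b_def by (rule taylor_diff_single) (use gms pg(1) in simp)
        then have Db: "taylor_diff ms b \<tau> = (if \<tau> = {g} then q * mpoly_monom (?L - g) else 0)
            - (if \<tau> = {par g} then q * mpoly_monom (?L - par g) else 0)" for \<tau>
          by (simp only: \<epsilon>(2) qe) (simp add: right_diff_distrib)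
        define c' where "c' = (\<lambda>\<sigma>. c \<sigma> - taylor_diff ms b \<sigma>)"
        have c': "c' \<in> chains 1"
          unfolding c'_def by (rule taylor_chains_diff[OF c diff_chain_2(1)[OF b]])
        have c'_out: "c' {h} = 0" if "h \<notin> T - {g}" for h
        proof (cases "h = g")
          case True
          then show ?thesis using pg(3) by (simp add: c'_def Db q(2))
        next
          case False
          then have "c {h} = 0" "h \<noteq> par g" using that psubset.prems(4) \<open>par g \<in> T\<close> by blast+
          with False show ?thesis by (simp add: c'_def Db)
        qed
        have sub: "T - {g} \<subset> T" using g(1) by blast
        \<comment> \<open>Subtracting the boundary of \<open>b\<close> leaves a relation, because
          that boundary is itself one.\<close>
        have Db_sum: "(\<Sum>h\<in>set ms. taylor_diff ms b {h} * mpoly_monom h) = 0"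
          using diff_chain_2(2)[OF b] unfolding diff_chain_1[OF diff_chain_2(1)[OF b]]
          by (metis (no_types, lifting))
        have "(\<Sum>h\<in>T - {g}. c' {h} * mpoly_monom h) = (\<Sum>h\<in>set ms. c' {h} * mpoly_monom h)"
          using c'_out psubset.prems(1) by (intro sum.mono_neutral_left) auto
        also have "\<dots> = (\<Sum>h\<in>set ms. c {h} * mpoly_monom h) - 0"
          unfolding c'_def left_diff_distrib sum_subtractf Db_sum ..
        also have "(\<Sum>h\<in>set ms. c {h} * mpoly_monom h) = (\<Sum>h\<in>T. c {h} * mpoly_monom h)"
          using psubset.prems(1,4) by (intro sum.mono_neutral_right) auto
        finally have c'_sum: "(\<Sum>h\<in>T - {g}. c' {h} * mpoly_monom h) = 0"
          using psubset.prems(5) by simp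
        have "\<exists>b'\<in>chains 2. taylor_diff ms b' = c'"
        proof (rule psubset.IH[OF sub _ _ c' c'_out c'_sum])
          show "T - {g} \<subseteq> set ms" using psubset.prems(1) by blast
          fix x h assume "x \<in> T - {g}" "h \<in> set ms" "depth h < depth x"
          then show "h \<in> T - {g}"
            using psubset.prems(2)[of x h] g(2)[of x] by auto
        qed
        then obtain b' where b': "b' \<in> chains 2" "taylor_diff ms b' = c'" by blast
        have "taylor_diff ms (\<lambda>\<sigma>. b' \<sigma> + b \<sigma>) = c"
          unfolding taylor_diff_add b'(2) c'_def by simp
        then show ?thesis using taylor_chains_add[OF b'(1) b] by blast
      qed
    qed
  qed
qed

section \<open>Exactness of the augmented complex\<close>

lemma exact_0:
  "{c \<in> chains 0. augmentation V I c = \<zero>\<^bsub>poly_ring V Quot I\<^esub>}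
    = taylor_diff ms ` chains 1" (is "?L = ?R")
proof
  interpret cring "poly_ring V :: ('v, 'k) mpoly ring" by (rule poly_ring_cring)
  interpret id: ideal I "poly_ring V"
    unfolding I_eq by (rule monomial_ideal_ideal[OF up])
  have aug: "augmentation V I c = \<zero>\<^bsub>poly_ring V Quot I\<^esub> \<longleftrightarrow> c {} \<in> I"
    if "c \<in> chains 0" for c
  proof -
    have "c {} \<in> carrier (poly_ring V)" using that by (simp add: taylor_chains_def)
    then show ?thesis
      unfolding augmentation_def FactRing_def
      using a_rcos_zero[OF id.is_ideal] id.a_rcos_self by auto
  qed
  show "?L \<subseteq> ?R"
  proof
    fix c assume c: "c \<in> ?L"
    then have c0: "c \<in> chains 0" and "c {} \<in> I" using aug by auto
    then obtain f :: "'v monomial \<Rightarrow> ('v, 'k) mpoly" where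
      f: "\<And>g. f g \<in> carrier (poly_ring V)" "c {} = (\<Sum>g\<in>set ms. f g * mpoly_monom g)"
      using monomial_ideal_combination[of "c {}" V Q "set ms"] gen unfolding I_eq by blast
    define b where "b = (\<lambda>\<sigma>. if \<exists>g\<in>set ms. \<sigma> = {g} then f (the_elem \<sigma>) else 0)"
    have b: "b \<in> chains 1"
      unfolding taylor_chains_def b_def using f(1) scarf_singleton by auto
    have "taylor_diff ms b \<tau> = c \<tau>" for \<tau>
      unfolding diff_chain_1[OF b] using chains_0[OF c0, of \<tau>] f(2)
      by (auto simp: b_def)
    then have "taylor_diff ms b = c" by blast
    then show "c \<in> ?R" using b by blast
  qed
  show "?R \<subseteq> ?L"
  proof
    fix c assume "c \<in> ?R"
    then obtain b where b: "b \<in> chains 1" "c = taylor_diff ms b" by blast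
    have "(\<Sum>g\<in>A. b {g} * mpoly_monom g) \<in> I" if "A \<subseteq> set ms" for A
    proof -
      have "finite A" using that by (rule finite_subset) simp
      then show ?thesis using that
      proof induction
        case (insert g A)
        have "mpoly_monom g \<in> I" using insert.prems ms by (auto simp: mingens_def)
        moreover have "b {g} \<in> carrier (poly_ring V)" using b(1) by (simp add: taylor_chains_def)
        ultimately have "b {g} * mpoly_monom g \<in> I" using id.I_l_closed by fastforce
        then show ?case using insert id.a_closed by fastforce
      qed (use id.zero_closed in simp)
    qed
    then have I: "c {} \<in> I" unfolding b(2) diff_chain_1[OF b(1)] by simp
    have "c \<in> chains 0"
      using I scarf_empty id.a_subset unfolding taylor_chains_def b(2) diff_chain_1[OF b(1)]
      by auto
    then show "c \<in> ?L" using aug I by blast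
  qed
qed

lemma exact_pos:
  assumes "1 \<le> i"
  shows "{c \<in> chains i. taylor_diff ms c = (\<lambda>\<tau>. 0)}
    = taylor_diff ms ` chains (Suc i)" (is "?L = ?R")
proof -
  consider "i = 1" | "2 \<le> i" using assms by linarith
  then show ?thesis
  proof cases
    case 1
    have "c \<in> ?R" if c: "c \<in> ?L" for c
    proof -
      have c1: "c \<in> chains 1" and "taylor_diff ms c = (\<lambda>_. 0)" using c 1 by auto
      then have "(\<Sum>g\<in>set ms. c {g} * mpoly_monom g) = 0"
        unfolding diff_chain_1[OF c1] by metis
      moreover have "c {g} = 0" if "g \<notin> set ms" for g using chains_1[OF c1, of "{g}"] that by auto
      ultimately have "\<exists>b\<in>chains 2. taylor_diff ms b = c"
        by (intro relation_is_boundary[of "set ms"] c1) auto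
      then show ?thesis using 1 by (auto simp: numeral_2_eq_2)
    qed
    moreover have "c \<in> ?L" if "c \<in> ?R" for c
      using that diff_chain_2 1 by (auto simp: numeral_2_eq_2)
    ultimately show ?thesis by blast
  next
    case 2
    have "?L = {\<lambda>_. 0}"
    proof (cases "i = 2")
      case True
      then show ?thesis using diff_chain_2_injective zero_chain taylor_diff_zero by blast
    next
      case False
      then show ?thesis using 2 chains_ge_3[of i] zero_chain taylor_diff_zero by auto
    qed
    moreover have "chains (Suc i) = {\<lambda>_. 0}"
      using 2 chains_ge_3[of "Suc i"] zero_chain by auto
    ultimately show ?thesis by (simp add: taylor_diff_zero)
  qed
qed

lemma is_scarf: "is_scarf V I"
proof -
  have "augmentation V I ` chains 0 = carrier (poly_ring V Quot I)" (is "?L = ?R")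
  proof
    show "?L \<subseteq> ?R"
      by (auto simp: augmentation_def FactRing_def A_RCOSETS_def' taylor_chains_def)
    show "?R \<subseteq> ?L"
    proof
      fix X assume "X \<in> ?R"
      then obtain x where x: "x \<in> carrier (poly_ring V)" "X = I +>\<^bsub>poly_ring V\<^esub> x"
        by (auto simp: FactRing_def A_RCOSETS_def')
      have "chain_single x {} \<in> chains 0"
        using taylor_chains_single[OF x(1) scarf_empty] by simp
      moreover have "augmentation V I (chain_single x {}) = X"
        by (simp add: augmentation_def chain_single_def x(2))
      ultimately show "X \<in> ?L" by blast
    qed
  qed
  then have "is_free_resolution V I ms scarf"
    unfolding is_free_resolution_def using exact_0 exact_pos by blast
  moreover have "taylor_diff ms c \<tau> \<in> variable_ideal V V"
    if "c \<in> chains (Suc i)" for c i \<tau>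
    using that keys_gen ms by (intro scarf_chains_minimal[OF finV fin_mingens]) auto
  ultimately show ?thesis
    unfolding is_scarf_def is_minimal_free_resolution_def using dist ms by blast
qed

end

section \<open>Obstructions to being Scarf\<close>

lemma mingens_below:
  assumes "finite V" "keys u \<subseteq> V" "Q u"
  obtains g where "g \<in> mingens (monomial_ideal V Q :: ('v, 'k::field) mpoly set)" "mono_dvd g u"
proof -
  have "\<exists>g. g \<in> mingens (monomial_ideal V Q :: ('v, 'k) mpoly set) \<and> mono_dvd g u"
    using assms(2,3)
  proof (induction "deg_on V u" arbitrary: u rule: less_induct)
    case less
    let ?M = "mingens (monomial_ideal V Q :: ('v, 'k) mpoly set)"
    show ?case
    proof (cases "u \<in> ?M")
      case False
      then obtain w where w: "keys w \<subseteq> V" "Q w" "mono_dvd w u" "w \<noteq> u"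
        using less.prems by (auto simp: mingens_def)
      have "\<exists>v. lookup w v < lookup u v"
        using w(3,4) by (metis mono_dvd_def order_le_imp_less_or_eq poly_mapping_eqI)
      then obtain v where v: "lookup w v < lookup u v" by blast
      then have "v \<in> V" using less.prems(1) by (metis in_keys_iff not_less_zero subsetD)
      then have "deg_on V w < deg_on V u"
        unfolding deg_on_def using w(3) v assms(1)
        by (intro sum_strict_mono_ex1) (auto simp: mono_dvd_def)
      then obtain g where "g \<in> ?M" "mono_dvd g w" using less.hyps w by blast
      then show ?thesis using w(3) mono_dvd_trans by blast
    qed (use mono_dvd_refl in blast)
  qed
  then show ?thesis using that by blast
qed

text \<open>Exactness writes the cycle as a boundary, so each of its terms must come from a face
  with one more element in the same multidegree. To refute a resolution it is enough to rule out
  such faces for one term of one cycle.\<close>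

lemma resolution_obstruction:
  fixes I :: "('v, 'k::field) mpoly set" and c :: "'v monomial set \<Rightarrow> ('v, 'k) mpoly"
  assumes "is_free_resolution V I ms \<Delta>" "c \<in> taylor_chains V \<Delta> i" "1 \<le> i"
    and "taylor_diff ms c = (\<lambda>_. 0)" "lookup (c \<tau>) \<mu> \<noteq> 0"
  obtains \<sigma> g where "\<sigma> \<in> \<Delta>" "\<sigma> \<subseteq> set ms" "g \<in> \<sigma>" "\<tau> = \<sigma> - {g}"
    "mono_dvd (mono_lcm \<sigma>) (mono_lcm \<tau> + \<mu>)"
proof -
  have eq: "{c \<in> taylor_chains V \<Delta> i. taylor_diff ms c = (\<lambda>\<tau>. 0 :: ('v, 'k) mpoly)}
      = taylor_diff ms ` taylor_chains V \<Delta> (Suc i)"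
    using assms(1,3) unfolding is_free_resolution_def by simp
  have "c \<in> taylor_diff ms ` taylor_chains V \<Delta> (Suc i)"
    unfolding eq[symmetric] using assms(2,4) by simp
  then obtain b where b: "b \<in> taylor_chains V \<Delta> (Suc i)" "c = taylor_diff ms b" by blast
  have "lookup (taylor_diff ms b \<tau>) \<mu> \<noteq> 0" using assms(5) b(2) by simp
  then obtain \<sigma> g where "\<sigma> \<subseteq> set ms" "b \<sigma> \<noteq> 0" "g \<in> \<sigma>" "\<tau> = \<sigma> - {g}"
    "mono_dvd (mono_lcm \<sigma>) (mono_lcm \<tau> + \<mu>)" by (rule taylor_diff_support)
  moreover have "\<sigma> \<in> \<Delta>" using b(1) \<open>b \<sigma> \<noteq> 0\<close> by (simp add: taylor_chains_def)
  ultimately show ?thesis using that by blast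
qed

text \<open>In multidegree \<open>m\<close> the Scarf complex has \<open>a\<close> as an isolated vertex but is not a point: every
  other generator dividing \<open>m\<close> has least common multiple \<open>m\<close> with \<open>a\<close>, and at least two such
  generators exist, one below \<open>b\<close> and one below \<open>c\<close>.\<close>

lemma not_scarf_isolated:
  assumes "finite V" "keys m \<subseteq> V"
    and a: "Q a" "mono_dvd a m" "\<And>u. Q u \<Longrightarrow> mono_dvd u a \<Longrightarrow> mono_dvd a u"
    and b: "Q b" "mono_dvd b m" "\<not> mono_dvd a b"
    and c: "Q c" "mono_dvd c m" "\<not> mono_dvd a c"
    and bc: "\<And>u. Q u \<Longrightarrow> mono_dvd u b \<Longrightarrow> mono_dvd u c \<Longrightarrow> False"
    and join: "\<And>u. Q u \<Longrightarrow> mono_dvd u m \<Longrightarrow> mono_dvd a u \<or> mono_dvd m (mono_lcm {a, u})"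
  shows "\<not> is_scarf V (monomial_ideal V Q :: ('v, 'k::field) mpoly set)"
proof
  let ?I = "monomial_ideal V Q :: ('v, 'k) mpoly set"
  assume "is_scarf V ?I"
  then obtain ms where ms: "distinct ms" "set ms = mingens ?I"
    and res: "is_free_resolution V ?I ms (scarf_complex ?I)"
    by (auto simp: is_scarf_def is_minimal_free_resolution_def)
  have fin: "finite (mingens ?I)" using ms(2) by (metis List.finite_set)
  have Q: "Q g" if "g \<in> mingens ?I" for g using that by (simp add: mingens_def)
  have keysV: "keys u \<subseteq> V" if "mono_dvd u m" for u
    using mono_dvd_keys[OF that] assms(2) by blast
  have aM: "a \<in> mingens ?I"
    using keysV[OF a(2)] a mono_dvd_antisym by (auto simp: mingens_def)
  obtain b' where b': "b' \<in> mingens ?I" "mono_dvd b' b"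
    using mingens_below[OF assms(1) keysV[OF b(2)], of Q] b(1) by blast
  obtain c' where c': "c' \<in> mingens ?I" "mono_dvd c' c"
    using mingens_below[OF assms(1) keysV[OF c(2)], of Q] c(1) by blast
  \<comment> \<open>Passing to minimal generators below \<open>b\<close> and \<open>c\<close> could
    merge them; \<open>bc\<close> prevents this.\<close>
  have ne: "b' \<noteq> c'" "b' \<noteq> a" "c' \<noteq> a"
    using bc[of b'] b' c' Q b(3) c(3) by blast+
  have le: "mono_dvd b' m" "mono_dvd c' m"
    using mono_dvd_trans b'(2) b(2) c'(2) c(2) by blast+
  have nz: "0 \<notin> mingens ?I"
    using bc[of 0] Q[of 0] by (auto simp: mono_dvd_def)
  \<comment> \<open>The difference of the vertices \<open>a\<close> and \<open>b'\<close>, both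
    lifted to multidegree \<open>m\<close>; filling it would need a Scarf edge at
    \<open>a\<close>.\<close>
  define x where "x = (\<lambda>\<sigma>. chain_single (mpoly_monom (m - a)) {a} \<sigma>
    + chain_single (- mpoly_monom (m - b')) {b'} \<sigma> :: ('v, 'k) mpoly)"
  have carr: "mpoly_monom (m - u) \<in> carrier (poly_ring V)" for u
    using order_trans[OF keys_minus_subset assms(2)] by simp
  have x: "x \<in> taylor_chains V (scarf_complex ?I) 1"
    unfolding x_def
    using taylor_chains_single[OF carr singleton_in_scarf_complex[OF fin nz aM], of a]
      taylor_chains_single[OF carrier_poly_ring_uminus[OF carr]
        singleton_in_scarf_complex[OF fin nz b'(1)], of b']
    by (intro taylor_chains_add) simp_all
  have "taylor_diff ms x = (\<lambda>_. 0)"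
    unfolding x_def taylor_diff_add
    using aM b'(1) ms le(1) a(2)
    by (intro ext) (simp add: taylor_diff_single taylor_boundary_singleton mpoly_monom_mult mono_dvd_diff_add)
  moreover have "lookup (x {a}) (m - a) \<noteq> 0"
    using ne(2) by (simp add: x_def chain_single_def mpoly_monom_def)
  ultimately obtain \<sigma> g where \<sigma>: "\<sigma> \<in> scarf_complex ?I" "\<sigma> \<subseteq> set ms" "g \<in> \<sigma>" "{a} = \<sigma> - {g}"
    "mono_dvd (mono_lcm \<sigma>) (mono_lcm {a} + (m - a))"
    by (rule resolution_obstruction[OF res x order_refl])
  have "mono_lcm {a} + (m - a) = m" using mono_dvd_diff_add[OF a(2)] by (simp add: add.commute)
  then have "mono_dvd (mono_lcm \<sigma>) m" using \<sigma>(5) by simp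
  then have "mono_dvd g m"
    using \<sigma>(2,3) mono_dvd_trans dvd_mono_lcm[of \<sigma> g] finite_subset[OF \<sigma>(2)] by blast
  have gM: "g \<in> mingens ?I" "g \<noteq> a" using \<sigma>(2-4) ms(2) by blast+
  then have "\<not> mono_dvd a g" using mingens_antichain aM by blast
  then have "mono_dvd m (mono_lcm {a, g})" using join Q gM \<open>mono_dvd g m\<close> by blast
  moreover have "\<sigma> = {a, g}" using \<sigma>(3,4) by blast
  ultimately have "mono_dvd m (mono_lcm \<sigma>)" by simp
  \<comment> \<open>The edge {a, g} has lcm \<open>m\<close>, so it absorbs \<open>b'\<close> and
    \<open>c'\<close> besides \<open>a\<close>: three distinct generators in a set of two.\<close>
  then have "b' \<in> \<sigma>" "c' \<in> \<sigma>"
    using scarf_complex_absorb[OF fin \<sigma>(1)] b' c' le mono_dvd_trans by blast+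
  then show False using ne \<open>\<sigma> = {a, g}\<close> by blast
qed

text \<open>The edge is scaled to multidegree \<open>m\<close> and oriented from \<open>g\<close> to
  \<open>h\<close>, so that boundaries telescope along a closed walk.\<close>

lemma edge_chain:
  assumes "distinct ms" "g \<in> set ms" "h \<in> set ms" "g \<noteq> h" "{g, h} \<in> \<Delta>"
    and "mono_dvd (mono_lcm {g, h}) m" "keys m \<subseteq> V"
  obtains c :: "'v monomial set \<Rightarrow> ('v, 'k::field) mpoly" where "c \<in> taylor_chains V \<Delta> 2"
    "taylor_diff ms c = (\<lambda>\<tau>. (if \<tau> = {h} then mpoly_monom (m - h) else 0)
        - (if \<tau> = {g} then mpoly_monom (m - g) else 0))"
    "lookup (c {g, h}) (m - mono_lcm {g, h}) \<noteq> 0" "\<forall>\<sigma>. \<sigma> \<noteq> {g, h} \<longrightarrow> c \<sigma> = 0"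
proof -
  let ?L = "mono_lcm {g, h}"
  obtain \<epsilon> :: "('v, 'k) mpoly" where \<epsilon>: "\<epsilon> = 1 \<or> \<epsilon> = - 1"
    "\<And>\<tau>. taylor_boundary ms {g, h} \<tau> = \<epsilon> *
       ((if \<tau> = {h} then mpoly_monom (?L - h) else 0)
        - (if \<tau> = {g} then mpoly_monom (?L - g) else 0))"
    using taylor_boundary_pair[OF assms(1-4)] by blast
  define c where "c = chain_single (mpoly_monom (m - ?L) * \<epsilon>) {g, h}"
  have "mpoly_monom (m - ?L) \<in> carrier (poly_ring V)"
    using order_trans[OF keys_minus_subset assms(7)] by simp
  then have carr: "mpoly_monom (m - ?L) * \<epsilon> \<in> carrier (poly_ring V)"
    using \<epsilon>(1) by (auto intro: carrier_poly_ring_uminus simp del: mpoly_monom_carrier)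
  have "c \<in> taylor_chains V \<Delta> 2"
    unfolding c_def using taylor_chains_single[OF carr assms(5)] assms(4) by (simp add: numeral_2_eq_2)
  moreover have "taylor_diff ms c = (\<lambda>\<tau>. (if \<tau> = {h} then mpoly_monom (m - h) else 0)
        - (if \<tau> = {g} then mpoly_monom (m - g) else 0))"
  proof
    fix \<tau>
    have "\<epsilon> * \<epsilon> = 1" using \<epsilon>(1) by auto
    then have ee: "p * \<epsilon> * (\<epsilon> * q) = p * q" for p q by (metis mult.assoc mult_1)
    have shift: "mpoly_monom (m - ?L) * mpoly_monom (?L - u) = (mpoly_monom (m - u) :: ('v, 'k) mpoly)"
      if "u \<in> {g, h}" for u
    proof -
      have "mono_dvd u ?L" using that by (auto intro: dvd_mono_lcm)
      then have "m - ?L + (?L - u) = m - u"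
        using assms(6)
        by (intro poly_mapping_eqI) (auto simp: mono_dvd_def lookup_add lookup_minus)
      then show ?thesis by (simp add: mpoly_monom_mult)
    qed
    have "taylor_diff ms c \<tau> = mpoly_monom (m - ?L) * \<epsilon> * taylor_boundary ms {g, h} \<tau>"
      unfolding c_def using assms(2,3) by (simp add: taylor_diff_single)
    also have "\<dots> = mpoly_monom (m - ?L) * ((if \<tau> = {h} then mpoly_monom (?L - h) else 0)
        - (if \<tau> = {g} then mpoly_monom (?L - g) else 0))"
      by (simp only: \<epsilon>(2) ee)
    also have "\<dots> = (if \<tau> = {h} then mpoly_monom (m - h) else 0)
        - (if \<tau> = {g} then mpoly_monom (m - g) else 0)"
      using shift[of g] shift[of h] assms(4) by (simp add: right_diff_distrib)
    finally show "taylor_diff ms c \<tau> = (if \<tau> = {h} then mpoly_monom (m - h) else 0)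
        - (if \<tau> = {g} then mpoly_monom (m - g) else 0)" .
  qed
  moreover have "lookup (c {g, h}) (m - ?L) \<noteq> 0"
    using \<epsilon>(1) by (auto simp: c_def chain_single_def mpoly_monom_def)
  ultimately show ?thesis
    using that by (simp add: c_def chain_single_def)
qed

text \<open>In multidegree \<open>m\<close> the Scarf complex is the circle \<open>a\<close>, \<open>b\<close>, \<open>c\<close>, \<open>d\<close> without 2-faces.\<close>

lemma not_scarf_square:
  assumes "finite V" "keys m \<subseteq> V"
    and Q: "Q a" "Q b" "Q c" "Q d"
    and le: "mono_dvd a m" "mono_dvd b m" "mono_dvd c m" "mono_dvd d m"
    and cover: "\<And>u. Q u \<Longrightarrow> mono_dvd u m \<Longrightarrow>
      mono_dvd a u \<or> mono_dvd b u \<or> mono_dvd c u \<or> mono_dvd d u"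
    and ab: "\<not> mono_dvd c (mono_lcm {a, b})" "\<not> mono_dvd d (mono_lcm {a, b})"
    and bc: "\<not> mono_dvd a (mono_lcm {b, c})" "\<not> mono_dvd d (mono_lcm {b, c})"
    and cd: "\<not> mono_dvd a (mono_lcm {c, d})" "\<not> mono_dvd b (mono_lcm {c, d})"
    and da: "\<not> mono_dvd b (mono_lcm {d, a})" "\<not> mono_dvd c (mono_lcm {d, a})"
    and diag: "mono_dvd d (mono_lcm {a, c})" "mono_dvd c (mono_lcm {b, d})"
  shows "\<not> is_scarf V (monomial_ideal V Q :: ('v, 'k::field) mpoly set)"
proof
  let ?I = "monomial_ideal V Q :: ('v, 'k) mpoly set"
  assume "is_scarf V ?I"
  then obtain ms where ms: "distinct ms" "set ms = mingens ?I"
    and res: "is_free_resolution V ?I ms (scarf_complex ?I)"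
    by (auto simp: is_scarf_def is_minimal_free_resolution_def)
  have fin: "finite (mingens ?I)" using ms(2) by (metis List.finite_set)
  have keysV: "keys u \<subseteq> V" if "mono_dvd u m" for u
    using mono_dvd_keys[OF that] assms(2) by blast
  have lcmI: "mono_dvd x (mono_lcm {y, z})" if "mono_dvd x y \<or> mono_dvd x z" for x y z :: "'v monomial"
    using that mono_dvd_trans dvd_mono_lcm[of "{y, z}"] by blast
  have anti: "\<not> mono_dvd x y" if "x \<in> {a, b, c, d}" "y \<in> {a, b, c, d}" "x \<noteq> y" for x y
    using that ab bc cd da lcmI by (metis insertE singletonD)
  have ne: "a \<noteq> b" "a \<noteq> c" "a \<noteq> d" "b \<noteq> c" "b \<noteq> d" "c \<noteq> d"
    using ab bc cd da lcmI mono_dvd_refl by metis+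
  have gens: "{a, b, c, d} \<subseteq> mingens ?I"
  proof
    fix x assume x: "x \<in> {a, b, c, d}"
    then have xm: "Q x" "mono_dvd x m" using Q le by auto
    have "u = x" if u: "Q u" "mono_dvd u x" for u
    proof -
      obtain y where y: "y \<in> {a, b, c, d}" "mono_dvd y u"
        using cover[OF u(1) mono_dvd_trans[OF u(2) xm(2)]] by blast
      then have "y = x" using anti[OF y(1) x] mono_dvd_trans[OF y(2) u(2)] by blast
      then show ?thesis using y(2) u(2) mono_dvd_antisym by blast
    qed
    then show "x \<in> mingens ?I" using xm keysV by (auto simp: mingens_def)
  qed
  have only: "g \<in> {a, b, c, d}" if g: "g \<in> mingens ?I" "mono_dvd g m" for g
  proof -
    have "Q g" using g(1) by (simp add: mingens_def)
    then obtain y where "y \<in> {a, b, c, d}" "mono_dvd y g" using cover g(2) by blast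
    then show ?thesis using mingens_antichain[of y ?I g] g(1) gens by blast
  qed
  have lcm_m: "mono_dvd (mono_lcm {x, y}) m" if "x \<in> {a, b, c, d}" "y \<in> {a, b, c, d}" for x y
    using that le by (auto simp: mono_lcm_dvd_iff)
  have edge: "{x, y} \<in> scarf_complex ?I"
    if xy: "{x, y, z, w} = {a, b, c, d}" "x \<noteq> y"
      "\<not> mono_dvd z (mono_lcm {x, y})" "\<not> mono_dvd w (mono_lcm {x, y})" for x y z w
  proof (rule edge_in_scarf_complex[OF fin _ _ xy(2)])
    have in4: "x \<in> {a, b, c, d}" "y \<in> {a, b, c, d}" using xy(1) by blast+
    then show "x \<in> mingens ?I" "y \<in> mingens ?I" using gens by blast+
    fix k assume k: "k \<in> mingens ?I" "mono_dvd k (mono_lcm {x, y})"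
    then have "k \<in> {x, y, z, w}"
      using only mono_dvd_trans[OF k(2) lcm_m[OF in4]] xy(1) by blast
    then show "k = x \<or> k = y" using k(2) xy(3,4) by blast
  qed
  have gm: "a \<in> set ms" "b \<in> set ms" "c \<in> set ms" "d \<in> set ms" using gens ms(2) by auto
  have E: "{a, b} \<in> scarf_complex ?I" "{b, c} \<in> scarf_complex ?I"
    "{c, d} \<in> scarf_complex ?I" "{d, a} \<in> scarf_complex ?I"
    by (rule edge[of _ _ c d], use ne ab in auto)
      (rule edge[of _ _ a d], use ne bc in auto,
       rule edge[of _ _ a b], use ne cd in auto,
       rule edge[of _ _ b c], use ne da in auto)
  let ?e = "\<lambda>h \<tau>. if \<tau> = {h} then mpoly_monom (m - h) else 0 :: ('v, 'k) mpoly"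
  let ?C = "taylor_chains V (scarf_complex ?I) 2 :: ('v monomial set \<Rightarrow> ('v, 'k) mpoly) set"
  have L: "mono_dvd (mono_lcm {a, b}) m" "mono_dvd (mono_lcm {b, c}) m"
    "mono_dvd (mono_lcm {c, d}) m" "mono_dvd (mono_lcm {d, a}) m"
    by (rule lcm_m; simp)+
  obtain x1 where x1: "x1 \<in> ?C" "taylor_diff ms x1 = (\<lambda>\<tau>. ?e b \<tau> - ?e a \<tau>)"
    "lookup (x1 {a, b}) (m - mono_lcm {a, b}) \<noteq> 0" "\<forall>\<sigma>. \<sigma> \<noteq> {a, b} \<longrightarrow> x1 \<sigma> = 0"
    by (rule edge_chain[OF ms(1) gm(1,2) ne(1) E(1) L(1) assms(2)])
  obtain x2 where x2: "x2 \<in> ?C" "taylor_diff ms x2 = (\<lambda>\<tau>. ?e c \<tau> - ?e b \<tau>)"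
    "lookup (x2 {b, c}) (m - mono_lcm {b, c}) \<noteq> 0" "\<forall>\<sigma>. \<sigma> \<noteq> {b, c} \<longrightarrow> x2 \<sigma> = 0"
    by (rule edge_chain[OF ms(1) gm(2,3) ne(4) E(2) L(2) assms(2)])
  obtain x3 where x3: "x3 \<in> ?C" "taylor_diff ms x3 = (\<lambda>\<tau>. ?e d \<tau> - ?e c \<tau>)"
    "lookup (x3 {c, d}) (m - mono_lcm {c, d}) \<noteq> 0" "\<forall>\<sigma>. \<sigma> \<noteq> {c, d} \<longrightarrow> x3 \<sigma> = 0"
    by (rule edge_chain[OF ms(1) gm(3,4) ne(6) E(3) L(3) assms(2)])
  obtain x4 where x4: "x4 \<in> ?C" "taylor_diff ms x4 = (\<lambda>\<tau>. ?e a \<tau> - ?e d \<tau>)"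
    "lookup (x4 {d, a}) (m - mono_lcm {d, a}) \<noteq> 0" "\<forall>\<sigma>. \<sigma> \<noteq> {d, a} \<longrightarrow> x4 \<sigma> = 0"
    by (rule edge_chain[OF ms(1) gm(4,1) ne(3)[symmetric] E(4) L(4) assms(2)])
  \<comment> \<open>The four oriented sides of the square; their boundaries telescope to
    zero.\<close>
  define x where "x = (\<lambda>\<sigma>. ((x1 \<sigma> + x2 \<sigma>) + x3 \<sigma>) + x4 \<sigma>)"
  have x: "x \<in> ?C" unfolding x_def by (intro taylor_chains_add x1 x2 x3 x4)
  have "taylor_diff ms x = (\<lambda>_. 0)"
    unfolding x_def taylor_diff_add x1(2) x2(2) x3(2) x4(2) by (rule ext) simp
  moreover have "{a, b} \<noteq> {b, c}" "{a, b} \<noteq> {c, d}" "{a, b} \<noteq> {d, a}"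
    using ne by (auto simp: doubleton_eq_iff)
  then have "lookup (x {a, b}) (m - mono_lcm {a, b}) \<noteq> 0"
    using x1(3) x2(4) x3(4) x4(4) by (simp add: x_def)
  ultimately obtain \<sigma> g where \<sigma>: "\<sigma> \<in> scarf_complex ?I" "\<sigma> \<subseteq> set ms" "g \<in> \<sigma>"
    "{a, b} = \<sigma> - {g}" "mono_dvd (mono_lcm \<sigma>) (mono_lcm {a, b} + (m - mono_lcm {a, b}))"
    by (rule resolution_obstruction[OF res x one_le_numeral])
  have "mono_lcm {a, b} + (m - mono_lcm {a, b}) = m"
    using mono_dvd_diff_add[OF L(1)] by (simp add: add.commute)
  then have "mono_dvd (mono_lcm \<sigma>) m" using \<sigma>(5) by simp
  then have "mono_dvd g m"
    using \<sigma>(2,3) mono_dvd_trans dvd_mono_lcm[of \<sigma> g] finite_subset[OF \<sigma>(2)] by blast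
  then have "g \<in> {a, b, c, d}" using only \<sigma>(2,3) ms(2) by blast
  moreover have "g \<notin> {a, b}" "\<sigma> = {a, b, g}" using \<sigma>(3,4) by blast+
  \<comment> \<open>Either possible filling contains a diagonal of the square, whose lcm is
    divisible by the fourth vertex, so absorption contradicts its size.\<close>
  ultimately consider "\<sigma> = {a, b, c}" | "\<sigma> = {a, b, d}" by blast
  then show False
  proof cases
    case 1
    have "mono_dvd d (mono_lcm \<sigma>)"
      using diag(1) mono_lcm_mono[of \<sigma> "{a, c}"] mono_dvd_trans unfolding 1 by blast
    then have "d \<in> \<sigma>" using scarf_complex_absorb[OF fin \<sigma>(1)] gens by blast
    then show False using ne 1 by auto
  next
    case 2
    have "mono_dvd c (mono_lcm \<sigma>)"
      using diag(2) mono_lcm_mono[of \<sigma> "{b, d}"] mono_dvd_trans unfolding 2 by blast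
    then have "c \<in> \<sigma>" using scarf_complex_absorb[OF fin \<sigma>(1)] gens by blast
    then show False using ne 2 by auto
  qed
qed

section \<open>Symbolic powers restricted to a set of vertices\<close>

text \<open>Lets exponent vectors be handled as plain functions; values outside \<open>W\<close> are
  cut off.\<close>

definition mon :: "'v set \<Rightarrow> ('v \<Rightarrow> nat) \<Rightarrow> 'v monomial" where
  "mon W f = (\<Sum>v\<in>W. single v (f v))"

lemma lookup_mon: "finite W \<Longrightarrow> lookup (mon W f) v = (if v \<in> W then f v else 0)"
  by (simp add: mon_def lookup_sum lookup_single when_def sum.delta)

lemma keys_mon: "finite W \<Longrightarrow> keys (mon W f) \<subseteq> W"
  by (auto simp: in_keys_iff lookup_mon split: if_splits)

lemma mon_lookup: "finite W \<Longrightarrow> keys u \<subseteq> W \<Longrightarrow> mon W (lookup u) = u"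
  by (rule poly_mapping_eqI) (auto simp: lookup_mon in_keys_iff)

lemma mon_dvd_mon: "finite W \<Longrightarrow> mono_dvd (mon W f) (mon W g) \<longleftrightarrow> (\<forall>v\<in>W. f v \<le> g v)"
  by (auto simp: mono_dvd_def lookup_mon)

lemma mono_lcm_mon:
  "finite W \<Longrightarrow> mono_lcm {mon W f, mon W g} = mon W (\<lambda>v. max (f v) (g v))"
  by (rule poly_mapping_eqI) (simp add: lookup_mon)

text \<open>The analogue of \<open>in_symb\<close> for the graph with vertices \<open>W\<close> and
  edges \<open>F\<close>, on plain functions, so that for a concrete graph it unfolds to a few
  linear inequalities.\<close>

definition symb_on :: "'v set \<Rightarrow> 'v set set \<Rightarrow> nat \<Rightarrow> ('v \<Rightarrow> nat) \<Rightarrow> bool" where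
  "symb_on W F n f \<longleftrightarrow> (\<forall>B\<subseteq>W. (\<forall>e\<in>F. e \<inter> B \<noteq> {}) \<longrightarrow> n \<le> sum f B)"

definition induced_edges :: "'v set set \<Rightarrow> 'v set \<Rightarrow> 'v set set" where
  "induced_edges E W = {e \<in> E. e \<subseteq> W}"

text \<open>A cover of the induced subgraph extends by all of \<open>V - W\<close>, and a cover of
  the whole graph restricts to \<open>W\<close>. Neither changes the degree of a monomial supported
  on \<open>W\<close>.\<close>

lemma in_symb_mon:
  assumes "simple_graph V E" "W \<subseteq> V"
  shows "in_symb V E n (mon W f) \<longleftrightarrow> symb_on W (induced_edges E W) n f"
proof -
  have finV: "finite V" and finW: "finite W"
    using assms finite_subset by (auto simp: simple_graph_def)
  have deg: "deg_on A (mon W f) = sum f (A \<inter> W)" if "A \<subseteq> V" for A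
    using finite_subset[OF that finV]
    by (simp add: deg_on_def lookup_mon[OF finW] sum.inter_restrict)
  show ?thesis
  proof
    assume L: "in_symb V E n (mon W f)"
    show "symb_on W (induced_edges E W) n f"
      unfolding symb_on_def
    proof (intro allI impI)
      fix B assume B: "B \<subseteq> W" "\<forall>e\<in>induced_edges E W. e \<inter> B \<noteq> {}"
      have "e \<inter> ((V - W) \<union> B) \<noteq> {}" if "e \<in> E" for e
      proof (cases "e \<subseteq> W")
        case True
        then have "e \<inter> B \<noteq> {}" using B(2) that by (simp add: induced_edges_def)
        then show ?thesis by blast
      next
        case False
        then show ?thesis using that assms(1) by (auto simp: simple_graph_def)
      qed
      then have cov: "vertex_cover V E ((V - W) \<union> B)"
        using B(1) assms(2) by (auto simp: vertex_cover_def)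
      have "((V - W) \<union> B) \<inter> W = B" using B(1) by blast
      then show "n \<le> sum f B"
        using L cov deg[of "(V - W) \<union> B"] B(1) assms(2) by (force simp: in_symb_def)
    qed
  next
    assume R: "symb_on W (induced_edges E W) n f"
    show "in_symb V E n (mon W f)"
      unfolding in_symb_def
    proof (intro allI impI)
      fix A assume A: "vertex_cover V E A"
      then have "e \<inter> (A \<inter> W) \<noteq> {}" if "e \<in> induced_edges E W" for e
        using that by (auto simp: induced_edges_def vertex_cover_def)
      then have "n \<le> sum f (A \<inter> W)" using R by (simp add: symb_on_def)
      then show "n \<le> deg_on A (mon W f)" using A by (simp add: deg vertex_cover_def)
    qed
  qed
qed

text \<open>Sums of natural numbers grow with the cover, so a family with a member below every cover
  decides the condition. It is applied to the minimal covers.\<close>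

lemma symb_on_covers:
  assumes "finite W" "\<And>C. C \<in> \<C> \<Longrightarrow> C \<subseteq> W \<and> (\<forall>e\<in>F. e \<inter> C \<noteq> {})"
    and "\<And>B. B \<subseteq> W \<Longrightarrow> \<forall>e\<in>F. e \<inter> B \<noteq> {} \<Longrightarrow> \<exists>C\<in>\<C>. C \<subseteq> B"
  shows "symb_on W F n f \<longleftrightarrow> (\<forall>C\<in>\<C>. n \<le> sum f C)"
proof
  assume "symb_on W F n f"
  then show "\<forall>C\<in>\<C>. n \<le> sum f C" using assms(2) by (simp add: symb_on_def)
next
  assume *: "\<forall>C\<in>\<C>. n \<le> sum f C"
  show "symb_on W F n f"
    unfolding symb_on_def
  proof (intro allI impI)
    fix B assume B: "B \<subseteq> W" "\<forall>e\<in>F. e \<inter> B \<noteq> {}"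
    then obtain C where C: "C \<in> \<C>" "C \<subseteq> B" using assms(3) by blast
    have "n \<le> sum f C" using * C(1) by blast
    also have "\<dots> \<le> sum f B" by (rule sum_mono2[OF finite_subset[OF B(1) assms(1)] C(2)]) simp
    finally show "n \<le> sum f B" .
  qed
qed

text \<open>All divisors of the multidegree are supported on \<open>W\<close>, so the obstruction
  involves only the induced subgraph on \<open>W\<close> yet refutes Scarfness for the whole
  graph.\<close>

lemma symbolic_not_scarf_isolated:
  fixes a b c m :: "'v \<Rightarrow> nat"
  assumes G: "simple_graph V E" "W \<subseteq> V"
    and P: "\<And>f. symb_on W (induced_edges E W) n f \<longleftrightarrow> P f"
    and a: "P a" "\<forall>v\<in>W. a v \<le> m v" "\<And>f. P f \<Longrightarrow> \<forall>v\<in>W. f v \<le> a v \<Longrightarrow> \<forall>v\<in>W. a v \<le> f v"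
    and b: "P b" "\<forall>v\<in>W. b v \<le> m v" "\<exists>v\<in>W. b v < a v"
    and c: "P c" "\<forall>v\<in>W. c v \<le> m v" "\<exists>v\<in>W. c v < a v"
    and bc: "\<And>f. P f \<Longrightarrow> \<forall>v\<in>W. f v \<le> b v \<and> f v \<le> c v \<Longrightarrow> False"
    and join: "\<And>f. P f \<Longrightarrow> \<forall>v\<in>W. f v \<le> m v \<Longrightarrow>
      (\<forall>v\<in>W. a v \<le> f v) \<or> (\<forall>v\<in>W. m v \<le> max (a v) (f v))"
  shows "\<not> is_scarf V (edge_ideal_symbolic_power V E n :: ('v, 'k::field) mpoly set)"
  unfolding symbolic_power_eq[OF G(1)]
proof (rule not_scarf_isolated)
  have finV: "finite V" and fin: "finite W"
    using G finite_subset by (auto simp: simple_graph_def)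
  have symb: "in_symb V E n (mon W f) \<longleftrightarrow> P f" for f using in_symb_mon[OF G] P by simp
  have sub: "\<exists>f. u = mon W f" if "mono_dvd u (mon W g)" for u g
    using mon_lookup[OF fin, of u] order_trans[OF mono_dvd_keys[OF that] keys_mon[OF fin]] by metis
  show "finite V" by fact
  show "keys (mon W m) \<subseteq> V" using keys_mon[OF fin] G(2) by blast
  show "in_symb V E n (mon W a)" "in_symb V E n (mon W b)" "in_symb V E n (mon W c)"
    using symb a(1) b(1) c(1) by auto
  show "mono_dvd (mon W a) (mon W m)" "mono_dvd (mon W b) (mon W m)" "mono_dvd (mon W c) (mon W m)"
    using a(2) b(2) c(2) by (simp_all add: mon_dvd_mon fin)
  show "\<not> mono_dvd (mon W a) (mon W b)" "\<not> mono_dvd (mon W a) (mon W c)"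
    using b(3) c(3) by (auto simp: mon_dvd_mon fin not_le)
  show "mono_dvd (mon W a) u" if u: "in_symb V E n u" "mono_dvd u (mon W a)" for u
  proof -
    obtain f where f: "u = mon W f" using sub[OF u(2)] by blast
    show ?thesis using u a(3)[of f] unfolding f by (simp add: symb mon_dvd_mon fin)
  qed
  show False if u: "in_symb V E n u" "mono_dvd u (mon W b)" "mono_dvd u (mon W c)" for u
  proof -
    obtain f where f: "u = mon W f" using sub[OF u(2)] by blast
    show ?thesis using u bc[of f] unfolding f by (simp add: symb mon_dvd_mon fin)
  qed
  show "mono_dvd (mon W a) u \<or> mono_dvd (mon W m) (mono_lcm {mon W a, u})"
    if u: "in_symb V E n u" "mono_dvd u (mon W m)" for u
  proof -
    obtain f where f: "u = mon W f" using sub[OF u(2)] by blast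
    show ?thesis using u join[of f] unfolding f by (simp add: symb mon_dvd_mon fin mono_lcm_mon)
  qed
qed

lemma symbolic_not_scarf_square:
  fixes a b c d m :: "'v \<Rightarrow> nat"
  assumes G: "simple_graph V E" "W \<subseteq> V"
    and P: "\<And>f. symb_on W (induced_edges E W) n f \<longleftrightarrow> P f"
    and Q: "P a" "P b" "P c" "P d"
    and le: "\<forall>v\<in>W. a v \<le> m v \<and> b v \<le> m v \<and> c v \<le> m v \<and> d v \<le> m v"
    and cover: "\<And>f. P f \<Longrightarrow> \<forall>v\<in>W. f v \<le> m v \<Longrightarrow>
      (\<forall>v\<in>W. a v \<le> f v) \<or> (\<forall>v\<in>W. b v \<le> f v) \<or> (\<forall>v\<in>W. c v \<le> f v) \<or> (\<forall>v\<in>W. d v \<le> f v)"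
    and ab: "\<exists>v\<in>W. max (a v) (b v) < c v" "\<exists>v\<in>W. max (a v) (b v) < d v"
    and bc: "\<exists>v\<in>W. max (b v) (c v) < a v" "\<exists>v\<in>W. max (b v) (c v) < d v"
    and cd: "\<exists>v\<in>W. max (c v) (d v) < a v" "\<exists>v\<in>W. max (c v) (d v) < b v"
    and da: "\<exists>v\<in>W. max (d v) (a v) < b v" "\<exists>v\<in>W. max (d v) (a v) < c v"
    and diag: "\<forall>v\<in>W. d v \<le> max (a v) (c v)" "\<forall>v\<in>W. c v \<le> max (b v) (d v)"
  shows "\<not> is_scarf V (edge_ideal_symbolic_power V E n :: ('v, 'k::field) mpoly set)"
  unfolding symbolic_power_eq[OF G(1)]
proof (rule not_scarf_square)
  have finV: "finite V" and fin: "finite W"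
    using G finite_subset by (auto simp: simple_graph_def)
  have symb: "in_symb V E n (mon W f) \<longleftrightarrow> P f" for f using in_symb_mon[OF G] P by simp
  have dvd: "mono_dvd (mon W f) (mon W g) \<longleftrightarrow> (\<forall>v\<in>W. f v \<le> g v)" for f g
    by (rule mon_dvd_mon[OF fin])
  have ndvd: "\<not> mono_dvd (mon W f) (mono_lcm {mon W g, mon W h})"
    if "\<exists>v\<in>W. max (g v) (h v) < f v" for f g h
    unfolding mono_lcm_mon[OF fin] dvd using that by (meson not_le)
  show "finite V" by fact
  show "keys (mon W m) \<subseteq> V" using keys_mon[OF fin] G(2) by blast
  show "in_symb V E n (mon W a)" "in_symb V E n (mon W b)" "in_symb V E n (mon W c)"
    "in_symb V E n (mon W d)"
    using symb Q by auto
  show "mono_dvd (mon W a) (mon W m)" "mono_dvd (mon W b) (mon W m)" "mono_dvd (mon W c) (mon W m)"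
    "mono_dvd (mon W d) (mon W m)"
    using le by (simp_all add: dvd)
  show "mono_dvd (mon W a) u \<or> mono_dvd (mon W b) u \<or> mono_dvd (mon W c) u \<or> mono_dvd (mon W d) u"
    if u: "in_symb V E n u" "mono_dvd u (mon W m)" for u
  proof -
    have "keys u \<subseteq> W" using order_trans[OF mono_dvd_keys[OF u(2)] keys_mon[OF fin]] .
    then have f: "u = mon W (lookup u)" using mon_lookup[OF fin] by metis
    have "P (lookup u)" "\<forall>v\<in>W. lookup u v \<le> m v"
      using u symb[of "lookup u"] dvd[of "lookup u" m] f by simp_all
    from cover[OF this] show ?thesis
      using dvd[of _ "lookup u"] f by simp
  qed
  show "mono_dvd (mon W d) (mono_lcm {mon W a, mon W c})"
    "mono_dvd (mon W c) (mono_lcm {mon W b, mon W d})"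
    unfolding mono_lcm_mon[OF fin] dvd using diag by simp_all
  show "\<not> mono_dvd (mon W c) (mono_lcm {mon W a, mon W b})"
    "\<not> mono_dvd (mon W d) (mono_lcm {mon W a, mon W b})"
    "\<not> mono_dvd (mon W a) (mono_lcm {mon W b, mon W c})"
    "\<not> mono_dvd (mon W d) (mono_lcm {mon W b, mon W c})"
    "\<not> mono_dvd (mon W a) (mono_lcm {mon W c, mon W d})"
    "\<not> mono_dvd (mon W b) (mono_lcm {mon W c, mon W d})"
    "\<not> mono_dvd (mon W b) (mono_lcm {mon W d, mon W a})"
    "\<not> mono_dvd (mon W c) (mono_lcm {mon W d, mon W a})"
    by (rule ndvd, fact)+
qed

text \<open>The tree lives on an index set \<open>J\<close>, where parents and depths of explicit
  generators are easy to write. By \<open>gen\<close> and \<open>anti\<close> the indexed vectors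
  are exactly the minimal generators, without repetition.\<close>

lemma symbolic_scarf_tree:
  fixes g :: "'i \<Rightarrow> 'v \<Rightarrow> nat" and par :: "'i \<Rightarrow> 'i" and depth :: "'i \<Rightarrow> nat"
  assumes G: "simple_graph V E" and fin: "finite J" and root: "depth r = 0"
    and P: "\<And>f. symb_on V E n f \<longleftrightarrow> P f"
    and gP: "\<And>i. i \<in> J \<Longrightarrow> P (g i)"
    and gen: "\<And>f. P f \<Longrightarrow> \<exists>i\<in>J. \<forall>v\<in>V. g i v \<le> f v"
    and anti: "\<And>i j. i \<in> J \<Longrightarrow> j \<in> J \<Longrightarrow> \<forall>v\<in>V. g i v \<le> g j v \<Longrightarrow> i = j"
    and nz: "\<And>i. i \<in> J \<Longrightarrow> \<exists>v\<in>V. g i v \<noteq> 0"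
    and par: "\<And>i. i \<in> J \<Longrightarrow> i \<noteq> r \<Longrightarrow> par i \<in> J \<and> depth (par i) < depth i"
    and colon: "\<And>i j. i \<in> J \<Longrightarrow> j \<in> J \<Longrightarrow> i \<noteq> r \<Longrightarrow> i \<noteq> j \<Longrightarrow> depth j \<le> depth i \<Longrightarrow>
      \<forall>v\<in>V. g (par i) v \<le> max (g i v) (g j v)"
    and third: "\<And>i j. i \<in> J \<Longrightarrow> j \<in> J \<Longrightarrow> i \<noteq> r \<Longrightarrow>
      \<forall>v\<in>V. g j v \<le> max (g i v) (g (par i) v) \<Longrightarrow> j = i \<or> j = par i"
    and rJ: "r \<in> J"
  shows "is_scarf V (edge_ideal_symbolic_power V E n :: ('v, 'k::field) mpoly set)"
proof -
  let ?I = "monomial_ideal V (in_symb V E n) :: ('v, 'k) mpoly set"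
  have finV: "finite V" using G by (simp add: simple_graph_def)
  have "induced_edges E V = E" using G by (auto simp: induced_edges_def simple_graph_def)
  then have symb: "in_symb V E n (mon V f) \<longleftrightarrow> P f" for f
    using in_symb_mon[OF G order_refl, of n f] P by simp
  define m where "m i = mon V (g i)" for i
  have dvd: "mono_dvd (m i) (mon V f) \<longleftrightarrow> (\<forall>v\<in>V. g i v \<le> f v)" for i f
    by (simp add: m_def mon_dvd_mon finV)
  have inj: "inj_on m J"
  proof (rule inj_onI)
    fix i j assume ij: "i \<in> J" "j \<in> J" "m i = m j"
    have "mono_dvd (m i) (mon V (g j))" using ij(3) by (simp add: m_def)
    then show "i = j" using anti ij(1,2) dvd by blast
  qed
  \<comment> \<open>The locale wants parent and depth as functions of monomials; \<open>ix\<close>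
    recovers the index.\<close>
  define ix where "ix = the_inv_into J m"
  have ix: "ix (m i) = i" if "i \<in> J" for i
    unfolding ix_def by (rule the_inv_into_f_f[OF inj that])
  have below: "\<exists>i\<in>J. mono_dvd (m i) u" if "keys u \<subseteq> V" "in_symb V E n u" for u
  proof -
    have u: "mon V (lookup u) = u" by (rule mon_lookup[OF finV that(1)])
    then have "P (lookup u)" using symb[of "lookup u"] that(2) by simp
    then show ?thesis using gen[of "lookup u"] dvd[of _ "lookup u"] u by metis
  qed
  have keysm: "keys (m i) \<subseteq> V" for i unfolding m_def by (rule keys_mon[OF finV])
  have symbm: "in_symb V E n (m i)" if "i \<in> J" for i using symb gP[OF that] by (simp add: m_def)
  have mins: "mingens ?I = m ` J"
  proof (intro equalityI subsetI)
    fix u assume u: "u \<in> mingens ?I"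
    then have "keys u \<subseteq> V" "in_symb V E n u" by (auto simp: mingens_def)
    then obtain i where i: "i \<in> J" "mono_dvd (m i) u" using below by blast
    then have "m i = u" using u keysm symbm by (simp add: mingens_def)
    then show "u \<in> m ` J" using i(1) by blast
  next
    fix u assume "u \<in> m ` J"
    then obtain i where i: "i \<in> J" "u = m i" by blast
    have "w = m i" if w: "keys w \<subseteq> V" "in_symb V E n w" "mono_dvd w (m i)" for w
    proof -
      obtain j where j: "j \<in> J" "mono_dvd (m j) w" using below w by blast
      have "mono_dvd (m j) (m i)" by (rule mono_dvd_trans[OF j(2) w(3)])
      then have "j = i" using anti[OF j(1) i(1)] dvd[of j "g i"] by (simp add: m_def)
      then show ?thesis using j(2) w(3) mono_dvd_antisym by blast
    qed
    then show "u \<in> mingens ?I" using i symbm keysm by (simp add: mingens_def)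
  qed
  obtain ms where ms: "set ms = m ` J" "distinct ms"
    using finite_distinct_list[of "m ` J"] fin by blast
  have lcm: "mono_lcm {m i, m j} = mon V (\<lambda>v. max (g i v) (g j v))" for i j
    unfolding m_def by (rule mono_lcm_mon[OF finV])
  have "scarf_tree V (in_symb V E n) ?I ms (m r) (\<lambda>u. m (par (ix u))) (\<lambda>u. depth (ix u))"
  proof
    show "0 \<notin> set ms"
    proof
      assume "0 \<in> set ms"
      then obtain i where i: "i \<in> J" "m i = 0" unfolding ms(1) by (metis imageE)
      obtain v where v: "v \<in> V" "g i v \<noteq> 0" using nz[OF i(1)] by blast
      then show False using i(2) lookup_mon[OF finV, of "g i" v] unfolding m_def by simp
    qed
    show "\<exists>u\<in>set ms. mono_dvd u w" if "keys w \<subseteq> V" "in_symb V E n w" for w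
      using below[OF that] unfolding ms(1) by blast
    show "depth (ix (m r)) = 0" using root ix[OF rJ] by simp
    fix u assume u: "u \<in> set ms" and ur: "u \<noteq> m r"
    then obtain i where i: "i \<in> J" "u = m i" "i \<noteq> r" unfolding ms(1) by blast
    show "m (par (ix u)) \<in> set ms \<and> depth (ix (m (par (ix u)))) < depth (ix u)"
      using par[OF i(1,3)] i(1,2) ix unfolding ms(1) by auto
    fix w assume w: "w \<in> set ms"
    then obtain j where j: "j \<in> J" "w = m j" unfolding ms(1) by blast
    show "mono_dvd (m (par (ix u))) (mono_lcm {u, w})"
      if "u \<noteq> w" "depth (ix w) \<le> depth (ix u)"
      using that colon[OF i(1) j(1) i(3)] i j by (auto simp: ix lcm dvd)
    show "w = u \<or> w = m (par (ix u))" if "mono_dvd w (mono_lcm {u, m (par (ix u))})"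
      using that third[OF i(1) j(1) i(3)] i j by (auto simp: ix lcm dvd)
  qed (use finV up_closed_in_symb ms mins in auto)
  then show ?thesis
    unfolding symbolic_power_eq[OF G] by (rule scarf_tree.is_scarf)
qed

section \<open>Forbidden induced subgraphs\<close>

lemma edge_doubleton:
  assumes "simple_graph V E" "e \<in> E"
  obtains p q where "e = {p, q}" "p \<noteq> q" "p \<in> V" "q \<in> V"
proof -
  have "card e = 2" "e \<subseteq> V" using assms by (auto simp: simple_graph_def)
  then show ?thesis using that by (auto simp: card_2_iff)
qed

lemma no_loop: "simple_graph V E \<Longrightarrow> {p} \<notin> E"
  by (auto simp: simple_graph_def)

text \<open>Being a cover is phrased as independence of the complement, so that instances reduce to
  listed edges and non-edges. The case p = q is included, which is why \<open>no_loop\<close>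
  accompanies the uses.\<close>

lemma symb_on_induced_covers:
  assumes G: "simple_graph V E" and "finite W"
    and C: "\<And>C. C \<in> \<C> \<Longrightarrow> C \<subseteq> W \<and> (\<forall>p\<in>W - C. \<forall>q\<in>W - C. {p, q} \<notin> E)"
    and B: "\<And>B. B \<subseteq> W \<Longrightarrow> \<forall>p\<in>W. \<forall>q\<in>W. {p, q} \<in> E \<longrightarrow> p \<in> B \<or> q \<in> B \<Longrightarrow> \<exists>C\<in>\<C>. C \<subseteq> B"
  shows "symb_on W (induced_edges E W) n f \<longleftrightarrow> (\<forall>C\<in>\<C>. n \<le> sum f C)"
proof (rule symb_on_covers[OF assms(2)])
  fix D assume D: "D \<in> \<C>"
  have "e \<inter> D \<noteq> {}" if e: "e \<in> E" "e \<subseteq> W" for e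
  proof -
    obtain p q where "e = {p, q}" by (rule edge_doubleton[OF G e(1)])
    then show ?thesis using C[OF D] e by blast
  qed
  then show "D \<subseteq> W \<and> (\<forall>e\<in>induced_edges E W. e \<inter> D \<noteq> {})"
    using C[OF D] by (auto simp: induced_edges_def)
next
  fix D assume D: "D \<subseteq> W" "\<forall>e\<in>induced_edges E W. e \<inter> D \<noteq> {}"
  have "p \<in> D \<or> q \<in> D" if "p \<in> W" "q \<in> W" "{p, q} \<in> E" for p q
  proof -
    have "{p, q} \<in> induced_edges E W" using that by (simp add: induced_edges_def)
    then have "{p, q} \<inter> D \<noteq> {}" using D(2) by (rule bspec[rotated])
    then show ?thesis by blast
  qed
  then show "\<exists>C\<in>\<C>. C \<subseteq> D" by (intro B[OF D(1)]) simp
qed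

text \<open>\<open>a\<close> is (xy)(xz)(xw)^k; \<open>b\<close> and \<open>c\<close> are
  (xy)(xw)^(k+1) and (xz)(xw)^(k+1). A member below \<open>m\<close> with exponent at most k at
  \<open>w\<close> needs both \<open>y\<close> and \<open>z\<close>, so it is a multiple of
  \<open>a\<close>; any other has exponent k + 1 at \<open>w\<close> and completes \<open>a\<close>
  to \<open>m\<close>.\<close>

lemma not_scarf_claw:
  assumes G: "simple_graph V E" and n: "2 \<le> n"
    and V: "{x, y, z, w} \<subseteq> V" and d: "distinct [x, y, z, w]"
    and e: "{x, y} \<in> E" "{x, z} \<in> E" "{x, w} \<in> E" "{y, z} \<notin> E" "{y, w} \<notin> E" "{z, w} \<notin> E"
  shows "\<not> is_scarf V (edge_ideal_symbolic_power V E n :: ('v, 'k::field) mpoly set)"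
proof -
  obtain k where k: "n = k + 2" using n le_Suc_ex by (metis add.commute)
  have "symb_on {x, y, z, w} (induced_edges E {x, y, z, w}) n f \<longleftrightarrow>
      (\<forall>C\<in>{{x}, {y, z, w}}. n \<le> sum f C)" for f
    by (rule symb_on_induced_covers[OF G])
      (use d e no_loop[OF G] in \<open>auto simp: insert_commute\<close>)
  then have P: "symb_on {x, y, z, w} (induced_edges E {x, y, z, w}) n f \<longleftrightarrow>
      n \<le> f x \<and> n \<le> f y + f z + f w" for f
    using d by (simp add: add.assoc)
  show ?thesis
    by (rule symbolic_not_scarf_isolated[OF G V P,
        where a = "(\<lambda>_. 0)(x := k + 2, y := 1, z := 1, w := k)"
          and b = "(\<lambda>_. 0)(x := k + 2, y := 1, w := k + 1)"
          and c = "(\<lambda>_. 0)(x := k + 2, z := 1, w := k + 1)"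
          and m = "(\<lambda>_. 0)(x := k + 2, y := 1, z := 1, w := k + 1)"])
      (use d in \<open>auto simp: k max_def\<close>)
qed

text \<open>As for the claw, with the triangle xyz, of symbolic order 2, in place of (xy)(xz). A
  member below \<open>m\<close> that misses \<open>y\<close> or \<open>z\<close> must attain
  \<open>m\<close> at \<open>x\<close> and \<open>w\<close>.\<close>

lemma not_scarf_paw:
  assumes G: "simple_graph V E" and n: "2 \<le> n"
    and V: "{x, y, z, w} \<subseteq> V" and d: "distinct [x, y, z, w]"
    and e: "{x, y} \<in> E" "{x, z} \<in> E" "{x, w} \<in> E" "{y, z} \<in> E" "{y, w} \<notin> E" "{z, w} \<notin> E"
  shows "\<not> is_scarf V (edge_ideal_symbolic_power V E n :: ('v, 'k::field) mpoly set)"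
proof -
  obtain k where k: "n = k + 2" using n le_Suc_ex by (metis add.commute)
  have "symb_on {x, y, z, w} (induced_edges E {x, y, z, w}) n f \<longleftrightarrow>
      (\<forall>C\<in>{{x, y}, {x, z}, {y, z, w}}. n \<le> sum f C)" for f
    by (rule symb_on_induced_covers[OF G])
      (use d e no_loop[OF G] in \<open>auto simp: insert_commute\<close>)
  then have P: "symb_on {x, y, z, w} (induced_edges E {x, y, z, w}) n f \<longleftrightarrow>
      n \<le> f x + f y \<and> n \<le> f x + f z \<and> n \<le> f y + f z + f w" for f
    using d by (simp add: add.assoc)
  show ?thesis
    by (rule symbolic_not_scarf_isolated[OF G V P,
        where a = "(\<lambda>_. 0)(x := k + 1, y := 1, z := 1, w := k)"
          and b = "(\<lambda>_. 0)(x := k + 2, y := 1, w := k + 1)"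
          and c = "(\<lambda>_. 0)(x := k + 2, z := 1, w := k + 1)"
          and m = "(\<lambda>_. 0)(x := k + 2, y := 1, z := 1, w := k + 1)"])
      (use d in \<open>auto simp: k max_def\<close>)
qed

text \<open>(xz)^k times (xz)(xw), xyz and xyw. Here \<open>a\<close> and \<open>m\<close> differ
  only at \<open>y\<close>, and a member below \<open>m\<close> without \<open>y\<close> is a
  multiple of \<open>a\<close>.\<close>

lemma not_scarf_diamond:
  assumes G: "simple_graph V E" and n: "2 \<le> n"
    and V: "{x, y, z, w} \<subseteq> V" and d: "distinct [x, y, z, w]"
    and e: "{x, y} \<in> E" "{x, z} \<in> E" "{x, w} \<in> E" "{y, z} \<in> E" "{y, w} \<in> E" "{z, w} \<notin> E"
  shows "\<not> is_scarf V (edge_ideal_symbolic_power V E n :: ('v, 'k::field) mpoly set)"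
proof -
  obtain k where k: "n = k + 2" using n le_Suc_ex by (metis add.commute)
  have "symb_on {x, y, z, w} (induced_edges E {x, y, z, w}) n f \<longleftrightarrow>
      (\<forall>C\<in>{{x, y}, {x, z, w}, {y, z, w}}. n \<le> sum f C)" for f
    by (rule symb_on_induced_covers[OF G])
      (use d e no_loop[OF G] in \<open>auto simp: insert_commute\<close>)
  then have P: "symb_on {x, y, z, w} (induced_edges E {x, y, z, w}) n f \<longleftrightarrow>
      n \<le> f x + f y \<and> n \<le> f x + f z + f w \<and> n \<le> f y + f z + f w" for f
    using d by (simp add: add.assoc)
  show ?thesis
    by (rule symbolic_not_scarf_isolated[OF G V P,
        where a = "(\<lambda>_. 0)(x := k + 2, z := k + 1, w := 1)"
          and b = "(\<lambda>_. 0)(x := k + 1, y := 1, z := k + 1)"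
          and c = "(\<lambda>_. 0)(x := k + 1, y := 1, z := k, w := 1)"
          and m = "(\<lambda>_. 0)(x := k + 2, y := 1, z := k + 1, w := 1)"])
      (use d in \<open>auto simp: k max_def\<close>)
qed

text \<open>(zw)^k times the triangles yzw, xzw and xyw. Here \<open>a\<close> and \<open>m\<close>
  differ only at \<open>x\<close>, and a member below \<open>m\<close> without \<open>x\<close> is a
  multiple of \<open>a\<close>.\<close>

lemma not_scarf_complete_4:
  assumes G: "simple_graph V E" and n: "2 \<le> n"
    and V: "{x, y, z, w} \<subseteq> V" and d: "distinct [x, y, z, w]"
    and e: "{x, y} \<in> E" "{x, z} \<in> E" "{x, w} \<in> E" "{y, z} \<in> E" "{y, w} \<in> E" "{z, w} \<in> E"
  shows "\<not> is_scarf V (edge_ideal_symbolic_power V E n :: ('v, 'k::field) mpoly set)"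
proof -
  obtain k where k: "n = k + 2" using n le_Suc_ex by (metis add.commute)
  have "symb_on {x, y, z, w} (induced_edges E {x, y, z, w}) n f \<longleftrightarrow>
      (\<forall>C\<in>{{x, y, z}, {x, y, w}, {x, z, w}, {y, z, w}}. n \<le> sum f C)" for f
    by (rule symb_on_induced_covers[OF G])
      (use d e no_loop[OF G] in \<open>auto simp: insert_commute\<close>)
  then have P: "symb_on {x, y, z, w} (induced_edges E {x, y, z, w}) n f \<longleftrightarrow>
      n \<le> f x + f y + f z \<and> n \<le> f x + f y + f w \<and> n \<le> f x + f z + f w \<and> n \<le> f y + f z + f w" for f
    using d by (simp add: add.assoc)
  show ?thesis
    by (rule symbolic_not_scarf_isolated[OF G V P,
        where a = "(\<lambda>_. 0)(y := 1, z := k + 1, w := k + 1)"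
          and b = "(\<lambda>_. 0)(x := 1, z := k + 1, w := k + 1)"
          and c = "(\<lambda>_. 0)(x := 1, y := 1, z := k, w := k + 1)"
          and m = "(\<lambda>_. 0)(x := 1, y := 1, z := k + 1, w := k + 1)"])
      (use d in \<open>auto simp: k max_def\<close>)
qed

text \<open>(xyz)^k times each of the three edges: any two of these generators have the same lcm, so
  none of the joining edges is Scarf.\<close>

lemma not_scarf_odd_triangle:
  assumes G: "simple_graph V E" and n: "odd n"
    and V: "{x, y, z} \<subseteq> V" and d: "distinct [x, y, z]"
    and e: "{x, y} \<in> E" "{x, z} \<in> E" "{y, z} \<in> E"
  shows "\<not> is_scarf V (edge_ideal_symbolic_power V E n :: ('v, 'k::field) mpoly set)"
proof -
  obtain k where k: "n = 2 * k + 1" using n by (rule oddE)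
  have "symb_on {x, y, z} (induced_edges E {x, y, z}) n f \<longleftrightarrow>
      (\<forall>C\<in>{{x, y}, {x, z}, {y, z}}. n \<le> sum f C)" for f
    by (rule symb_on_induced_covers[OF G])
      (use d e no_loop[OF G] in \<open>auto simp: insert_commute\<close>)
  then have P: "symb_on {x, y, z} (induced_edges E {x, y, z}) n f \<longleftrightarrow>
      n \<le> f x + f y \<and> n \<le> f x + f z \<and> n \<le> f y + f z" for f
    using d by (simp add: add.assoc)
  show ?thesis
    by (rule symbolic_not_scarf_isolated[OF G V P,
        where a = "(\<lambda>_. 0)(x := k, y := k + 1, z := k + 1)"
          and b = "(\<lambda>_. 0)(x := k + 1, y := k, z := k + 1)"
          and c = "(\<lambda>_. 0)(x := k + 1, y := k + 1, z := k)"
          and m = "(\<lambda>_. 0)(x := k + 1, y := k + 1, z := k + 1)"])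
      (use d in \<open>auto simp: k max_def\<close>)
qed

text \<open>(uv)^k times (xy)(yz), (xy)(uv) and (yz)(uv). A member below \<open>m\<close> with
  exponent at most k at \<open>u\<close> or \<open>v\<close> must make up for it on the path and
  becomes a multiple of \<open>a\<close>.\<close>

lemma not_scarf_path_2_edge:
  assumes G: "simple_graph V E" and n: "2 \<le> n"
    and V: "{x, y, z, u, v} \<subseteq> V" and d: "distinct [x, y, z, u, v]"
    and e: "{x, y} \<in> E" "{x, z} \<notin> E" "{x, u} \<notin> E" "{x, v} \<notin> E" "{y, z} \<in> E"
      "{y, u} \<notin> E" "{y, v} \<notin> E" "{z, u} \<notin> E" "{z, v} \<notin> E" "{u, v} \<in> E"
  shows "\<not> is_scarf V (edge_ideal_symbolic_power V E n :: ('v, 'k::field) mpoly set)"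
proof -
  obtain k where k: "n = k + 2" using n le_Suc_ex by (metis add.commute)
  have "symb_on {x, y, z, u, v} (induced_edges E {x, y, z, u, v}) n f \<longleftrightarrow>
      (\<forall>C\<in>{{y, u}, {y, v}, {x, z, u}, {x, z, v}}. n \<le> sum f C)" for f
    by (rule symb_on_induced_covers[OF G])
      (use d e no_loop[OF G] in \<open>auto simp: insert_commute\<close>)
  then have P: "symb_on {x, y, z, u, v} (induced_edges E {x, y, z, u, v}) n f \<longleftrightarrow>
      n \<le> f y + f u \<and> n \<le> f y + f v \<and> n \<le> f x + f z + f u \<and> n \<le> f x + f z + f v" for f
    using d by (simp add: add.assoc)
  show ?thesis
    by (rule symbolic_not_scarf_isolated[OF G V P,
        where a = "(\<lambda>_. 0)(x := 1, y := 2, z := 1, u := k, v := k)"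
          and b = "(\<lambda>_. 0)(x := 1, y := 1, u := k + 1, v := k + 1)"
          and c = "(\<lambda>_. 0)(y := 1, z := 1, u := k + 1, v := k + 1)"
          and m = "(\<lambda>_. 0)(x := 1, y := 2, z := 1, u := k + 1, v := k + 1)"])
      (use d in \<open>auto simp: k max_def\<close>)
qed

text \<open>(uv)^k times xyz, (xy)(uv) and (yz)(uv); the argument is that for the path plus an edge,
  with xyz in place of (xy)(yz).\<close>

lemma not_scarf_triangle_edge:
  assumes G: "simple_graph V E" and n: "2 \<le> n"
    and V: "{x, y, z, u, v} \<subseteq> V" and d: "distinct [x, y, z, u, v]"
    and e: "{x, y} \<in> E" "{x, z} \<in> E" "{x, u} \<notin> E" "{x, v} \<notin> E" "{y, z} \<in> E"
      "{y, u} \<notin> E" "{y, v} \<notin> E" "{z, u} \<notin> E" "{z, v} \<notin> E" "{u, v} \<in> E"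
  shows "\<not> is_scarf V (edge_ideal_symbolic_power V E n :: ('v, 'k::field) mpoly set)"
proof -
  obtain k where k: "n = k + 2" using n le_Suc_ex by (metis add.commute)
  have "symb_on {x, y, z, u, v} (induced_edges E {x, y, z, u, v}) n f \<longleftrightarrow>
      (\<forall>C\<in>{{x, y, u}, {x, y, v}, {x, z, u}, {x, z, v}, {y, z, u}, {y, z, v}}. n \<le> sum f C)" for f
    by (rule symb_on_induced_covers[OF G])
      (use d e no_loop[OF G] in \<open>auto simp: insert_commute\<close>)
  then have P: "symb_on {x, y, z, u, v} (induced_edges E {x, y, z, u, v}) n f \<longleftrightarrow>
      n \<le> f x + f y + f u \<and> n \<le> f x + f y + f v \<and> n \<le> f x + f z + f u \<and>
      n \<le> f x + f z + f v \<and> n \<le> f y + f z + f u \<and> n \<le> f y + f z + f v" for f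
    using d by (simp add: add.assoc)
  show ?thesis
    by (rule symbolic_not_scarf_isolated[OF G V P,
        where a = "(\<lambda>_. 0)(x := 1, y := 1, z := 1, u := k, v := k)"
          and b = "(\<lambda>_. 0)(x := 1, y := 1, u := k + 1, v := k + 1)"
          and c = "(\<lambda>_. 0)(y := 1, z := 1, u := k + 1, v := k + 1)"
          and m = "(\<lambda>_. 0)(x := 1, y := 1, z := 1, u := k + 1, v := k + 1)"])
      (use d in \<open>auto simp: k max_def\<close>)
qed

text \<open>(uv)^k times (xy)(zw), (xy)(uv) and (zw)(uv), again trading copies of uv for the other
  edges.\<close>

lemma not_scarf_three_edges:
  assumes G: "simple_graph V E" and n: "2 \<le> n"
    and V: "{x, y, z, w, u, v} \<subseteq> V" and d: "distinct [x, y, z, w, u, v]"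
    and e: "{x, y} \<in> E" "{x, z} \<notin> E" "{x, w} \<notin> E" "{x, u} \<notin> E" "{x, v} \<notin> E"
      "{y, z} \<notin> E" "{y, w} \<notin> E" "{y, u} \<notin> E" "{y, v} \<notin> E" "{z, w} \<in> E"
      "{z, u} \<notin> E" "{z, v} \<notin> E" "{w, u} \<notin> E" "{w, v} \<notin> E" "{u, v} \<in> E"
  shows "\<not> is_scarf V (edge_ideal_symbolic_power V E n :: ('v, 'k::field) mpoly set)"
proof -
  obtain k where k: "n = k + 2" using n le_Suc_ex by (metis add.commute)
  have "symb_on {x, y, z, w, u, v} (induced_edges E {x, y, z, w, u, v}) n f \<longleftrightarrow>
      (\<forall>C\<in>{{x, z, u}, {x, z, v}, {x, w, u}, {x, w, v}, {y, z, u}, {y, z, v}, {y, w, u},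
        {y, w, v}}. n \<le> sum f C)" for f
    by (rule symb_on_induced_covers[OF G])
      (use d e no_loop[OF G] in \<open>auto simp: insert_commute\<close>)
  then have P: "symb_on {x, y, z, w, u, v} (induced_edges E {x, y, z, w, u, v}) n f \<longleftrightarrow>
      n \<le> f x + f z + f u \<and> n \<le> f x + f z + f v \<and> n \<le> f x + f w + f u \<and>
      n \<le> f x + f w + f v \<and> n \<le> f y + f z + f u \<and> n \<le> f y + f z + f v \<and>
      n \<le> f y + f w + f u \<and> n \<le> f y + f w + f v" for f
    using d by (simp add: add.assoc)
  show ?thesis
    by (rule symbolic_not_scarf_isolated[OF G V P,
        where a = "(\<lambda>_. 0)(x := 1, y := 1, z := 1, w := 1, u := k, v := k)"
          and b = "(\<lambda>_. 0)(x := 1, y := 1, u := k + 1, v := k + 1)"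
          and c = "(\<lambda>_. 0)(z := 1, w := 1, u := k + 1, v := k + 1)"
          and m = "(\<lambda>_. 0)(x := 1, y := 1, z := 1, w := 1, u := k + 1, v := k + 1)"])
      (use d in \<open>auto simp: k max_def\<close>)
qed

text \<open>The square is (xy)^k times (xy)(yz), (xy)(zw), (yz)(zw) and (yz)^2, in this cyclic
  order.\<close>

lemma not_scarf_path_3:
  assumes G: "simple_graph V E" and n: "2 \<le> n"
    and V: "{x, y, z, w} \<subseteq> V" and d: "distinct [x, y, z, w]"
    and e: "{x, y} \<in> E" "{x, z} \<notin> E" "{x, w} \<notin> E" "{y, z} \<in> E" "{y, w} \<notin> E" "{z, w} \<in> E"
  shows "\<not> is_scarf V (edge_ideal_symbolic_power V E n :: ('v, 'k::field) mpoly set)"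
proof -
  obtain k where k: "n = k + 2" using n le_Suc_ex by (metis add.commute)
  have "symb_on {x, y, z, w} (induced_edges E {x, y, z, w}) n f \<longleftrightarrow>
      (\<forall>C\<in>{{y, z}, {x, z}, {y, w}}. n \<le> sum f C)" for f
    by (rule symb_on_induced_covers[OF G])
      (use d e no_loop[OF G] in \<open>auto simp: insert_commute\<close>)
  then have P: "symb_on {x, y, z, w} (induced_edges E {x, y, z, w}) n f \<longleftrightarrow>
      n \<le> f y + f z \<and> n \<le> f x + f z \<and> n \<le> f y + f w" for f
    using d by (simp add: add.assoc)
  show ?thesis
    by (rule symbolic_not_scarf_square[OF G V P,
        where a = "(\<lambda>_. 0)(x := k + 1, y := k + 2, z := 1)"
          and b = "(\<lambda>_. 0)(x := k + 1, y := k + 1, z := 1, w := 1)"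
          and c = "(\<lambda>_. 0)(x := k, y := k + 1, z := 2, w := 1)"
          and d = "(\<lambda>_. 0)(x := k, y := k + 2, z := 2)"
          and m = "(\<lambda>_. 0)(x := k + 1, y := k + 2, z := 2, w := 1)"])
      (use d in \<open>auto simp: k max_def\<close>)
qed

text \<open>The square is (xy)^(k+1) times the four edges xy, xw, zw, yz in this cyclic
  order.\<close>

lemma not_scarf_cycle_4:
  assumes G: "simple_graph V E" and n: "2 \<le> n"
    and V: "{x, y, z, w} \<subseteq> V" and d: "distinct [x, y, z, w]"
    and e: "{x, y} \<in> E" "{x, z} \<notin> E" "{x, w} \<in> E" "{y, z} \<in> E" "{y, w} \<notin> E" "{z, w} \<in> E"
  shows "\<not> is_scarf V (edge_ideal_symbolic_power V E n :: ('v, 'k::field) mpoly set)"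
proof -
  obtain k where k: "n = k + 2" using n le_Suc_ex by (metis add.commute)
  have "symb_on {x, y, z, w} (induced_edges E {x, y, z, w}) n f \<longleftrightarrow>
      (\<forall>C\<in>{{x, z}, {y, w}}. n \<le> sum f C)" for f
    by (rule symb_on_induced_covers[OF G])
      (use d e no_loop[OF G] in \<open>auto simp: insert_commute\<close>)
  then have P: "symb_on {x, y, z, w} (induced_edges E {x, y, z, w}) n f \<longleftrightarrow>
      n \<le> f x + f z \<and> n \<le> f y + f w" for f
    using d by (simp add: add.assoc)
  show ?thesis
    by (rule symbolic_not_scarf_square[OF G V P,
        where a = "(\<lambda>_. 0)(x := k + 2, y := k + 2)"
          and b = "(\<lambda>_. 0)(x := k + 2, y := k + 1, w := 1)"
          and c = "(\<lambda>_. 0)(x := k + 1, y := k + 1, z := 1, w := 1)"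
          and d = "(\<lambda>_. 0)(x := k + 1, y := k + 2, z := 1)"
          and m = "(\<lambda>_. 0)(x := k + 2, y := k + 2, z := 1, w := 1)"])
      (use d in \<open>auto simp: k max_def\<close>)
qed

section \<open>The Scarf graphs\<close>

text \<open>The ideal is principal, generated by (ab)^n, so the tree is just its root.\<close>

lemma scarf_single_edge:
  assumes "2 \<le> n" "a \<noteq> b"
  shows "is_scarf {a, b} (edge_ideal_symbolic_power {a, b} {{a, b}} n :: ('v, 'k::field) mpoly set)"
proof -
  have "symb_on {a, b} {{a, b}} n f \<longleftrightarrow> (\<forall>C\<in>{{a}, {b}}. n \<le> sum f C)" for f
    by (rule symb_on_covers) auto
  then have P: "symb_on {a, b} {{a, b}} n f \<longleftrightarrow> n \<le> f a \<and> n \<le> f b" for f by simp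
  show ?thesis
    by (rule symbolic_scarf_tree[OF _ _ _ P, where J = "{0}" and r = 0 and depth = "\<lambda>i::nat. i"
        and g = "\<lambda>_ _. n" and par = "\<lambda>i. i"])
      (use assms in \<open>auto simp: simple_graph_def\<close>)
qed

text \<open>The generators are (xy)^i (yz)^(n-i), forming a path rooted at i = 0. The lcm of two of
  them is divisible exactly by those with index in between, which yields both \<open>colon\<close>
  and \<open>third\<close>.\<close>

lemma scarf_path_2:
  assumes "2 \<le> n" "distinct [x, y, z]"
  shows "is_scarf {x, y, z}
    (edge_ideal_symbolic_power {x, y, z} {{x, y}, {y, z}} n :: ('v, 'k::field) mpoly set)"
proof -
  have "symb_on {x, y, z} {{x, y}, {y, z}} n f \<longleftrightarrow> (\<forall>C\<in>{{y}, {x, z}}. n \<le> sum f C)" for f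
    by (rule symb_on_covers) auto
  then have P: "symb_on {x, y, z} {{x, y}, {y, z}} n f \<longleftrightarrow> n \<le> f y \<and> n \<le> f x + f z" for f
    using assms(2) by simp
  show ?thesis
  proof (rule symbolic_scarf_tree[OF _ _ _ P, where J = "{..n}" and r = 0 and depth = "\<lambda>i::nat. i"
        and g = "\<lambda>i. (\<lambda>_. 0)(x := i, y := n, z := n - i)" and par = "\<lambda>i. i - 1"])
    fix f :: "'v \<Rightarrow> nat" assume "n \<le> f y \<and> n \<le> f x + f z"
    then show "\<exists>i\<in>{..n}. \<forall>v\<in>{x, y, z}. ((\<lambda>_. 0)(x := i, y := n, z := n - i)) v \<le> f v"
      using assms(2) by (intro bexI[of _ "min n (f x)"]) auto
  qed (use assms in \<open>auto simp: simple_graph_def max_def split: if_splits\<close>)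
qed

text \<open>The generators (xy)^i (zw)^(n-i) form a path, for the same reason as for the path of
  length two.\<close>

lemma scarf_two_edges:
  assumes "2 \<le> n" "distinct [x, y, z, w]"
  shows "is_scarf {x, y, z, w}
    (edge_ideal_symbolic_power {x, y, z, w} {{x, y}, {z, w}} n :: ('v, 'k::field) mpoly set)"
proof -
  have "symb_on {x, y, z, w} {{x, y}, {z, w}} n f \<longleftrightarrow>
      (\<forall>C\<in>{{x, z}, {x, w}, {y, z}, {y, w}}. n \<le> sum f C)" for f
    by (rule symb_on_covers) auto
  then have P: "symb_on {x, y, z, w} {{x, y}, {z, w}} n f \<longleftrightarrow>
      n \<le> f x + f z \<and> n \<le> f x + f w \<and> n \<le> f y + f z \<and> n \<le> f y + f w" for f
    using assms(2) by simp
  show ?thesis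
  proof (rule symbolic_scarf_tree[OF _ _ _ P, where J = "{..n}" and r = 0 and depth = "\<lambda>i::nat. i"
        and g = "\<lambda>i. (\<lambda>_. 0)(x := i, y := i, z := n - i, w := n - i)" and par = "\<lambda>i. i - 1"])
    fix f :: "'v \<Rightarrow> nat"
    assume "n \<le> f x + f z \<and> n \<le> f x + f w \<and> n \<le> f y + f z \<and> n \<le> f y + f w"
    \<comment> \<open>The index is the largest power of xy dividing \<open>f\<close>, capped at n.
      Below the cap one of \<open>x\<close>, \<open>y\<close> attains it, and its two inequalities
      leave at least n - i at \<open>z\<close> and \<open>w\<close>.\<close>
    then show "\<exists>i\<in>{..n}. \<forall>v\<in>{x, y, z, w}.
        ((\<lambda>_. 0)(x := i, y := i, z := n - i, w := n - i)) v \<le> f v"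
      using assms(2) by (intro bexI[of _ "min n (min (f x) (f y))"]) auto
  qed (use assms in \<open>auto simp: simple_graph_def max_def split: if_splits\<close>)
qed

text \<open>The generators are \<open>(k, k, k)\<close> and, for each vertex \<open>v\<close> and \<open>1 \<le> s \<le> k\<close>, the exponent
  vector with entry \<open>k - s\<close> at \<open>v\<close> and \<open>k + s\<close> elsewhere: a tree with three branches.\<close>

lemma scarf_even_triangle:
  assumes "1 \<le> k" "distinct [x, y, z]"
  shows "is_scarf {x, y, z}
    (edge_ideal_symbolic_power {x, y, z} {{x, y}, {y, z}, {x, z}} (2 * k) :: ('v, 'k::field) mpoly set)"
proof -
  let ?V = "{x, y, z}"
  have "symb_on ?V {{x, y}, {y, z}, {x, z}} (2 * k) f \<longleftrightarrow>
      (\<forall>C\<in>{{x, y}, {y, z}, {x, z}}. 2 * k \<le> sum f C)" for f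
    by (rule symb_on_covers) auto
  then have P: "symb_on ?V {{x, y}, {y, z}, {x, z}} (2 * k) f \<longleftrightarrow>
      (\<forall>u\<in>?V. \<forall>v\<in>?V. u \<noteq> v \<longrightarrow> 2 * k \<le> f u + f v)" for f
    using assms(2) by (auto simp: add.commute)
  have other: "\<exists>v\<in>?V. v \<noteq> u" for u using assms(2) by auto
  define g :: "'v \<times> nat \<Rightarrow> 'v \<Rightarrow> nat" where
    "g i v = (if v = fst i then k - snd i else k + snd i)" for i v
  \<comment> \<open>At s = 0 all branches meet in (k, k, k); only the pair \<open>(x, 0)\<close>
    stands for it, so that the indexing stays injective.\<close>
  define J where "J = insert (x, 0) (?V \<times> {1..k})"
  define par :: "'v \<times> nat \<Rightarrow> 'v \<times> nat" where
    "par i = (if snd i = 1 then (x, 0) else (fst i, snd i - 1))" for i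
  have J_cases: "i = (x, 0) \<or> (\<exists>u s. i = (u, s) \<and> u \<in> ?V \<and> 1 \<le> s \<and> s \<le> k)" if "i \<in> J" for i
    using that by (auto simp: J_def)
  have snd_le: "snd i \<le> k" and fst_in: "fst i \<in> ?V" if "i \<in> J" for i
    using that by (auto simp: J_def)
  have J_zero: "i = (x, 0)" if "i \<in> J" "snd i = 0" for i
    using that by (auto simp: J_def)
  show ?thesis
  proof (rule symbolic_scarf_tree[OF _ _ _ P, where J = J and r = "(x, 0)" and depth = snd
        and g = g and par = par])
    fix f :: "'v \<Rightarrow> nat" assume f: "\<forall>u\<in>?V. \<forall>v\<in>?V. u \<noteq> v \<longrightarrow> 2 * k \<le> f u + f v"
    show "\<exists>i\<in>J. \<forall>v\<in>?V. g i v \<le> f v"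
    proof (cases "\<forall>v\<in>?V. k \<le> f v")
      case True
      then show ?thesis by (intro bexI[of _ "(x, 0)"]) (auto simp: g_def J_def)
    next
      case False
      then obtain u where u: "u \<in> ?V" "f u < k" by (meson not_le)
      \<comment> \<open>A deficit of k - f u at \<open>u\<close> forces the same surplus over k at
        both other vertices: this is the generator at that distance on the branch of
        \<open>u\<close>.\<close>
      have "g (u, k - f u) v \<le> f v" if "v \<in> ?V" for v
      proof (cases "v = u")
        case False
        then have "2 * k \<le> f u + f v" using f[rule_format, OF u(1) that] by simp
        then show ?thesis using u(2) False by (simp add: g_def)
      qed (use u in \<open>simp add: g_def\<close>)
      moreover have "(u, k - f u) \<in> J" using u unfolding J_def by simp
      ultimately show ?thesis by blast
    qed
  next
    fix i assume i: "i \<in> J"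
    show "\<forall>u\<in>?V. \<forall>v\<in>?V. u \<noteq> v \<longrightarrow> 2 * k \<le> g i u + g i v"
      using snd_le[OF i] by (auto simp: g_def)
    obtain v where "v \<in> ?V" "v \<noteq> fst i" using other by blast
    then show "\<exists>v\<in>?V. g i v \<noteq> 0" using assms(1) by (intro bexI[of _ v]) (auto simp: g_def)
    show "par i \<in> J \<and> snd (par i) < snd i" if "i \<noteq> (x, 0)"
      using J_cases[OF i] that by (auto simp: par_def J_def)
    fix j assume j: "j \<in> J"
    show "i = j" if le: "\<forall>v\<in>?V. g i v \<le> g j v"
    proof -
      obtain v where v: "v \<in> ?V" "v \<noteq> fst j" using other by blast
      have 1: "g i (fst j) \<le> k - snd j" using le fst_in[OF j] by (auto simp: g_def)
      have 2: "g i v \<le> k + snd j" using le v by (auto simp: g_def)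
      show ?thesis
      proof (cases "fst i = fst j")
        case True
        then have "k - snd i \<le> k - snd j" "k + snd i \<le> k + snd j"
          using 1 2 v(2) by (auto simp: g_def)
        then show ?thesis using snd_le[OF i] snd_le[OF j] True by (auto simp: prod_eq_iff)
      next
        case False
        then have "k + snd i \<le> k - snd j" using 1 by (simp add: g_def)
        then have "snd i = 0" "snd j = 0" using snd_le[OF j] by auto
        then show ?thesis using J_zero i j by metis
      qed
    qed
    assume ir: "i \<noteq> (x, 0)"
    then have pos: "1 \<le> snd i" using J_zero[OF i] by (cases "snd i") auto
    show "\<forall>v\<in>?V. g (par i) v \<le> max (g i v) (g j v)" if "i \<noteq> j" "snd j \<le> snd i"
    proof
      fix v
      \<comment> \<open>The parent exceeds \<open>g i\<close> only at \<open>fst i\<close>, and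
        there by one. A shallower \<open>j\<close> on the same branch makes up for this, and on
        another branch \<open>g j\<close> is at least k there.\<close>
      have "fst i = fst j \<Longrightarrow> snd j < snd i" using that by (auto simp: prod_eq_iff order_less_le)
      then show "g (par i) v \<le> max (g i v) (g j v)"
        using pos snd_le[OF i] by (auto simp: g_def par_def max_def)
    qed
    show "j = i \<or> j = par i" if le: "\<forall>v\<in>?V. g j v \<le> max (g i v) (g (par i) v)"
    proof -
      obtain v where v: "v \<in> ?V" "v \<noteq> fst i" using other by blast
      \<comment> \<open>The formula also covers the step into the centre, where \<open>par\<close>
        changes the first component unless it is already \<open>x\<close>.\<close>
      have "g (par i) (fst i) = k + 1 - snd i" "g i (fst i) = k - snd i"
        using pos by (cases "snd i = 1"; simp add: g_def par_def)+
      then have 1: "g j (fst i) \<le> k + 1 - snd i"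
        using bspec[OF le fst_in[OF i]] by simp
      have "g (par i) v \<le> k + snd i" "g i v = k + snd i"
        using v(2) by (cases "snd i = 1"; simp add: g_def par_def)+
      then have 2: "g j v \<le> k + snd i"
        using bspec[OF le v(1)] by simp
      show ?thesis
      proof (cases "fst i = fst j")
        case True
        then have "k - snd j \<le> k + 1 - snd i" "snd j \<le> snd i" using 1 2 v(2) by (auto simp: g_def)
        then have "snd j = snd i \<or> snd j = snd i - 1" using snd_le[OF i] snd_le[OF j] by linarith
        then show ?thesis
          using True J_zero[OF j] by (cases "snd i = 1") (auto simp: par_def prod_eq_iff)
      next
        case False
        then have "k + snd j \<le> k + 1 - snd i" using 1 by (simp add: g_def)
        then have "snd i = 1" "snd j = 0" using pos snd_le[OF i] by linarith+
        then show ?thesis using J_zero[OF j] by (simp add: par_def)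
      qed
    qed
  qed (use assms in \<open>auto simp: simple_graph_def J_def\<close>)
qed


section \<open>The classification\<close>

text \<open>For either status of the pair a, c there are seven nonempty sets of neighbours of
  \<open>w\<close> in the path; each of the fourteen graphs is a claw, paw, diamond, complete graph,
  path or cycle on four vertices.\<close>

lemma scarf_path_not_extendable:
  assumes G: "simple_graph V E" and n: "2 \<le> n"
    and S: "is_scarf V (edge_ideal_symbolic_power V E n :: ('v, 'k::field) mpoly set)"
    and V: "{a, b, c, w} \<subseteq> V" and d: "distinct [a, b, c, w]"
    and e: "{a, b} \<in> E" "{b, c} \<in> E"
  shows "{a, w} \<notin> E \<and> {b, w} \<notin> E \<and> {c, w} \<notin> E"
proof (rule ccontr)
  assume neg: "\<not> ?thesis"
  note claw = not_scarf_claw[OF G n, where ?'k = 'k] and paw = not_scarf_paw[OF G n, where ?'k = 'k]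
    and dia = not_scarf_diamond[OF G n, where ?'k = 'k]
    and path = not_scarf_path_3[OF G n, where ?'k = 'k]
    and cyc = not_scarf_cycle_4[OF G n, where ?'k = 'k]
    and K4 = not_scarf_complete_4[OF G n, where ?'k = 'k]
  have V': "a \<in> V" "b \<in> V" "c \<in> V" "w \<in> V" using V by auto
  show False
  proof (cases "{a, c} \<in> E")
    case False
    consider "{a, w} \<in> E" "{b, w} \<notin> E" "{c, w} \<notin> E" | "{a, w} \<notin> E" "{b, w} \<in> E" "{c, w} \<notin> E"
      | "{a, w} \<notin> E" "{b, w} \<notin> E" "{c, w} \<in> E" | "{a, w} \<in> E" "{b, w} \<in> E" "{c, w} \<notin> E"
      | "{a, w} \<in> E" "{b, w} \<notin> E" "{c, w} \<in> E" | "{a, w} \<notin> E" "{b, w} \<in> E" "{c, w} \<in> E"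
      | "{a, w} \<in> E" "{b, w} \<in> E" "{c, w} \<in> E"
      using neg by blast
    then show False
    proof cases
      case 1 then show ?thesis using path[of w a b c] S V' d e False by (auto simp: insert_commute)
    next
      case 2 then show ?thesis using claw[of b a c w] S V' d e False by (auto simp: insert_commute)
    next
      case 3 then show ?thesis using path[of a b c w] S V' d e False by (auto simp: insert_commute)
    next
      case 4 then show ?thesis using paw[of b a w c] S V' d e False by (auto simp: insert_commute)
    next
      case 5 then show ?thesis using cyc[of a b c w] S V' d e False by (auto simp: insert_commute)
    next
      case 6 then show ?thesis using paw[of b c w a] S V' d e False by (auto simp: insert_commute)
    next
      case 7 then show ?thesis using dia[of b w a c] S V' d e False by (auto simp: insert_commute)
    qed
  next
    case True
    consider "{a, w} \<in> E" "{b, w} \<notin> E" "{c, w} \<notin> E" | "{a, w} \<notin> E" "{b, w} \<in> E" "{c, w} \<notin> E"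
      | "{a, w} \<notin> E" "{b, w} \<notin> E" "{c, w} \<in> E" | "{a, w} \<in> E" "{b, w} \<in> E" "{c, w} \<notin> E"
      | "{a, w} \<in> E" "{b, w} \<notin> E" "{c, w} \<in> E" | "{a, w} \<notin> E" "{b, w} \<in> E" "{c, w} \<in> E"
      | "{a, w} \<in> E" "{b, w} \<in> E" "{c, w} \<in> E"
      using neg by blast
    then show False
    proof cases
      case 1 then show ?thesis using paw[of a b c w] S V' d e True by (auto simp: insert_commute)
    next
      case 2 then show ?thesis using paw[of b a c w] S V' d e True by (auto simp: insert_commute)
    next
      case 3 then show ?thesis using paw[of c a b w] S V' d e True by (auto simp: insert_commute)
    next
      case 4 then show ?thesis using dia[of a b c w] S V' d e True by (auto simp: insert_commute)
    next
      case 5 then show ?thesis using dia[of a c b w] S V' d e True by (auto simp: insert_commute)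
    next
      case 6 then show ?thesis using dia[of b c a w] S V' d e True by (auto simp: insert_commute)
    next
      case 7 then show ?thesis using K4[of a b c w] S V' d e True by (auto simp: insert_commute)
    qed
  qed
qed

lemma path_2_edges:
  "{{[a, b, c] ! i, [a, b, c] ! Suc i} | i. i < 2} = {{a, b}, {b, c}}"
proof -
  have "{{[a, b, c] ! i, [a, b, c] ! Suc i} | i. i < 2}
      = (\<lambda>i. {[a, b, c] ! i, [a, b, c] ! Suc i}) ` {..<2}"
    by blast
  also have "{..<2::nat} = {0, 1}" by auto
  finally show ?thesis by simp
qed

lemma edges_in_triple:
  assumes "simple_graph {a, b, c} E" "e \<in> E"
  shows "e = {a, b} \<or> e = {b, c} \<or> e = {a, c}"
proof -
  obtain p q where "e = {p, q}" "p \<noteq> q" "p \<in> {a, b, c}" "q \<in> {a, b, c}"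
    by (rule edge_doubleton[OF assms])
  then show ?thesis by auto
qed

text \<open>The three vertices of the path are cut off from all others. A further vertex has a
  neighbour, also outside, and that edge next to the path or triangle is forbidden; so these three
  vertices are all of \<open>V\<close>.\<close>

lemma scarf_with_path:
  assumes G: "simple_graph V E" and n: "2 \<le> n"
    and S: "is_scarf V (edge_ideal_symbolic_power V E n :: ('v, 'k::field) mpoly set)"
    and iso: "\<forall>v\<in>V. \<not> isolated_vertex E v"
    and d: "distinct [a, b, c]" and e: "{a, b} \<in> E" "{b, c} \<in> E"
  shows "is_path V E 2 \<or> is_triangle V E \<and> even n"
proof -
  have V': "a \<in> V" "b \<in> V" "c \<in> V" using G e by (auto simp: simple_graph_def)
  have ext: "{a, w} \<notin> E \<and> {b, w} \<notin> E \<and> {c, w} \<notin> E" if "w \<in> V" "w \<notin> {a, b, c}" for w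
    using scarf_path_not_extendable[OF G n S _ _ e, of w] V' that d by auto
  have V: "V = {a, b, c}"
  proof (rule ccontr)
    assume "V \<noteq> {a, b, c}"
    then obtain u where u: "u \<in> V" "u \<notin> {a, b, c}" using V' by blast
    then obtain f where f: "f \<in> E" "u \<in> f" using iso by (auto simp: isolated_vertex_def)
    obtain p q where pq: "f = {p, q}" "p \<noteq> q" "p \<in> V" "q \<in> V" by (rule edge_doubleton[OF G f(1)])
    obtain v where v: "{u, v} \<in> E" "v \<noteq> u" "v \<in> V"
      using f pq by (cases "u = p") (auto simp: insert_commute)
    have "v \<notin> {a, b, c}" using ext[OF u] v(1) by (auto simp: insert_commute)
    then have nv: "{a, v} \<notin> E \<and> {b, v} \<notin> E \<and> {c, v} \<notin> E" by (rule ext[OF v(3)])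
    have D: "distinct [a, b, c, u, v]" using d u v \<open>v \<notin> {a, b, c}\<close> by auto
    have "{a, b, c, u, v} \<subseteq> V" using V' u v by simp
    then show False
      using not_scarf_path_2_edge[OF G n _ D, where ?'k = 'k]
        not_scarf_triangle_edge[OF G n _ D, where ?'k = 'k] S ext[OF u] nv e v(1)
      by blast
  qed
  show ?thesis
  proof (cases "{a, c} \<in> E")
    case True
    have "E = {{a, b}, {b, c}, {a, c}}"
      using edges_in_triple[of a b c E] G e True unfolding V by blast
    moreover have "even n"
      using not_scarf_odd_triangle[OF G _ _ d, where ?'k = 'k] S V e True by blast
    ultimately show ?thesis using V d unfolding is_triangle_def by blast
  next
    case False
    have "E = {{a, b}, {b, c}}"
      using edges_in_triple[of a b c E] G e False unfolding V by blast
    then have "is_path V E 2"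
      unfolding is_path_def using V d
      by (intro exI[of _ "[a, b, c]"]) (simp only: path_2_edges, simp)
    then show ?thesis by blast
  qed
qed

text \<open>Each vertex has exactly one neighbour, so the graph is a disjoint union of edges, and
  three of them are already forbidden.\<close>

lemma scarf_matching:
  assumes G: "simple_graph V E" and n: "2 \<le> n"
    and S: "is_scarf V (edge_ideal_symbolic_power V E n :: ('v, 'k::field) mpoly set)"
    and iso: "\<forall>v\<in>V. \<not> isolated_vertex E v" and "V \<noteq> {}"
    and matching: "\<And>a b c. {a, b} \<in> E \<Longrightarrow> {b, c} \<in> E \<Longrightarrow> a = c"
  shows "is_path V E 1 \<or> is_two_disjoint_edges V E"
proof -
  have partner: "\<exists>v\<in>V. v \<noteq> u \<and> {u, v} \<in> E" if u: "u \<in> V" for u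
  proof -
    obtain f where f: "f \<in> E" "u \<in> f" using iso u by (auto simp: isolated_vertex_def)
    obtain p q where pq: "f = {p, q}" "p \<noteq> q" "p \<in> V" "q \<in> V" by (rule edge_doubleton[OF G f(1)])
    then show ?thesis using f by (cases "u = p") (auto simp: insert_commute)
  qed
  have unique: "v = w" if "{u, v} \<in> E" "{u, w} \<in> E" for u v w
    using matching[of v u w] that by (simp add: insert_commute)
  obtain a where "a \<in> V" using \<open>V \<noteq> {}\<close> by blast
  then obtain b where ab: "b \<in> V" "b \<noteq> a" "{a, b} \<in> E" using partner by blast
  show ?thesis
  proof (cases "V = {a, b}")
    case True
    have "E = {{a, b}}"
    proof -
      have "e = {a, b}" if "e \<in> E" for e
        using edge_doubleton[OF G that] unfolding True by auto
      then show ?thesis using ab(3) by blast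
    qed
    then have "is_path V E 1"
      unfolding is_path_def using True ab(2) by (intro exI[of _ "[a, b]"]) auto
    then show ?thesis by blast
  next
    case False
    then obtain c where c: "c \<in> V" "c \<notin> {a, b}" using \<open>a \<in> V\<close> ab(1) by blast
    then obtain e where ce: "e \<in> V" "e \<noteq> c" "{c, e} \<in> E" using partner by blast
    have e: "e \<notin> {a, b}"
      using unique[of a b c] unique[of b a c] ab(3) ce(3) c(2) by (auto simp: insert_commute)
    have D: "distinct [a, b, c, e]" using ab c ce e by auto
    show ?thesis
    proof (cases "V = {a, b, c, e}")
      case True
      have "f = {a, b} \<or> f = {c, e}" if f: "f \<in> E" for f
      proof -
        obtain p q where pq: "f = {p, q}" "p \<noteq> q" "p \<in> V" "q \<in> V" by (rule edge_doubleton[OF G f])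
        have "{b, a} \<in> E" "{e, c} \<in> E" using ab(3) ce(3) by (simp_all add: insert_commute)
        have pqE: "{p, q} \<in> E" using f pq(1) by simp
        have "p = a \<or> p = b \<or> p = c \<or> p = e" using pq(3) unfolding True by simp
        then have "p = a \<and> q = b \<or> p = b \<and> q = a \<or> p = c \<and> q = e \<or> p = e \<and> q = c"
          using pqE unique[OF ab(3)] unique[OF \<open>{b, a} \<in> E\<close>] unique[OF ce(3)]
            unique[OF \<open>{e, c} \<in> E\<close>] by metis
        then show ?thesis using pq(1) by (auto simp: insert_commute)
      qed
      then have "E = {{a, b}, {c, e}}" using ab(3) ce(3) by blast
      then show ?thesis using True D unfolding is_two_disjoint_edges_def by blast
    next
      case False
      then obtain u where u: "u \<in> V" "u \<notin> {a, b, c, e}" using \<open>a \<in> V\<close> ab(1) c(1) ce(1) by blast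
      then obtain v where uv: "v \<in> V" "v \<noteq> u" "{u, v} \<in> E" using partner by blast
      have sym: "{b, a} \<in> E" "{e, c} \<in> E" "{v, u} \<in> E"
        using ab(3) ce(3) uv(3) by (simp_all add: insert_commute)
      have "{p, u} \<notin> E" if "{p, q} \<in> E" "q \<in> {a, b, c, e}" for p q
        using unique[OF that(1)] that(2) u(2) by blast
      then have "{a, u} \<notin> E" "{b, u} \<notin> E" "{c, u} \<notin> E" "{e, u} \<notin> E"
        using ab(3) ce(3) sym(1,2) by blast+
      then have v: "v \<notin> {a, b, c, e}" using sym(3) by auto
      have D': "distinct [a, b, c, e, u, v]" using D u v uv(2) by auto
      have sub: "{a, b, c, e, u, v} \<subseteq> V" using \<open>a \<in> V\<close> ab(1) c(1) ce(1) u(1) uv(1) by simp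
      \<comment> \<open>The twelve non-edges follow from uniqueness of partners: another edge at
        \<open>a\<close>, \<open>b\<close>, \<open>c\<close> or \<open>e\<close> would give that
        vertex a second neighbour.\<close>
      have "\<not> is_scarf V (edge_ideal_symbolic_power V E n :: ('v, 'k) mpoly set)"
        by (rule not_scarf_three_edges[OF G n sub D' ab(3) _ _ _ _ _ _ _ _ ce(3) _ _ _ _ uv(3)])
          (use D' in \<open>auto dest: unique[OF ab(3)] unique[OF sym(1)] unique[OF ce(3)] unique[OF sym(2)]\<close>)
      then show ?thesis using S by blast
    qed
  qed
qed

theorem theorem1p2:
  fixes V :: "'v set" and E :: "'v set set" and n :: nat
  assumes "n \<ge> 2"
    and "simple_graph V E" and "V \<noteq> {}"
    and "\<forall>v\<in>V. \<not> isolated_vertex E v"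
  shows "is_scarf V (edge_ideal_symbolic_power V E n :: ('v, 'k::field) mpoly set) \<longleftrightarrow>
    (is_path V E 1 \<or> is_path V E 2) \<or>
    (is_triangle V E \<and> even n) \<or>
    is_two_disjoint_edges V E"
proof
  assume S: "is_scarf V (edge_ideal_symbolic_power V E n :: ('v, 'k) mpoly set)"
  show "(is_path V E 1 \<or> is_path V E 2) \<or> (is_triangle V E \<and> even n) \<or> is_two_disjoint_edges V E"
  \<comment> \<open>The alternative is whether two different edges share a vertex.\<close>
  proof (cases "\<exists>a b c. {a, b} \<in> E \<and> {b, c} \<in> E \<and> a \<noteq> c")
    case True
    then obtain a b c where abc: "{a, b} \<in> E" "{b, c} \<in> E" "a \<noteq> c" by blast
    then have "distinct [a, b, c]" using no_loop[OF assms(2)] by auto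
    then show ?thesis using scarf_with_path[OF assms(2,1) S assms(4) _ abc(1,2)] by blast
  next
    case False
    then show ?thesis using scarf_matching[OF assms(2,1) S assms(4,3)] by blast
  qed
next
  assume "(is_path V E 1 \<or> is_path V E 2) \<or> (is_triangle V E \<and> even n) \<or> is_two_disjoint_edges V E"
  then consider "is_path V E 1" | "is_path V E 2" | "is_triangle V E" "even n"
    | "is_two_disjoint_edges V E" by blast
  then show "is_scarf V (edge_ideal_symbolic_power V E n :: ('v, 'k) mpoly set)"
  proof cases
    case 1
    then obtain vs where vs: "distinct vs" "length vs = 2" "V = set vs"
      "E = {{vs ! i, vs ! Suc i} | i. i < 1}" by (auto simp: is_path_def)
    then obtain a b where ab: "vs = [a, b]" by (auto simp: length_Suc_conv numeral_2_eq_2)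
    have "E = {{a, b}}" unfolding vs(4) ab by auto
    then show ?thesis using scarf_single_edge[OF assms(1), of a b] vs(1,3) ab by simp
  next
    case 2
    then obtain vs where vs: "distinct vs" "length vs = 3" "V = set vs"
      "E = {{vs ! i, vs ! Suc i} | i. i < 2}" by (auto simp: is_path_def)
    then obtain a b c where abc: "vs = [a, b, c]" by (auto simp: length_Suc_conv numeral_3_eq_3)
    have "E = {{a, b}, {b, c}}" unfolding vs(4) abc by (rule path_2_edges)
    then show ?thesis using scarf_path_2[OF assms(1), of a b c] vs(1,3) abc by simp
  next
    case 3
    then obtain a b c where abc: "distinct [a, b, c]" "V = {a, b, c}"
      "E = {{a, b}, {b, c}, {a, c}}" by (auto simp: is_triangle_def)
    obtain k where "n = 2 * k" using 3(2) by (rule evenE)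
    then show ?thesis using scarf_even_triangle[OF _ abc(1), of k] assms(1) abc(2,3) by simp
  next
    case 4
    then obtain a b c d where "distinct [a, b, c, d]" "V = {a, b, c, d}" "E = {{a, b}, {c, d}}"
      by (auto simp: is_two_disjoint_edges_def)
    then show ?thesis using scarf_two_edges[OF assms(1), of a b c d] by simp
  qed
qed

end
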